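(* Let $H$ be a BLS-hole with integral vertex coordinates and let $r=(w,h)$ be a rectangle with positive integers $w,h$. Then the set of all feasible BL-stable locations for placing $r$ within $H$ can be computed in $O(nv(H))$ time, given $H$ as a doubly-linked list of its vertices in boundary order with pointers to its leftmost edges, left notches and rightmost edge and to its falling corner (if one exists).
   Context: A hole is a set $H=J\cup I$ where $J$ is a closed rectilinear arc (a closed Jordan curve that is a finite union of axis-parallel segments) and $I$ its bounded inner region; $nv(H)$ is its number of vertices. Edges are the maximal straight segments of $J$, vertices the points where two edges meet. Clockwise traversal of $J$ labels edges leftward/rightward/upward/downward by traversal direction. For a vertical edge $e$ whose two adjacent horizontal edges both extend to the left of $e$: $e$ is a rightmost edge if the interior of $H$ near $e$ lies to its left, a left notch if to its right. For a vertical edge whose two adjacent horizontal edges both extend to the right: it is a leftmost edge if the interior lies to its right, a right notch if to its left. A horizontal edge whose two adjacent vertical edges extend above it is a top notch if the interior near it lies below it. A falling corner is a vertex whose clockwise-preceding edge is downward and clockwise-succeeding edge rightward. A BLS-hole is a hole with no right notch, no top notch and at most one falling corner. A point $p=(p_1,p_2)$ is a feasible location for $(w,h)$ within $H$ if $[p_1,p_1+w]\times[p_2,p_2+h]\subseteq H$; it is a feasible BL-stable location if moreover there is $\varepsilon>0$ such that for every $t\in(0,\varepsilon)$ neither $(p_1-t,p_2)$ nor $(p_1,p_2-t)$ is a feasible location within $H$. *)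

theory Defs
  imports "HOL-Analysis.Analysis"
begin

section \<open>Holes\<close>

type_synonym point = "real \<times> real"

definition axis_parallel :: "point \<Rightarrow> point \<Rightarrow> bool" where
  "axis_parallel a b \<longleftrightarrow> fst a = fst b \<or> snd a = snd b"

definition closed_rectilinear_arc :: "point set \<Rightarrow> bool" where
  "closed_rectilinear_arc J \<longleftrightarrow>
     (\<exists>g. simple_path g \<and> pathfinish g = pathstart g \<and> path_image g = J) \<and>
     (\<exists>S. finite S \<and> (\<forall>s\<in>S. \<exists>a b. axis_parallel a b \<and> s = closed_segment a b) \<and> J = \<Union>S)"

text \<open>A hole is given by its boundary curve \<open>J\<close>; the bounded inner region is \<^term>\<open>inside J\<close>.\<close>

definition hole :: "point set \<Rightarrow> point set" where
  "hole J = J \<union> inside J"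

definition is_edge :: "point set \<Rightarrow> point \<Rightarrow> point \<Rightarrow> bool" where
  "is_edge J a b \<longleftrightarrow> a \<noteq> b \<and> closed_segment a b \<subseteq> J \<and>
     (\<forall>c d. closed_segment a b \<subseteq> closed_segment c d \<and> closed_segment c d \<subseteq> J
        \<longrightarrow> closed_segment c d = closed_segment a b)"

definition edges :: "point set \<Rightarrow> point set set" where
  "edges J = {closed_segment a b | a b. is_edge J a b}"

definition vertices :: "point set \<Rightarrow> point set" where
  "vertices J = {v. \<exists>e1\<in>edges J. \<exists>e2\<in>edges J. e1 \<noteq> e2 \<and> v \<in> e1 \<and> v \<in> e2}"

definition nv :: "point set \<Rightarrow> nat" where
  "nv J = card (vertices J)"

text \<open>The interior of the hole near the segment from \<open>a\<close> to \<open>b\<close> lies in direction \<open>d\<close> of it.\<close>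

definition interior_on :: "point set \<Rightarrow> point \<Rightarrow> point \<Rightarrow> point \<Rightarrow> bool" where
  "interior_on J a b d \<longleftrightarrow>
     (\<forall>x\<in>open_segment a b. \<exists>\<epsilon>>0. \<forall>t. 0 < t \<and> t < \<epsilon> \<longrightarrow> x + t *\<^sub>R d \<in> inside J)"

text \<open>Clockwise traversal keeps the interior on the right-hand side: the last argument below is
  \<open>b - a\<close> turned clockwise by a right angle.\<close>

definition cw_edge :: "point set \<Rightarrow> point \<Rightarrow> point \<Rightarrow> bool" where
  "cw_edge J a b \<longleftrightarrow>
     is_edge J a b \<and> interior_on J a b (snd b - snd a, - (fst b - fst a))"

definition adjacent_left :: "point set \<Rightarrow> point \<Rightarrow> point \<Rightarrow> bool" where
  "adjacent_left J a b \<longleftrightarrow> is_edge J a b \<and> fst a = fst b \<and>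
     (\<exists>p. is_edge J p a \<and> snd p = snd a \<and> fst p < fst a) \<and>
     (\<exists>q. is_edge J b q \<and> snd q = snd b \<and> fst q < fst b)"

definition adjacent_right :: "point set \<Rightarrow> point \<Rightarrow> point \<Rightarrow> bool" where
  "adjacent_right J a b \<longleftrightarrow> is_edge J a b \<and> fst a = fst b \<and>
     (\<exists>p. is_edge J p a \<and> snd p = snd a \<and> fst p > fst a) \<and>
     (\<exists>q. is_edge J b q \<and> snd q = snd b \<and> fst q > fst b)"

definition adjacent_above :: "point set \<Rightarrow> point \<Rightarrow> point \<Rightarrow> bool" where
  "adjacent_above J a b \<longleftrightarrow> is_edge J a b \<and> snd a = snd b \<and>
     (\<exists>p. is_edge J p a \<and> fst p = fst a \<and> snd p > snd a) \<and>
     (\<exists>q. is_edge J b q \<and> fst q = fst b \<and> snd q > snd b)"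

definition rightmost_edge :: "point set \<Rightarrow> point \<Rightarrow> point \<Rightarrow> bool" where
  "rightmost_edge J a b \<longleftrightarrow> adjacent_left J a b \<and> interior_on J a b (-1, 0)"

definition left_notch :: "point set \<Rightarrow> point \<Rightarrow> point \<Rightarrow> bool" where
  "left_notch J a b \<longleftrightarrow> adjacent_left J a b \<and> interior_on J a b (1, 0)"

definition leftmost_edge :: "point set \<Rightarrow> point \<Rightarrow> point \<Rightarrow> bool" where
  "leftmost_edge J a b \<longleftrightarrow> adjacent_right J a b \<and> interior_on J a b (1, 0)"

definition right_notch :: "point set \<Rightarrow> point \<Rightarrow> point \<Rightarrow> bool" where
  "right_notch J a b \<longleftrightarrow> adjacent_right J a b \<and> interior_on J a b (-1, 0)"

definition top_notch :: "point set \<Rightarrow> point \<Rightarrow> point \<Rightarrow> bool" where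
  "top_notch J a b \<longleftrightarrow> adjacent_above J a b \<and> interior_on J a b (0, -1)"

definition falling_corner :: "point set \<Rightarrow> point \<Rightarrow> bool" where
  "falling_corner J v \<longleftrightarrow>
     (\<exists>u. cw_edge J u v \<and> fst u = fst v \<and> snd v < snd u) \<and>
     (\<exists>w. cw_edge J v w \<and> snd w = snd v \<and> fst v < fst w)"

definition bls_hole :: "point set \<Rightarrow> bool" where
  "bls_hole J \<longleftrightarrow> closed_rectilinear_arc J \<and>
     (\<nexists>a b. right_notch J a b) \<and> (\<nexists>a b. top_notch J a b) \<and>
     (\<forall>u v. falling_corner J u \<and> falling_corner J v \<longrightarrow> u = v)"

definition integral_vertices :: "point set \<Rightarrow> bool" where
  "integral_vertices J \<longleftrightarrow> (\<forall>v\<in>vertices J. fst v \<in> \<int> \<and> snd v \<in> \<int>)"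


section \<open>Feasible and BL-stable locations\<close>

definition feasible :: "point set \<Rightarrow> real \<Rightarrow> real \<Rightarrow> point \<Rightarrow> bool" where
  "feasible H w h p \<longleftrightarrow> {fst p .. fst p + w} \<times> {snd p .. snd p + h} \<subseteq> H"

definition bl_stable :: "point set \<Rightarrow> real \<Rightarrow> real \<Rightarrow> point \<Rightarrow> bool" where
  "bl_stable H w h p \<longleftrightarrow> feasible H w h p \<and>
     (\<exists>\<epsilon>>0. \<forall>t. 0 < t \<and> t < \<epsilon> \<longrightarrow>
        \<not> feasible H w h (fst p - t, snd p) \<and> \<not> feasible H w h (fst p, snd p - t))"


section \<open>A random access machine\<close>

text \<open>
  Unit-cost RAM over the integers with addition, subtraction, comparison and indirect addressing,
  presented as a structured language. Multiplication is left out on purpose, since at unit cost it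
  would allow numbers of exponential length. Every operator, memory access, assignment and test
  costs one step.
\<close>

record state =
  reg :: "nat \<Rightarrow> int"
  mem :: "int \<Rightarrow> int"

datatype aexp = Const int | Reg nat | Plus aexp aexp | Minus aexp aexp | Mem aexp

datatype bexp = Less aexp aexp | Neg bexp | Conj bexp bexp

datatype com =
    Skip
  | Assign nat aexp
  | Store aexp aexp
  | Seq com com
  | Cond bexp com com
  | While bexp com

primrec aval :: "aexp \<Rightarrow> state \<Rightarrow> int" where
  "aval (Const n) s = n"
| "aval (Reg r) s = reg s r"
| "aval (Plus a b) s = aval a s + aval b s"
| "aval (Minus a b) s = aval a s - aval b s"
| "aval (Mem a) s = mem s (aval a s)"

primrec acost :: "aexp \<Rightarrow> nat" where
  "acost (Const n) = 1"
| "acost (Reg r) = 1"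
| "acost (Plus a b) = 1 + acost a + acost b"
| "acost (Minus a b) = 1 + acost a + acost b"
| "acost (Mem a) = 1 + acost a"

primrec bval :: "bexp \<Rightarrow> state \<Rightarrow> bool" where
  "bval (Less a b) s \<longleftrightarrow> aval a s < aval b s"
| "bval (Neg c) s \<longleftrightarrow> \<not> bval c s"
| "bval (Conj c d) s \<longleftrightarrow> bval c s \<and> bval d s"

primrec bcost :: "bexp \<Rightarrow> nat" where
  "bcost (Less a b) = 1 + acost a + acost b"
| "bcost (Neg c) = 1 + bcost c"
| "bcost (Conj c d) = 1 + bcost c + bcost d"

text \<open>\<open>exec c s t s'\<close>: started in \<open>s\<close>, the program \<open>c\<close> halts after \<open>t\<close> steps in \<open>s'\<close>.\<close>

inductive exec :: "com \<Rightarrow> state \<Rightarrow> nat \<Rightarrow> state \<Rightarrow> bool" where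
  exec_Skip: "exec Skip s 1 s"
| exec_Assign: "exec (Assign r a) s (1 + acost a) (s\<lparr>reg := (reg s)(r := aval a s)\<rparr>)"
| exec_Store: "exec (Store a b) s (1 + acost a + acost b)
                 (s\<lparr>mem := (mem s)(aval a s := aval b s)\<rparr>)"
| exec_Seq: "exec c1 s1 t1 s2 \<Longrightarrow> exec c2 s2 t2 s3 \<Longrightarrow> exec (Seq c1 c2) s1 (t1 + t2) s3"
| exec_CondT: "bval b s \<Longrightarrow> exec c1 s t s' \<Longrightarrow> exec (Cond b c1 c2) s (1 + bcost b + t) s'"
| exec_CondF: "\<not> bval b s \<Longrightarrow> exec c2 s t s' \<Longrightarrow> exec (Cond b c1 c2) s (1 + bcost b + t) s'"
| exec_WhileF: "\<not> bval b s \<Longrightarrow> exec (While b c) s (1 + bcost b) s"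
| exec_WhileT: "bval b s1 \<Longrightarrow> exec c s1 t1 s2 \<Longrightarrow> exec (While b c) s2 t2 s3
                 \<Longrightarrow> exec (While b c) s1 (1 + bcost b + t1 + t2) s3"


section \<open>Input and output\<close>

definition pt :: "int \<times> int \<Rightarrow> point" where
  "pt v = (real_of_int (fst v), real_of_int (snd v))"

definition cyc :: "'a list \<Rightarrow> nat \<Rightarrow> 'a" where
  "cyc xs i = xs ! (i mod length xs)"

definition cw_vertex_list :: "point set \<Rightarrow> (int \<times> int) list \<Rightarrow> bool" where
  "cw_vertex_list J vs \<longleftrightarrow> distinct vs \<and> pt ` set vs = vertices J \<and>
     (\<forall>i<length vs. cw_edge J (pt (cyc vs i)) (pt (cyc vs (i + 1))))"

text \<open>The vertex \<open>vs ! i\<close> is stored in four consecutive cells from address \<open>ns ! i\<close> on: its two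
  coordinates and the addresses of its clockwise successor and predecessor. The addresses
  themselves are arbitrary.\<close>

definition stores_vertices :: "(int \<Rightarrow> int) \<Rightarrow> int list \<Rightarrow> (int \<times> int) list \<Rightarrow> bool" where
  "stores_vertices m ns vs \<longleftrightarrow> length ns = length vs \<and>
     (\<forall>i<length vs.
        m (ns ! i) = fst (vs ! i) \<and>
        m (ns ! i + 1) = snd (vs ! i) \<and>
        m (ns ! i + 2) = cyc ns (i + 1) \<and>
        m (ns ! i + 3) = cyc ns (i + length ns - 1))"

definition node_cells :: "int list \<Rightarrow> int list" where
  "node_cells ns = concat (map (\<lambda>a. [a, a + 1, a + 2, a + 3]) ns)"

definition array_cells :: "int \<Rightarrow> nat \<Rightarrow> int list" where
  "array_cells a k = map (\<lambda>i. a + int i) [0..<k]"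

text \<open>The array of length \<open>k\<close> at address \<open>a\<close> lists, in any order, pointers to all edges with
  property \<open>P\<close>. A pointer to an edge is the address of its clockwise first endpoint.\<close>

definition stores_edges ::
  "(int \<Rightarrow> int) \<Rightarrow> int list \<Rightarrow> (int \<times> int) list \<Rightarrow> int \<Rightarrow> nat \<Rightarrow> (point \<Rightarrow> point \<Rightarrow> bool) \<Rightarrow> bool" where
  "stores_edges m ns vs a k P \<longleftrightarrow>
     (\<exists>is. length is = k \<and> distinct is \<and>
        set is = {i. i < length vs \<and> P (pt (cyc vs i)) (pt (cyc vs (i + 1)))} \<and>
        (\<forall>j<k. m (a + int j) = ns ! (is ! j)))"

text \<open>
  Registers of an initial state:
    0, 1: the dimensions of the rectangle;
    2: some vertex node;
    3, 4: address and length of the array of leftmost edges;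
    5, 6: address and length of the array of left notches;
    7: the rightmost edge (a BLS-hole has exactly one);
    8: the falling corner, or the null pointer 0;
    9: an address beyond all input cells, from which on memory is free to use.
  The remaining registers and memory cells have arbitrary contents.
\<close>

definition encodes :: "state \<Rightarrow> point set \<Rightarrow> int \<Rightarrow> int \<Rightarrow> bool" where
  "encodes s J w h \<longleftrightarrow> (\<exists>vs ns k l.
     cw_vertex_list J vs \<and>
     stores_vertices (mem s) ns vs \<and>
     reg s 0 = w \<and> reg s 1 = h \<and>
     reg s 2 \<in> set ns \<and>
     reg s 4 = int k \<and> stores_edges (mem s) ns vs (reg s 3) k (leftmost_edge J) \<and>
     reg s 6 = int l \<and> stores_edges (mem s) ns vs (reg s 5) l (left_notch J) \<and>
     (\<exists>i<length vs. rightmost_edge J (pt (cyc vs i)) (pt (cyc vs (i + 1))) \<and> reg s 7 = ns ! i) \<and>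
     (if \<exists>v. falling_corner J v
      then \<exists>i<length vs. falling_corner J (pt (vs ! i)) \<and> reg s 8 = ns ! i
      else reg s 8 = 0) \<and>
     distinct (node_cells ns @ array_cells (reg s 3) k @ array_cells (reg s 5) l) \<and>
     set (node_cells ns @ array_cells (reg s 3) k @ array_cells (reg s 5) l) \<subseteq> {0<..<reg s 9})"

text \<open>On termination, register 0 holds the number of reported locations and register 1 the address
  from which on their coordinates are stored in consecutive cells.\<close>

definition reported :: "state \<Rightarrow> point set" where
  "reported s =
     (\<lambda>i. pt (mem s (reg s 1 + 2 * int i), mem s (reg s 1 + 2 * int i + 1))) ` {..<nat (reg s 0)}"

end

theory Submission
  imports Defs
begin

text \<open>Cut the plane into unit cells. A location is BL-stable iff it is integral, all cells of the
  rectangle belong to the hole, and some cell bordering its left side and some cell bordering its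
  bottom side do not.

  Traverse the boundary clockwise from the lower end of the rightmost edge. A rightward edge is
  followed by an upward one and a downward edge by a leftward one, except in the final pieces
  around the falling corner. Indeed, every other exception would give a notch, a second falling
  corner or a second rightmost edge. The last is impossible because without right notches all
  cells flow eastwards into the same dead end. On a chain of this kind the successive crossings of
  a column ascend and those of a row move to the left.

  Hence the left side of a stable location rests against an upward edge, its height is the maximum,
  over the columns it occupies, of the floors traversed last, and only later rightward edges can
  obstruct it from above. One sweep along the chain finds these locations with a stack of floors, a
  stack of floors that are records seen from the current position, and a stack of locations that
  wait for their ceiling. The heights stay accurate enough if valleys narrower than the rectangle
  are filled, and then every entry is pushed and popped only once.\<close>

section \<open>Lattice chains\<close>

text \<open>That crossings of a column ascend is a global fact about a simple curve; the two turning
  rules do not give it locally. Between consecutive crossings the chain stays on one side of the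
  column, and at its extreme point there the rules make it arrive upwards. So an arc can be led to
  infinity just below that point, and an integer crossing count, constant along the rest of the
  chain, compares the two heights. Rows need no second proof: reversing the chain and exchanging the
  coordinates preserves both rules.

  Filling a valley is harmless for two reasons. A rectangle wider than the valley covers one of its
  banks, so the maximum over its columns is unchanged. And the upward edge that causes the filling
  keeps all later crossings, from the column on its left onwards, at or above its top, so none of
  them meets the filled part.

  On the topological side, every boundary point is a limit of inside and of outside points. Around
  such a point an axis direction therefore carries a piece of the boundary exactly if the two
  quadrants beside it lie on different sides, and the local structure of the boundary becomes a
  matter of parity.\<close>

definition hcov :: "(nat \<Rightarrow> int) \<Rightarrow> nat \<Rightarrow> int \<Rightarrow> bool" where
  "hcov x k i \<longleftrightarrow> min (x k) (x (Suc k)) \<le> i \<and> i < max (x k) (x (Suc k))"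

text \<open>A chain is an axis-parallel lattice polyline that alternately runs horizontally from
  \<open>(x k, y k)\<close> to \<open>(x (k + 1), y k)\<close> (piece \<open>2 k\<close>) and vertically from there to
  \<open>(x (k + 1), y (k + 1))\<close> (piece \<open>2 k + 1\<close>).\<close>

definition on_piece :: "(nat \<Rightarrow> int) \<Rightarrow> (nat \<Rightarrow> int) \<Rightarrow> nat \<Rightarrow> int \<Rightarrow> int \<Rightarrow> bool" where
  "on_piece x y e X Y \<longleftrightarrow>
     (if even e then Y = y (e div 2) \<and> min (x (e div 2)) (x (Suc (e div 2))) \<le> X \<and> X \<le> max (x (e div 2)) (x (Suc (e div 2)))
      else X = x (Suc (e div 2)) \<and> min (y (e div 2)) (y (Suc (e div 2))) \<le> Y \<and> Y \<le> max (y (e div 2)) (y (Suc (e div 2))))"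

text \<open>The start of piece \<open>e\<close>; the rounding of \<open>div\<close> lets one formula
  serve both parities.\<close>

definition chain_vertex :: "(nat \<Rightarrow> int) \<Rightarrow> (nat \<Rightarrow> int) \<Rightarrow> nat \<Rightarrow> int \<times> int" where
  "chain_vertex x y e = (x (Suc e div 2), y (e div 2))"

text \<open>The two turning rules are all that the chain keeps of the conditions on notches and
  falling corners. \<open>down_left\<close> stops one index earlier because no horizontal piece of
  the chain follows the last vertical one.\<close>

locale chain =
  fixes N :: nat and x y :: "nat \<Rightarrow> int"
  assumes x_step: "k < N \<Longrightarrow> x k \<noteq> x (Suc k)"
    and y_step: "k < N \<Longrightarrow> y k \<noteq> y (Suc k)"
    and right_up: "k < N \<Longrightarrow> x k < x (Suc k) \<Longrightarrow> y k < y (Suc k)"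
    and down_left: "Suc k < N \<Longrightarrow> y (Suc k) < y k \<Longrightarrow> x (Suc (Suc k)) < x (Suc k)"
    and simple: "e < e' \<Longrightarrow> e' < 2 * N \<Longrightarrow> on_piece x y e X Y \<Longrightarrow> on_piece x y e' X Y \<Longrightarrow>
           e' = Suc e \<and> (X, Y) = chain_vertex x y e'"
begin

lemma hpiece: "on_piece x y (2 * k) X Y \<longleftrightarrow> Y = y k \<and> min (x k) (x (Suc k)) \<le> X \<and> X \<le> max (x k) (x (Suc k))"
  by (simp add: on_piece_def)

lemma vpiece: "on_piece x y (Suc (2 * k)) X Y \<longleftrightarrow>
    X = x (Suc k) \<and> min (y k) (y (Suc k)) \<le> Y \<and> Y \<le> max (y k) (y (Suc k))"
  by (simp add: on_piece_def)

lemma hh_disjoint: "k < l \<Longrightarrow> l < N \<Longrightarrow> on_piece x y (2 * k) X Y \<Longrightarrow> \<not> on_piece x y (2 * l) X Y"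
  using simple[of "2*k" "2*l"] by auto

lemma hv_disjoint:
  assumes "k < l" "l < N" "on_piece x y (2 * k) X Y" "on_piece x y (Suc (2 * l)) X Y" shows False
  using simple[of "2*k" "Suc (2*l)"] assms by auto

lemma vv_disjoint:
  assumes "k < l" "l < N" "on_piece x y (Suc (2 * k)) X Y" "on_piece x y (Suc (2 * l)) X Y" shows False
  using simple[of "Suc (2*k)" "Suc (2*l)"] assms by auto

lemma vh_disjoint:
  assumes "k < l" "l < N" "on_piece x y (Suc (2 * k)) X Y" "on_piece x y (2 * l) X Y"
  shows "l = Suc k \<and> X = x l \<and> Y = y l"
proof -
  have "2 * l = Suc (Suc (2 * k)) \<and> X = x l \<and> Y = y l"
    using simple[of "Suc (2*k)" "2*l" X Y] assms by (simp add: chain_vertex_def)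
  then show ?thesis by linarith
qed

lemma hv_same:
  assumes "l < N" "on_piece x y (2 * l) X Y" "on_piece x y (Suc (2 * l)) X Y"
  shows "X = x (Suc l) \<and> Y = y l"
  using simple[of "2*l" "Suc (2*l)"] assms by (auto simp: chain_vertex_def)

text \<open>Signed number of times that the column \<open>i\<close> is crossed at height at most \<open>j\<close> by a curve that
  comes down the vertical line at \<open>a\<close>, joins piece \<open>2 k\<close>, follows the chain up to piece
  \<open>2 (m - 1)\<close> and leaves to infinity horizontally (leftwards if \<open>r = 1\<close>, rightwards if \<open>r = 0\<close>).
  It is locally constant off that curve.\<close>

definition crossings :: "nat \<Rightarrow> nat \<Rightarrow> int \<Rightarrow> int \<Rightarrow> int \<Rightarrow> int \<Rightarrow> int" where
  "crossings k m a r i j =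
     of_bool (y k \<le> j) * (of_bool (x (Suc k) \<le> i) - of_bool (a \<le> i))
     + (\<Sum>q\<in>{Suc k..<m}. of_bool (y q \<le> j) * (of_bool (x (Suc q) \<le> i) - of_bool (x q \<le> i)))
     + of_bool (y (m - 1) \<le> j) * (r - of_bool (x m \<le> i))"

text \<open>Summation by parts: the same count taken over the vertical pieces. In this form a step
  to the next column affects only the pieces on the vertical line that is passed.\<close>

lemma crossings_by_rows:
  assumes "k < m"
  shows "crossings k m a r i j =
    of_bool (y (m - 1) \<le> j) * r - of_bool (a \<le> i) * of_bool (y k \<le> j)
    + (\<Sum>q\<in>{k..<m-1}. of_bool (x (Suc q) \<le> i) * (of_bool (y q \<le> j) - of_bool (y (Suc q) \<le> j)))"
proof -
  obtain d where m: "m = Suc (k + d)" using assms less_iff_Suc_add by auto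
  show ?thesis unfolding m
    by (induction d) (simp_all add: crossings_def algebra_simps)
qed

text \<open>A cell and the one below it are separated by the unit edge from \<open>(X, Y)\<close> to
  \<open>(X + 1, Y)\<close>. Testing its left end is enough, since a horizontal piece containing the
  edge contains that point.\<close>

lemma crossings_const_up:
  assumes "k < m"
    and "\<And>q. k < q \<Longrightarrow> q < m \<Longrightarrow> \<not> on_piece x y (2 * q) X Y"
    and "Y = y k \<Longrightarrow> \<not> (min a (x (Suc k)) \<le> X \<and> X \<le> max a (x (Suc k)))"
    and "Y = y (m - 1) \<Longrightarrow> if r = 1 then x m \<le> X else r = 0 \<and> X < x m"
  shows "crossings k m a r X (Y - 1) = crossings k m a r X Y"
proof -
  have 1: "of_bool (y k \<le> Y - 1) * (of_bool (x (Suc k) \<le> X) - of_bool (a \<le> X)) =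
     of_bool (y k \<le> Y) * (of_bool (x (Suc k) \<le> X) - of_bool (a \<le> X) :: int)"
    using assms(3) by (auto simp: of_bool_def)
  have 2: "of_bool (y q \<le> Y - 1) * (of_bool (x (Suc q) \<le> X) - of_bool (x q \<le> X)) =
     of_bool (y q \<le> Y) * (of_bool (x (Suc q) \<le> X) - of_bool (x q \<le> X) :: int)" if "q \<in> {Suc k..<m}" for q
    using assms(2)[of q] that by (auto simp: of_bool_def hpiece)
  have 3: "of_bool (y (m - 1) \<le> Y - 1) * (r - of_bool (x m \<le> X)) = of_bool (y (m - 1) \<le> Y) * (r - of_bool (x m \<le> X))"
    using assms(4) by (auto simp: of_bool_def split: if_splits)
  show ?thesis unfolding crossings_def 1 3 by (simp only: sum.cong[OF refl 2])
qed

lemma crossings_const_right: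
  assumes "k < m"
    and "\<And>q. k \<le> q \<Longrightarrow> Suc q < m \<Longrightarrow> \<not> on_piece x y (Suc (2 * q)) X Y"
    and "X \<noteq> a"
  shows "crossings k m a r (X - 1) Y = crossings k m a r X Y"
proof -
  have 2: "of_bool (x (Suc q) \<le> X - 1) * (of_bool (y q \<le> Y) - of_bool (y (Suc q) \<le> Y)) =
     of_bool (x (Suc q) \<le> X) * (of_bool (y q \<le> Y) - of_bool (y (Suc q) \<le> Y) :: int)" if "q \<in> {k..<m-1}" for q
    using assms(2)[of q] that less_diff_conv[of q m 1] by (auto simp: of_bool_def vpiece)
  have 1: "of_bool (a \<le> X - 1) = (of_bool (a \<le> X) :: int)" using assms(3) by (auto simp: of_bool_def)
  show ?thesis unfolding crossings_by_rows[OF assms(1)] 1 by (simp only: sum.cong[OF refl 2])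
qed

lemma int_const_between:
  fixes f :: "int \<Rightarrow> 'b"
  assumes "\<And>i. min a b < i \<Longrightarrow> i \<le> max a b \<Longrightarrow> f (i - 1) = f i"
  shows "f a = f b"
proof -
  have *: "f a = f b" if "a \<le> b" "\<And>i. a < i \<Longrightarrow> i \<le> b \<Longrightarrow> f (i - 1) = f i" for a b
  proof -
    have "f a = f (a + int n)" if "a + int n \<le> b" for n
      using that
    proof (induction n)
      case (Suc n)
      then show ?case using \<open>\<And>i. a < i \<Longrightarrow> i \<le> b \<Longrightarrow> f (i - 1) = f i\<close>[of "a + int (Suc n)"] by simp
    qed simp
    from this[of "nat (b - a)"] \<open>a \<le> b\<close> show ?thesis by simp
  qed
  show ?thesis
  proof (cases "a \<le> b")
    case True
    show ?thesis by (rule *[OF True], rule assms) (use True in auto)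
  next
    case False
    have "f b = f a" by (rule *, use False in simp, rule assms) (use False in auto)
    then show ?thesis by simp
  qed
qed

text \<open>The cell followed is the one whose lower left corner is the current lattice point of the
  chain. Simplicity keeps these points off the arc, and \<open>side\<close> keeps them between its
  two unbounded ends.\<close>

lemma crossings_const_along:
  assumes km: "k < m" "m \<le> l" "l < N" and U: "y (m - 1) < y m"
    and side: "\<And>q. m \<le> q \<Longrightarrow> q \<le> l \<Longrightarrow> (if r = 1 then x m \<le> x q \<and> x q < a else r = 0 \<and> x q \<le> x m \<and> a < x q)"
    and A: "min (x k) (x (Suc k)) \<le> a" "a \<le> max (x k) (x (Suc k))"
    and c: "min (x l) (x (Suc l)) \<le> c" "c \<le> max (x l) (x (Suc l))"
      "if r = 1 then x m \<le> c \<and> c < a else c \<le> x m \<and> a < c"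
  shows "crossings k m a r (x m) (y (m - 1) + 1) = crossings k m a r c (y l)"
proof -
  have off: "crossings k m a r (X - 1) Y = crossings k m a r X Y \<and>
       crossings k m a r X (Y - 1) = crossings k m a r X Y"
    if p: "m \<le> q \<and> q \<le> l \<and> on_piece x y (2 * q) X Y \<or> m \<le> q \<and> q < l \<and> on_piece x y (Suc (2 * q)) X Y \<or>
           Suc q = m \<and> on_piece x y (Suc (2 * q)) X Y \<and> y q < Y"
      and s: "if r = 1 then x m \<le> X \<and> X < a else r = 0 \<and> X \<le> x m \<and> a < X" for q X Y
  proof
    have h: "\<not> on_piece x y (2 * q') X Y" if "q' < m" for q'
      using p hh_disjoint[of q' q X Y] hv_disjoint[of q' q X Y] that km hv_same[of q X Y] 
      by (cases "q' = q") auto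
    have v: "\<not> on_piece x y (Suc (2 * q')) X Y" if "Suc q' < m" for q'
      using p vh_disjoint[of q' q X Y] vv_disjoint[of q' q X Y] that km by auto
    show "crossings k m a r (X - 1) Y = crossings k m a r X Y"
      using v s km by (intro crossings_const_right) (auto split: if_splits)
    have "on_piece x y (2 * (m - 1)) X Y" if "X = x m" "Y = y (m - 1)"
      using that km by (auto simp: hpiece)
    moreover have "m - 1 < m" using km by simp
    ultimately have "X \<noteq> x m" if "Y = y (m - 1)" using h that by blast
    moreover have "\<not> (min a (x (Suc k)) \<le> X \<and> X \<le> max a (x (Suc k)))" if "Y = y k"
      using that A h[of k] km by (auto simp: hpiece)
    ultimately show "crossings k m a r X (Y - 1) = crossings k m a r X Y"
      using h km s by (intro crossings_const_up) (auto split: if_splits)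
  qed
  have vert: "crossings k m a r (x (Suc q)) (y q) = crossings k m a r (x (Suc q)) (y (Suc q))" if "m \<le> q" "q < l" for q
  proof (rule int_const_between[where f = "\<lambda>j. crossings k m a r (x (Suc q)) j"])
    fix j assume "min (y q) (y (Suc q)) < j" "j \<le> max (y q) (y (Suc q))"
    then have "on_piece x y (Suc (2 * q)) (x (Suc q)) j" by (auto simp: vpiece)
    then show "crossings k m a r (x (Suc q)) (j - 1) = crossings k m a r (x (Suc q)) j"
      using off[of q "x (Suc q)" j] that side[of "Suc q"] by (meson Suc_leI le_SucI)
  qed
  have horz: "crossings k m a r (x q) (y q) = crossings k m a r c (y q)"
    if c: "m \<le> q" "q \<le> l" "min (x q) (x (Suc q)) \<le> c" "c \<le> max (x q) (x (Suc q))" 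
      "if r = 1 then x m \<le> c \<and> c < a else c \<le> x m \<and> a < c" for q c
  proof (rule int_const_between[where f = "\<lambda>i. crossings k m a r i (y q)"])
    fix i assume i: "min (x q) c < i" "i \<le> max (x q) c"
    then have "on_piece x y (2 * q) i (y q)" using c by (auto simp: hpiece)
    moreover have "if r = 1 then x m \<le> i \<and> i < a else r = 0 \<and> i \<le> x m \<and> a < i"
      using i c side[of q] by (auto split: if_splits)
    ultimately show "crossings k m a r (i - 1) (y q) = crossings k m a r i (y q)"
      using off[of q i "y q"] c by blast
  qed
  \<comment> \<open>The start is one unit above the lower end of this vertical piece, since that end
    itself lies on the arc.\<close>
  have "crossings k m a r (x m) (y (m - 1) + 1) = crossings k m a r (x m) (y m)"
  proof (rule int_const_between[where f = "\<lambda>j. crossings k m a r (x m) j"])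
    fix j assume "min (y (m - 1) + 1) (y m) < j" "j \<le> max (y (m - 1) + 1) (y m)"
    then have "on_piece x y (Suc (2 * (m - 1))) (x m) j" "y (m - 1) < j" using U km by (auto simp: vpiece)
    moreover have "Suc (m - 1) = m" using km by simp
    ultimately show "crossings k m a r (x m) (j - 1) = crossings k m a r (x m) j"
      using off[of "m - 1" "x m" j] side[of m] km by (meson order_refl)
  qed
  also have "crossings k m a r (x m) (y m) = crossings k m a r (x q) (y q)" if "m \<le> q" "q \<le> l" for q
    using that
  proof (induction q rule: dec_induct)
    case (step q)
    then show ?case using horz[of q "x (Suc q)"] vert[of q] side[of "Suc q"] by (auto split: if_splits)
  qed simp
  from this[of l] have "crossings k m a r (x m) (y m) = crossings k m a r (x l) (y l)" using km by simp
  also have "\<dots> = crossings k m a r c (y l)" using horz[of l c] km c by auto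
  finally show ?thesis .
qed

text \<open>An arc that comes down beside piece \<open>k\<close>, follows the chain to its extreme
  point and leaves from there to infinity misses the rest of the chain. Its crossing count at piece
  \<open>l\<close> hence equals the one at the extreme point, and this tells on which side of piece
  \<open>k\<close> the crossing \<open>l\<close> lies.\<close>

lemma next_crossing_above:
  assumes kl: "k < l" "l < N" and ck: "hcov x k c" and cl: "hcov x l c"
    and btw: "\<And>q. k < q \<Longrightarrow> q < l \<Longrightarrow> \<not> hcov x q c"
  shows "y k < y l"
proof -
  have ne: "y k \<noteq> y l"
    using hh_disjoint[OF kl, of c "y k"] ck cl by (auto simp: hpiece hcov_def)
  have xs: "x k \<noteq> x (Suc k)" using x_step kl by simp
  show ?thesis
  proof (cases "x (Suc k) < x k")
    case True
    have lef: "x q \<le> c" if "Suc k \<le> q" "q \<le> l" for q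
      using that
    proof (induction q rule: dec_induct)
      case base then show ?case using ck True by (auto simp: hcov_def)
    next
      case (step q) then show ?case using btw[of q] by (auto simp: hcov_def)
    qed
    \<comment> \<open>Leftmost point in between. The chain turns right there, hence by
      \<open>down_left\<close> it arrived upwards, and the arc can leave to the left from the lower
      end of that vertical piece.\<close>
    define m where "m = arg_min_on x {Suc k..l}"
    have m: "Suc k \<le> m" "m \<le> l" and mm: "\<And>q. Suc k \<le> q \<Longrightarrow> q \<le> l \<Longrightarrow> x m \<le> x q"
      using arg_min_if_finite(1)[of "{Suc k..l}" x] arg_min_least[of "{Suc k..l}" _ x] kl
      by (auto simp: m_def)
    have "x l < x (Suc l)" using lef[of l] cl kl by (auto simp: hcov_def)
    then have R: "x m < x (Suc m)"
      using m mm[of "Suc m"] x_step[of m] kl by (cases "m = l") auto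
    have U: "y (m - 1) < y m"
      using down_left[of "m - 1"] R y_step[of "m - 1"] m kl by (cases m) fastforce+
    \<comment> \<open>With \<open>a = c + 1\<close> the arc meets column \<open>c\<close> only in
      the part taken from piece \<open>k\<close>, which makes the count at \<open>(c, y l)\<close> a
      test of \<open>y k \<le> y l\<close>.\<close>
    have eq: "crossings k m (c + 1) 1 (x m) (y (m - 1) + 1) = crossings k m (c + 1) 1 c (y l)"
      using m kl U lef mm ck cl by (intro crossings_const_along) (auto simp: hcov_def less_Suc_eq_le Suc_le_eq)
    have "crossings k m (c + 1) 1 (x m) (y (m - 1) + 1) = crossings k m (c + 1) 1 (x m - 1) (y (m - 1) + 1)"
    proof (rule crossings_const_right[symmetric])
      show "x m \<noteq> c + 1" using lef[of m] m by simp
      have "on_piece x y (Suc (2 * (m - 1))) (x m) (y (m - 1) + 1)" using U m by (auto simp: vpiece)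
      then show "\<not> on_piece x y (Suc (2 * q)) (x m) (y (m - 1) + 1)" if "k \<le> q" "Suc q < m" for q
        using vv_disjoint[of q "m - 1" "x m" "y (m - 1) + 1"] that m kl by fastforce
    qed (use m in auto)
    \<comment> \<open>West of the leftmost point only the outgoing ray is counted.\<close>
    moreover have "crossings k m (c + 1) 1 (x m - 1) (y (m - 1) + 1) = 1"
    proof -
      have "(\<Sum>q\<in>{Suc k..<m}. of_bool (y q \<le> y (m - 1) + 1) * (of_bool (x (Suc q) \<le> x m - 1) - of_bool (x q \<le> x m - 1))) = (0::int)"
      proof (intro sum.neutral ballI)
        fix q assume "q \<in> {Suc k..<m}"
        then have "x m \<le> x q" "x m \<le> x (Suc q)" using mm[of q] mm[of "Suc q"] m by auto
        then show "of_bool (y q \<le> y (m - 1) + 1) * (of_bool (x (Suc q) \<le> x m - 1) - of_bool (x q \<le> x m - 1)) = (0::int)"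
          by simp
      qed
      then show ?thesis using mm[of "Suc k"] lef[of m] m by (simp add: crossings_def of_bool_def)
    qed
    moreover have "crossings k m (c + 1) 1 c (y l) = of_bool (y k \<le> y l)"
    proof -
      have "(\<Sum>q\<in>{Suc k..<m}. of_bool (y q \<le> y l) * (of_bool (x (Suc q) \<le> c) - of_bool (x q \<le> c))) = (0::int)"
        using lef m by (intro sum.neutral) (auto simp: of_bool_def)
      then show ?thesis using lef[of "Suc k"] lef[of m] m by (simp add: crossings_def)
    qed
    ultimately show ?thesis using eq ne by (simp add: of_bool_def split: if_splits)
  next
    case False
    then have Rk: "x k < x (Suc k)" using xs by simp
    have rig: "c < x q" if "Suc k \<le> q" "q \<le> l" for q
      using that
    proof (induction q rule: dec_induct)
      case base then show ?case using ck Rk by (auto simp: hcov_def)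
    next
      case (step q) then show ?case using btw[of q] by (auto simp: hcov_def)
    qed
    \<comment> \<open>Mirror image: the rightmost point is reached by a rightward piece,
      \<open>right_up\<close> sends the chain up there, and the arc leaves to the right; hence
      \<open>r = 0\<close> and the count \<open>- 1\<close>.\<close>
    define m where "m = arg_min_on (\<lambda>q. - x q) {Suc k..l}"
    have m: "Suc k \<le> m" "m \<le> l" and mm: "\<And>q. Suc k \<le> q \<Longrightarrow> q \<le> l \<Longrightarrow> x q \<le> x m"
      using arg_min_if_finite(1)[of "{Suc k..l}" "\<lambda>q. - x q"] arg_min_least[of "{Suc k..l}" _ "\<lambda>q. - x q"] kl
      by (auto simp: m_def)
    have "x (m - 1) < x m"
    proof (cases "m = Suc k")
      case False
      then have "Suc k \<le> m - 1" "m - 1 \<le> l" "m - 1 < N" "Suc (m - 1) = m" using m kl by auto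
      then show ?thesis using mm[of "m - 1"] x_step[of "m - 1"] by auto
    qed (use Rk in simp)
    then have U: "y (m - 1) < y m"
      using right_up[of "m - 1"] m kl by auto
    have "c + 1 \<le> x m" using rig[of m] m by simp
    then have eq: "crossings k m c 0 (x m) (y (m - 1) + 1) = crossings k m c 0 (c + 1) (y l)"
      using m kl U rig mm ck cl by (intro crossings_const_along) (auto simp: hcov_def less_Suc_eq_le Suc_le_eq)
    have "crossings k m c 0 (x m) (y (m - 1) + 1) = - 1"
    proof -
      have "(\<Sum>q\<in>{Suc k..<m}. of_bool (y q \<le> y (m - 1) + 1) * (of_bool (x (Suc q) \<le> x m) - of_bool (x q \<le> x m))) = (0::int)"
        using mm m by (intro sum.neutral) (force simp: of_bool_def)
      then show ?thesis using mm[of "Suc k"] rig[of m] m by (simp add: crossings_def)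
    qed
    \<comment> \<open>The walk along the chain must stay right of \<open>a = c\<close>, so it ends
      in column \<open>c + 1\<close>; one more step to the left reaches column
      \<open>c\<close>.\<close>
    moreover have "crossings k m c 0 c (y l) = crossings k m c 0 (c + 1) (y l)"
    proof -
      have "on_piece x y (2 * l) (c + 1) (y l)" using cl by (auto simp: hpiece hcov_def)
      then have "\<not> on_piece x y (Suc (2 * q)) (c + 1) (y l)" if "Suc q < m" for q
        using vh_disjoint[of q l "c + 1" "y l"] that m kl by auto
      then show ?thesis using crossings_const_right[of k m "c + 1" "y l" c 0] m by simp
    qed
    moreover have "crossings k m c 0 c (y l) = - of_bool (y k \<le> y l)"
    proof -
      have "(\<Sum>q\<in>{Suc k..<m}. of_bool (y q \<le> y l) * (of_bool (x (Suc q) \<le> c) - of_bool (x q \<le> c))) = (0::int)"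
      proof (intro sum.neutral ballI)
        fix q assume "q \<in> {Suc k..<m}"
        then have "c < x q" "c < x (Suc q)" using rig[of q] rig[of "Suc q"] m by auto
        then show "of_bool (y q \<le> y l) * (of_bool (x (Suc q) \<le> c) - of_bool (x q \<le> c)) = (0::int)" by simp
      qed
      then show ?thesis using rig[of "Suc k"] rig[of m] m by (simp add: crossings_def)
    qed
    ultimately show ?thesis using eq ne by (auto simp: of_bool_def split: if_splits)
  qed
qed

theorem column_crossings_ascend:
  assumes "k < l" "l < N" "hcov x k c" "hcov x l c"
  shows "y k < y l"
  using assms
proof (induction "l - k" arbitrary: k rule: less_induct)
  case less
  let ?P = "\<lambda>q. k < q \<and> hcov x q c"
  define q where "q = Least ?P"
  have P: "?P l" using less.prems by simp
  have "?P q" unfolding q_def by (rule LeastI[of ?P, OF P])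
  then have q: "k < q" "hcov x q c" by auto
  have "q \<le> l" unfolding q_def by (rule Least_le[of ?P, OF P])
  have nq: "\<not> hcov x q' c" if "k < q'" "q' < q" for q'
    using not_less_Least[of q' ?P] that unfolding q_def by blast
  have "y k < y q" using next_crossing_above[of k q c] q nq less.prems \<open>q \<le> l\<close> by auto
  moreover have "q = l \<or> y q < y l" using less.hyps[of q] q \<open>q \<le> l\<close> less.prems by (cases "q = l") auto
  ultimately show ?case by auto
qed

end

text \<open>As no step is degenerate, reversal together with the exchange of coordinates turns each
  turning rule into its own contrapositive.\<close>

lemma chain_transpose:
  assumes "chain N x y"
  shows "chain N (\<lambda>k. y (N - k)) (\<lambda>k. x (N - k))"
proof -
  interpret chain N x y by fact
  have pc: "on_piece (\<lambda>k. y (N - k)) (\<lambda>k. x (N - k)) e X Y = on_piece x y (2 * N - Suc e) Y X" if "e < 2 * N" for e X Y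
  proof (cases "even e")
    case True
    then obtain k where e: "e = 2 * k" by auto
    then have k: "k < N" using that by auto
    have "2 * N - Suc e = Suc (2 * (N - Suc k))" using k e by auto
    moreover have "Suc (N - Suc k) = N - k" using k by auto
    ultimately show ?thesis by (auto simp: e on_piece_def min.commute max.commute)
  next
    case False
    then obtain k where e: "e = Suc (2 * k)" by (metis Suc_eq_plus1 oddE)
    then have k: "k < N" using that by auto
    have "2 * N - Suc e = 2 * (N - Suc k)" using k e by auto
    moreover have "Suc (N - Suc k) = N - k" using k by auto
    ultimately show ?thesis by (auto simp: e on_piece_def min.commute max.commute)
  qed
  show ?thesis
  proof
    fix k assume k: "k < N"
    have s: "Suc (N - Suc k) = N - k" using k by auto
    show "y (N - k) \<noteq> y (N - Suc k)" "x (N - k) \<noteq> x (N - Suc k)"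
      using x_step[of "N - Suc k"] y_step[of "N - Suc k"] k s by auto
    show "x (N - k) < x (N - Suc k)" if "y (N - k) < y (N - Suc k)"
      using right_up[of "N - Suc k"] x_step[of "N - Suc k"] that k s by force
  next
    fix k assume k: "Suc k < N" and lt: "x (N - Suc k) < x (N - k)"
    have s: "Suc (N - Suc (Suc k)) = N - Suc k" "Suc (N - Suc k) = N - k" using k by auto
    show "y (N - Suc (Suc k)) < y (N - Suc k)"
      using down_left[of "N - Suc (Suc k)"] y_step[of "N - Suc (Suc k)"] lt k s by force
  next
    fix e e' X Y assume a: "e < e'" "e' < 2 * N" and
      p: "on_piece (\<lambda>k. y (N - k)) (\<lambda>k. x (N - k)) e X Y" "on_piece (\<lambda>k. y (N - k)) (\<lambda>k. x (N - k)) e' X Y"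
    have "2 * N - Suc e = Suc (2 * N - Suc e') \<and> (Y, X) = chain_vertex x y (2 * N - Suc e)"
      using simple[of "2 * N - Suc e'" "2 * N - Suc e" Y X] a p pc[of e] pc[of e'] by auto
    moreover have "Suc (2 * N - Suc e) div 2 = N - Suc e div 2" "(2 * N - Suc e) div 2 = N - Suc (Suc e) div 2" if "Suc e < 2 * N"
      using that by auto
    moreover have "e' = Suc e" using calculation(1) a by linarith
    ultimately show "e' = Suc e \<and> (X, Y) = chain_vertex (\<lambda>k. y (N - k)) (\<lambda>k. x (N - k)) e'"
      using a by (simp add: chain_vertex_def)
  qed
qed

context chain
begin

theorem row_crossings_descend:
  assumes "k < l" "l < N" "hcov y k j" "hcov y l j"
  shows "x (Suc l) < x (Suc k)"
proof -
  interpret tr: chain N "\<lambda>k. y (N - k)" "\<lambda>k. x (N - k)" by (rule chain_transpose) (rule chain_axioms)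
  have "hcov (\<lambda>k. y (N - k)) (N - Suc k) j" if "hcov y k j" "k < N" for k
  proof -
    have "N - (N - Suc k) = Suc k" "N - Suc (N - Suc k) = k" using that by auto
    then show ?thesis using that by (simp add: hcov_def min.commute max.commute)
  qed
  then show ?thesis
    using tr.column_crossings_ascend[of "N - Suc l" "N - Suc k" j] assms
    by (auto simp: Suc_diff_Suc)
qed

end

section \<open>Stable locations along a chain\<close>

context chain
begin

lemma crossing_rightward:
  assumes "p \<le> q" "x p \<le> i" "i < x q"
  obtains r where "p \<le> r" "r < q" "x r \<le> i" "i < x (Suc r)"
proof -
  have "\<exists>r. p \<le> r \<and> r < q \<and> x r \<le> i \<and> i < x (Suc r)"
    using assms
  proof (induction q rule: dec_induct)
    case (step q) then show ?case by (cases "i < x q") (auto intro: less_SucI)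
  qed simp
  then show ?thesis using that by blast
qed

lemma crossing_leftward:
  assumes "p \<le> q" "i < x p" "x q \<le> i"
  obtains r where "p \<le> r" "r < q" "x (Suc r) \<le> i" "i < x r"
proof -
  have "\<exists>r. p \<le> r \<and> r < q \<and> x (Suc r) \<le> i \<and> i < x r"
    using assms
  proof (induction q rule: dec_induct)
    case (step q) then show ?case by (cases "x q \<le> i") (auto intro: less_SucI)
  qed simp
  then show ?thesis using that by blast
qed

lemma hcov_L: "x (Suc k) \<le> i \<Longrightarrow> i < x k \<Longrightarrow> hcov x k i"
  and hcov_R: "x k \<le> i \<Longrightarrow> i < x (Suc k) \<Longrightarrow> hcov x k i"
  by (auto simp: hcov_def)

lemma right_after_up: "0 < l \<Longrightarrow> l < N \<Longrightarrow> x l < x (Suc l) \<Longrightarrow> y (l - 1) < y l"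
  using down_left[of "l - 1"] y_step[of "l - 1"] by (cases l) fastforce+

text \<open>The upward edge acts as a wall, and the rest of the chain starts at its top. The
  induction traces a later crossing back to an earlier and lower one, except in one configuration
  that the order within a row settles. The column just left of the wall is included because it will
  serve as the bank of a filled valley.\<close>

lemma later_crossings_above:
  assumes U: "y k < y (Suc k)" and "k < l" "l < N" "hcov x l i" "x (Suc k) - 1 \<le> i"
  shows "y (Suc k) \<le> y l"
  using assms(2-)
proof (induction l arbitrary: i rule: less_induct)
  case (less l)
  show ?case
  proof (cases "l = Suc k")
    case False
    then have l: "k < l - 1" "l - 1 < l" "Suc (l - 1) = l" using less.prems by auto
    have prev: "y (Suc k) \<le> y l" if "k < q" "q < l" "hcov x q i'" "hcov x l i'" "x (Suc k) - 1 \<le> i'" for q i'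
      using less.IH[of q i'] column_crossings_ascend[of q l i'] that less.prems by fastforce
    have viaL: "y (Suc k) \<le> y l" if v: "hcov x l (x (Suc k) - 1)" "x l \<le> x (Suc k) - 1"
    proof -
      obtain q where "Suc k \<le> q" "q < l" "x (Suc q) \<le> x (Suc k) - 1" "x (Suc k) - 1 < x q"
        using crossing_leftward[of "Suc k" l "x (Suc k) - 1"] less.prems v by auto
      then show ?thesis using prev[of q "x (Suc k) - 1"] v hcov_L[of q "x (Suc k) - 1"] by auto
    qed
    show ?thesis
    proof (cases "x (Suc k) \<le> i")
      case True
      show ?thesis
      proof (cases "x l \<le> i")
        case True
        then have R: "i < x (Suc l)" using less.prems by (auto simp: hcov_def)
        have up: "y (l - 1) < y l" using right_after_up[of l] R True less.prems by auto
        show ?thesis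
        proof (cases "x (Suc k) \<le> x l")
          case True
          have "x (l - 1) \<noteq> x l" using x_step[of "l - 1"] l less.prems by auto
          then have "hcov x (l - 1) (x l) \<or> hcov x (l - 1) (x l - 1)" using l by (auto simp: hcov_def)
          then have "y (Suc k) \<le> y (l - 1)"
            using less.IH[of "l - 1" "x l"] less.IH[of "l - 1" "x l - 1"] l True less.prems by fastforce
          then show ?thesis using up by simp
        next
          case False
          then show ?thesis using viaL R True \<open>x (Suc k) \<le> i\<close> by (auto simp: hcov_def)
        qed
      next
        case False
        then obtain q where "Suc k \<le> q" "q < l" "x q \<le> i" "i < x (Suc q)"
          using crossing_rightward[of "Suc k" l i] less.prems True by auto
        then show ?thesis using prev[of q i] less.prems hcov_R by auto
      qed
    next
      case False
      then have i: "i = x (Suc k) - 1" using less.prems by auto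
      show ?thesis
      proof (cases "x l \<le> i")
        case True
        then show ?thesis using viaL i less.prems by auto
      next
        case False
        then have L: "x (Suc l) \<le> i" using less.prems by (auto simp: hcov_def)
        show ?thesis
        proof (cases "x l = x (Suc k)")
          case True
          have "x (l - 1) \<noteq> x l" using x_step[of "l - 1"] l less.prems by auto
          then consider "x (l - 1) < x l" | "x l < x (l - 1)" by linarith
          then show ?thesis
          proof cases
            case 1
            then have "hcov x (l - 1) i" using l True i by (auto simp: hcov_def)
            then show ?thesis using prev[of "l - 1" i] l less.prems by auto
          next
            case 2
            then have "hcov x (l - 1) (x l)" using l by (auto simp: hcov_def)
            then have z: "y (Suc k) \<le> y (l - 1)" using less.IH[of "l - 1" "x l"] l True less.prems by auto
            show ?thesis
            proof (rule ccontr)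
              assume c: "\<not> y (Suc k) \<le> y l"
              \<comment> \<open>The chain arrives at the line of the wall from the right and turns
                left exactly on that line. Ending below the top, its vertical piece would share row
                \<open>j\<close> with the wall at the same abscissa, but row crossings move strictly
                to the left.\<close>
              define j where "j = max (y k) (y l)"
              have "hcov y k j" "hcov y (l - 1) j" using U z c l by (auto simp: hcov_def j_def)
              then have "x (Suc (l - 1)) < x (Suc k)"
                using row_crossings_descend[of k "l - 1" j] l less.prems by auto
              then show False using True l by auto
            qed
          qed
        next
          case False
          then have "x (Suc k) < x l" using \<open>\<not> x l \<le> i\<close> i by auto
          then obtain q where "Suc k \<le> q" "q < l" "x q \<le> x (Suc k)" "x (Suc k) < x (Suc q)"
            using crossing_rightward[of "Suc k" l "x (Suc k)"] less.prems by auto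
          then show ?thesis using prev[of q "x (Suc k)"] hcov_R hcov_L[of l "x (Suc k)"] L i \<open>x (Suc k) < x l\<close> by auto
        qed
      qed
    qed
  qed simp
qed

text \<open>Going back from a rightward edge the heights fall: an upward edge precedes it, and if
  the edge before that comes from the right, an earlier rightward crossing of the same column lies
  below. The trace ends over column \<open>x (Suc k)\<close>, so for a rectangle it is enough to
  watch the ceilings over its first column.\<close>

lemma right_crossing_beyond:
  assumes "k < l" "l < N" "x l \<le> i" "i < x (Suc l)" "x (Suc k) \<le> i"
  shows "\<exists>q. k < q \<and> q \<le> l \<and> x q \<le> x (Suc k) \<and> x (Suc k) < x (Suc q) \<and> y q \<le> y l"
  using assms
proof (induction l arbitrary: i rule: less_induct)
  case (less l)
  show ?case
  proof (cases "x l \<le> x (Suc k)")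
    case True then show ?thesis using less.prems by auto
  next
    case False
    then have l: "k < l - 1" "l - 1 < l" "Suc (l - 1) = l" "l - 1 < N" using less.prems by (cases "l = Suc k"; auto)+
    have up: "y (l - 1) < y l" using right_after_up[of l] less.prems by auto
    have "x (l - 1) \<noteq> x l" using x_step[of "l - 1"] l less.prems by auto
    then consider "x (l - 1) < x l" | "x l < x (l - 1)" by linarith
    then show ?thesis
    proof cases
      case 1
      then show ?thesis using less.IH[of "l - 1" "x l - 1"] l less.prems False up by fastforce
    next
      case 2
      obtain q where q: "Suc k \<le> q" "q < l - 1" "x q \<le> x l" "x l < x (Suc q)"
        using crossing_rightward[of "Suc k" "l - 1" "x l"] 2 False l by auto
      then have "y q < y (l - 1)" using column_crossings_ascend[of q "l - 1" "x l"] hcov_R hcov_L[of "l - 1" "x l"] 2 l by auto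
      then show ?thesis using less.IH[of q "x l"] q up False l less.prems(2) by fastforce
    qed
  qed
qed

text \<open>The most recent floor in column \<open>i\<close> after piece \<open>k\<close>. With the
  default \<open>y N\<close>, the height of the top edge, columns without a floor act as
  walls.\<close>

primrec phi :: "nat \<Rightarrow> int \<Rightarrow> int" where
  "phi 0 i = (if x 1 \<le> i \<and> i < x 0 then y 0 else y N)"
| "phi (Suc k) i = (if x (Suc (Suc k)) \<le> i \<and> i < x (Suc k) then y (Suc k) else phi k i)"

text \<open>A chain that started right of a column and is now left of it crossed it last in leftward
  direction, and has stayed left since.\<close>

lemma phi_last_floor:
  assumes "x (Suc k) \<le> i" "i < x 0"
  shows "\<exists>l\<le>k. x (Suc l) \<le> i \<and> i < x l \<and> phi k i = y l \<and> (\<forall>q. l < q \<and> q \<le> k \<longrightarrow> x q \<le> i \<and> x (Suc q) \<le> i)"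
  using assms
proof (induction k)
  case (Suc k)
  show ?case
  proof (cases "i < x (Suc k)")
    case True then show ?thesis using Suc.prems by (intro exI[of _ "Suc k"]) auto
  next
    case False
    then have "x (Suc k) \<le> i" by simp
    from Suc.IH[OF this Suc.prems(2)] obtain l where l: "l\<le>k" "x (Suc l) \<le> i" "i < x l" "phi k i = y l"
        "\<forall>q. l < q \<and> q \<le> k \<longrightarrow> x q \<le> i \<and> x (Suc q) \<le> i"
      by blast
    have "x q \<le> i \<and> x (Suc q) \<le> i" if "l < q" "q \<le> Suc k" for q
      using l(5) that Suc.prems \<open>x (Suc k) \<le> i\<close> by (cases "q = Suc k") auto
    moreover have "phi (Suc k) i = y l" using False l by simp
    ultimately show ?thesis using l le_SucI by blast
  qed
qed auto

end

text \<open>\<open>inn i j\<close> stands for: the open unit square with lower left corner \<open>(i, j)\<close> belongs to the hole.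
  The chain is the boundary from the lower end of the rightmost edge to the left end of the top
  edge. It is closed up by the top edge, which ends at the abscissa \<open>c1\<close>, a descent to height \<open>c2\<close>
  at the falling corner \<open>(c1, c2)\<close>, and the rightmost edge; without falling corner
  \<open>(c1, c2)\<close> is the top right corner.\<close>

locale bls_chain = chain +
  fixes inn :: "int \<Rightarrow> int \<Rightarrow> bool" and c1 c2 w h :: int
  assumes N_pos: "0 < N" and first_left: "x 1 < x 0"
    and corner: "x N < c1" "c1 \<le> x 0" "c2 \<le> y N"
    and above_left: "k < N \<Longrightarrow> x (Suc k) \<le> i \<Longrightarrow> i < x k \<Longrightarrow> inn i (y k) \<and> \<not> inn i (y k - 1)"
    and below_right: "k < N \<Longrightarrow> x k \<le> i \<Longrightarrow> i < x (Suc k) \<Longrightarrow> \<not> inn i (y k) \<and> inn i (y k - 1)"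
    and change_up: "inn i j \<noteq> inn i (j - 1) \<Longrightarrow>
      (\<exists>k<N. hcov x k i \<and> y k = j) \<or> x N \<le> i \<and> i < c1 \<and> j = y N \<or> c1 \<le> i \<and> i < x 0 \<and> j = c2"
    and right_of_up: "k < N \<Longrightarrow> y k \<le> j \<Longrightarrow> j < y (Suc k) \<Longrightarrow> inn (x (Suc k)) j \<and> \<not> inn (x (Suc k) - 1) j"
    and right_of_down: "k < N \<Longrightarrow> y (Suc k) \<le> j \<Longrightarrow> j < y k \<Longrightarrow> \<not> inn (x (Suc k)) j"
    and change_right: "inn i j \<Longrightarrow> \<not> inn (i - 1) j \<Longrightarrow> \<exists>k<N. y k \<le> j \<and> j < y (Suc k) \<and> x (Suc k) = i"
    and bounded_above: "\<exists>B. \<forall>i j. inn i j \<longrightarrow> j < B"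
    and size: "0 < w" "0 < h"
begin

section \<open>Inside and outside cells of the closed-up chain\<close>

lemma inn_const_upward:
  assumes "j \<le> j'" "\<And>k. k < N \<Longrightarrow> hcov x k i \<Longrightarrow> j < y k \<Longrightarrow> j' < y k"
    "x N \<le> i \<Longrightarrow> i < c1 \<Longrightarrow> j < y N \<Longrightarrow> j' < y N" "c1 \<le> i \<Longrightarrow> i < x 0 \<Longrightarrow> j < c2 \<Longrightarrow> j' < c2"
  shows "inn i j' = inn i j"
proof -
  have "inn i (j + int n) = inn i j" if "j + int n \<le> j'" for n
    using that
  proof (induction n)
    case (Suc n)
    have "inn i (j + int (Suc n)) = inn i (j + int (Suc n) - 1)"
    proof (rule ccontr)
      assume "inn i (j + int (Suc n)) \<noteq> inn i (j + int (Suc n) - 1)"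
      from change_up[OF this] show False using assms Suc.prems by fastforce
    qed
    then show ?case using Suc by simp
  qed simp
  from this[of "nat (j' - j)"] assms(1) show ?thesis by simp
qed

text \<open>Above the highest boundary edge of a column membership never changes again, and the
  inside is bounded.\<close>

lemma not_inn_no_crossing_above:
  assumes "\<And>k. k < N \<Longrightarrow> hcov x k i \<Longrightarrow> y k \<le> j" "x N \<le> i \<Longrightarrow> i < c1 \<Longrightarrow> y N \<le> j"
    "c1 \<le> i \<Longrightarrow> i < x 0 \<Longrightarrow> c2 \<le> j"
  shows "\<not> inn i j"
proof
  assume a: "inn i j"
  obtain B where B: "\<And>i j. inn i j \<Longrightarrow> j < B" using bounded_above by blast
  have "inn i (max j B)" using inn_const_upward[of j "max j B" i] a assms by force
  then show False using B by fastforce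
qed

text \<open>A rightmost point of the later chain that is not left of \<open>x 0\<close> would be
  reached by a rightward edge and left by an upward one, with the inside to its right; but no
  boundary edge covers the column there.\<close>

lemma x_less: assumes "0 < k" "k \<le> N" shows "x k < x 0"
proof (rule ccontr)
  assume c: "\<not> x k < x 0"
  define m where "m = arg_min_on (\<lambda>q. - x q) {1..N}"
  have m: "1 \<le> m" "m \<le> N" and mm: "\<And>q. 1 \<le> q \<Longrightarrow> q \<le> N \<Longrightarrow> x q \<le> x m"
    using arg_min_if_finite(1)[of "{1..N}" "\<lambda>q. - x q"] arg_min_least[of "{1..N}" _ "\<lambda>q. - x q"] N_pos
    by (auto simp: m_def)
  have m0: "x 0 \<le> x m" using mm[of k] assms c by auto
  have mx: "x q \<le> x m" if "q \<le> N" for q using mm[of q] m0 that by (cases q) auto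
  have "x (m - 1) < x m" using mx[of "m - 1"] x_step[of "m - 1"] m by (cases m) auto
  then have "y (m - 1) < y m" using right_up[of "m - 1"] m by auto
  then have "inn (x m) (y (m - 1))" using right_of_up[of "m - 1" "y (m - 1)"] m by auto
  moreover have "\<not> inn (x m) (y (m - 1))"
  proof (rule not_inn_no_crossing_above)
    fix q assume "q < N" "hcov x q (x m)"
    then show "y q \<le> y (m - 1)" using mx[of q] mx[of "Suc q"] by (auto simp: hcov_def)
  qed (use m0 corner in auto)
  ultimately show False by blast
qed

lemma y_less: assumes "k < N" shows "y k < y N"
proof (rule ccontr)
  assume c: "\<not> y k < y N"
  define m where "m = arg_min_on (\<lambda>q. - y q) {0..<N}"
  have m: "m < N" and mm: "\<And>q. q < N \<Longrightarrow> y q \<le> y m"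
    using arg_min_if_finite(1)[of "{0..<N}" "\<lambda>q. - y q"] arg_min_least[of "{0..<N}" _ "\<lambda>q. - y q"] N_pos
    by (auto simp: m_def)
  have mx: "y N \<le> y m" using mm[of k] assms c by auto
  have "\<not> x m < x (Suc m)"
    using right_up[of m] m mx mm[of "Suc m"] by (cases "Suc m = N") auto
  then have L: "x (Suc m) < x m" using x_step[of m] m by auto
  then have "inn (x (Suc m)) (y m)" using above_left[of m] m by auto
  moreover have "\<not> inn (x (Suc m)) (y m)"
    using mm mx corner by (intro not_inn_no_crossing_above) auto
  ultimately show False by blast
qed

lemma y_le: "k \<le> N \<Longrightarrow> y k \<le> y N"
  using y_less[of k] by (cases "k = N") auto

lemma not_inn_right: "x 0 \<le> i \<Longrightarrow> \<not> inn i j"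
proof (rule not_inn_no_crossing_above)
  fix k assume "x 0 \<le> i" "k < N" "hcov x k i"
  then show "y k \<le> j" using x_less[of k] x_less[of "Suc k"] by (cases "k = 0") (auto simp: hcov_def)
qed (use corner in auto)

text \<open>The chain ends left of column \<open>i\<close>, so its last and highest crossing there
  is a floor with the inside above it; only the edge at height \<open>c2\<close> can close the
  column.\<close>

lemma below_corner_height:
  assumes "c1 \<le> i" "i < x 0" "k < N" "hcov x k i"
  shows "y k < c2"
proof (rule ccontr)
  assume c: "\<not> y k < c2"
  define K where "K = (GREATEST q. q < N \<and> hcov x q i)"
  have K: "K < N" "hcov x K i" and Km: "\<And>q. q < N \<Longrightarrow> hcov x q i \<Longrightarrow> q \<le> K"
    using GreatestI_nat[of "\<lambda>q. q < N \<and> hcov x q i" k N] Greatest_le_nat[of "\<lambda>q. q < N \<and> hcov x q i" _ N] assms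
    by (auto simp: K_def)
  have "y k \<le> y K" using column_crossings_ascend[of k K i] assms K Km[of k] by (cases "k = K") auto
  then have yK: "c2 \<le> y K" using c by auto
  have "x (Suc K) \<le> i"
  proof (rule ccontr)
    assume "\<not> x (Suc K) \<le> i"
    moreover have "x N \<le> i" using corner assms by auto
    ultimately obtain r where "Suc K \<le> r" "r < N" "x (Suc r) \<le> i" "i < x r" using crossing_leftward[of "Suc K" N i] K by auto
    then show False using Km[of r] hcov_L by auto
  qed
  moreover have "i < x K" using K x_step[of K] calculation by (auto simp: hcov_def)
  ultimately have "inn i (y K)" using above_left K by auto
  moreover have "\<not> inn i (y K)"
  proof (rule not_inn_no_crossing_above)
    fix q assume q: "q < N" "hcov x q i"
    show "y q \<le> y K" using column_crossings_ascend[of q K i] q K Km[of q] by (cases "q = K") auto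
  qed (use assms yK in auto)
  ultimately show False by blast
qed

lemma not_inn_beyond_corner:
  assumes "c1 \<le> i" "c2 \<le> j" shows "\<not> inn i j"
proof (cases "i < x 0")
  case True
  then show ?thesis using below_corner_height[OF assms(1) True] assms by (intro not_inn_no_crossing_above) force+
qed (use not_inn_right in auto)

lemma inn_above_floor:
  assumes "l < N" "x (Suc l) \<le> i" "i < x l" "y l \<le> j"
    and "\<And>q. l < q \<Longrightarrow> q < N \<Longrightarrow> x q \<le> i \<Longrightarrow> i < x (Suc q) \<Longrightarrow> j < y q"
    and "i < c1 \<Longrightarrow> j < y N" "c1 \<le> i \<Longrightarrow> j < c2" "i < x 0"
  shows "inn i j"
proof -
  have "inn i (y l)" using above_left assms by auto
  moreover have "inn i j = inn i (y l)"
  proof (rule inn_const_upward)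
    fix q assume q: "q < N" "hcov x q i" "y l < y q"
    have lq: "l < q" using column_crossings_ascend[of q l i] q hcov_L[of l i] assms by (cases q l rule: linorder_cases) auto
    show "j < y q"
    proof (cases "x q \<le> i")
      case True then show ?thesis using assms(5)[of q] lq q by (auto simp: hcov_def)
    next
      case False
      then obtain r where r: "Suc l \<le> r" "r < q" "x r \<le> i" "i < x (Suc r)"
        using crossing_rightward[of "Suc l" q i] lq assms by auto
      then show ?thesis using assms(5)[of r] column_crossings_ascend[of r q i] hcov_R[of r i] q by auto
    qed
  qed (use assms in auto)
  ultimately show ?thesis by blast
qed

section \<open>Stable locations in terms of floors and ceilings\<close>

definition stable :: "int \<Rightarrow> int \<Rightarrow> bool" where
  "stable a b \<longleftrightarrow> (\<forall>i\<in>{a..<a+w}. \<forall>j\<in>{b..<b+h}. inn i j) \<and>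
     (\<exists>j\<in>{b..<b+h}. \<not> inn (a - 1) j) \<and> (\<exists>i\<in>{a..<a+w}. \<not> inn i (b - 1))"

text \<open>The two inequalities for \<open>b\<close> say that upward edge \<open>k\<close> shares a
  row with the left side of the rectangle. The rest fixes \<open>b\<close> as the maximal floor
  under the rectangle at that moment; floors added later are not consulted.\<close>

definition candidate :: "nat \<Rightarrow> int \<Rightarrow> bool" where
  "candidate k b \<longleftrightarrow> k < N \<and> y k < y (Suc k) \<and> b < y (Suc k) \<and> y k < b + h \<and>
     (\<forall>i\<in>{x (Suc k)..<x (Suc k) + w}. phi k i \<le> b) \<and> (\<exists>i\<in>{x (Suc k)..<x (Suc k) + w}. phi k i = b)"

definition clear :: "nat \<Rightarrow> int \<Rightarrow> bool" where
  "clear k b \<longleftrightarrow> (\<forall>l. k < l \<and> l < N \<and> x l \<le> x (Suc k) \<and> x (Suc k) < x (Suc l) \<longrightarrow> b + h \<le> y l)"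

lemma phi_right: "x 0 \<le> i \<Longrightarrow> k < N \<Longrightarrow> phi k i = y N"
proof (induction k)
  case (Suc k) then show ?case using x_less[of "Suc k"] by simp
qed simp

text \<open>Beyond \<open>x 0\<close> the floor has its default \<open>y N\<close>, and a candidate
  height is below the top of an edge of the chain.\<close>

lemma candidate_width: assumes "candidate k b" shows "x (Suc k) + w \<le> x 0"
proof (rule ccontr)
  assume "\<not> x (Suc k) + w \<le> x 0"
  then have "phi k (x (Suc k) + w - 1) = y N"
    using assms phi_right[of "x (Suc k) + w - 1" k] size by (auto simp: candidate_def)
  moreover have "phi k (x (Suc k) + w - 1) \<le> b"
    using assms size unfolding candidate_def by (elim conjE ballE[of _ _ "x (Suc k) + w - 1"]) auto
  ultimately have "y N \<le> b" by simp
  then show False using assms y_le[of "Suc k"] by (auto simp: candidate_def)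
qed

lemma stableI:
  assumes c: "candidate k b" and cl: "clear k b" and top: "b + h \<le> y N"
    and cor: "\<not> (c1 < x (Suc k) + w \<and> c2 < b + h)"
  shows "stable (x (Suc k)) b"
proof -
  have k: "k < N" "y k < y (Suc k)" "b < y (Suc k)" "y k < b + h" using c by (auto simp: candidate_def)
  have wd: "x (Suc k) + w \<le> x 0" using candidate_width[OF c] .
  have "inn i j" if i: "i \<in> {x (Suc k)..<x (Suc k)+w}" and j: "j \<in> {b..<b+h}" for i j
  proof -
    obtain l where l: "l\<le>k" "x (Suc l) \<le> i" "i < x l" "phi k i = y l" "\<forall>q. l < q \<and> q \<le> k \<longrightarrow> x q \<le> i \<and> x (Suc q) \<le> i"
      using phi_last_floor[of k i] i wd by auto
    have "y l \<le> b" using c i l unfolding candidate_def by metis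
    show ?thesis
    proof (rule inn_above_floor)
      fix q assume q: "l < q" "q < N" "x q \<le> i" "i < x (Suc q)"
      \<comment> \<open>From floor \<open>l\<close> up to edge \<open>k\<close> the chain stays left
        of column \<open>i\<close>, so a ceiling over \<open>i\<close> comes later than
        \<open>k\<close>, and some ceiling over the first column is no higher.\<close>
      then have "k < q" using l by force
      then obtain q' where "k < q'" "q' \<le> q" "x q' \<le> x (Suc k)" "x (Suc k) < x (Suc q')" "y q' \<le> y q"
        using right_crossing_beyond[of k q i] q i by auto
      then show "j < y q" using cl j q by (fastforce simp: clear_def)
    qed (use l k i j wd top cor \<open>y l \<le> b\<close> in auto)
  qed
  moreover have "\<exists>j\<in>{b..<b+h}. \<not> inn (x (Suc k) - 1) j"
    using right_of_up[of k "max b (y k)"] k size by (intro bexI[of _ "max b (y k)"]) auto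
  moreover have "\<exists>i\<in>{x (Suc k)..<x (Suc k)+w}. \<not> inn i (b - 1)"
  proof -
    obtain i where i: "i \<in> {x (Suc k)..<x (Suc k)+w}" "phi k i = b" using c by (auto simp: candidate_def)
    obtain l where l: "l\<le>k" "x (Suc l) \<le> i" "i < x l" "phi k i = y l"
      using phi_last_floor[of k i] i wd by auto
    then show ?thesis using above_left[of l i] i k by auto
  qed
  ultimately show ?thesis by (auto simp: stable_def)
qed

lemma stableD:
  assumes st: "stable a b"
  shows "\<exists>k. x (Suc k) = a \<and> candidate k b \<and> clear k b \<and> b + h \<le> y N \<and> \<not> (c1 < a + w \<and> c2 < b + h)"
proof -
  have inn: "\<And>i j. a \<le> i \<Longrightarrow> i < a + w \<Longrightarrow> b \<le> j \<Longrightarrow> j < b + h \<Longrightarrow> inn i j"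
    using st by (auto simp: stable_def)
  obtain j0 where j0: "b \<le> j0" "j0 < b + h" "\<not> inn (a - 1) j0" using st by (auto simp: stable_def)
  then obtain k where k: "k < N" "y k \<le> j0" "j0 < y (Suc k)" "x (Suc k) = a"
    using change_right[of a j0] inn[of a j0] size by auto
  have wd: "a + w \<le> x 0" using not_inn_right[of "a + w - 1" b] inn[of "a + w - 1" b] size by fastforce
  \<comment> \<open>Edge \<open>k\<close> rises above row \<open>j0\<close>. Being a wall it keeps
    later ceilings over the window above \<open>b\<close>, and one below \<open>b + h\<close> would
    leave an outside cell in the rectangle.\<close>
  have hi: "b < y l \<and> b + h \<le> y l" if "k < l" "l < N" "x l \<le> i" "i < x (Suc l)" "a \<le> i" "i < a + w" for l i
  proof -
    have 1: "y (Suc k) \<le> y l" using later_crossings_above[of k l i] that k hcov_R[of l i] by auto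
    have "\<not> inn i (y l)" using below_right[of l i] that by auto
    then show ?thesis using inn[of i "y l"] that 1 k j0 by fastforce
  qed
  have le: "phi k i \<le> b" if i: "a \<le> i" "i < a + w" for i
  proof (rule ccontr)
    assume gt: "\<not> phi k i \<le> b"
    obtain l where l: "l\<le>k" "x (Suc l) \<le> i" "i < x l" "phi k i = y l" "\<forall>q. l < q \<and> q \<le> k \<longrightarrow> x q \<le> i \<and> x (Suc q) \<le> i"
      using phi_last_floor[of k i] i wd k by auto
    have "\<not> inn i (y l - 1)" using above_left[of l i] l k by auto
    then have yl: "b + h \<le> y l" using inn[of i "y l - 1"] gt l i by fastforce
    \<comment> \<open>Floor \<open>l\<close> is above row \<open>j0\<close> and edge
      \<open>k\<close> starts at or below it, so the chain descends through this row in
      between.\<close>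
    have "\<exists>d. l \<le> d \<and> d < k \<and> y (Suc d) \<le> j0 \<and> j0 < y d"
    proof (rule ccontr)
      assume nd: "\<not> ?thesis"
      have "j0 < y d" if "l \<le> d" "d \<le> k" for d
        using that
      proof (induction d rule: dec_induct)
        case base then show ?case using yl j0 by auto
      next
        case (step d) then show ?case using nd by (meson Suc_le_lessD less_or_eq_imp_le not_less)
      qed
      from this[of k] l k show False by auto
    qed
    then obtain d where d: "l \<le> d" "d < k" "y (Suc d) \<le> j0" "j0 < y d" by auto
    \<comment> \<open>The order within a row puts the descent right of the left side; after floor
      \<open>l\<close> the chain is not right of \<open>i\<close>. The descent would therefore cut
      the rectangle.\<close>
    have "x (Suc k) < x (Suc d)" using row_crossings_descend[of d k j0] d k by (auto simp: hcov_def)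
    moreover have "x (Suc d) \<le> i" using l d by (cases "d = l") auto
    ultimately have "inn (x (Suc d)) j0" using inn k i j0 by auto
    then show False using right_of_down[of d j0] d k by auto
  qed
  obtain i where i: "a \<le> i" "i < a + w" "\<not> inn i (b - 1)" using st by (auto simp: stable_def)
  have bN: "b + h \<le> y N"
  proof (rule ccontr)
    assume c: "\<not> b + h \<le> y N"
    have "inn a (b + h - 1)" using inn[of a "b + h - 1"] size by auto
    moreover have "\<not> inn a (b + h - 1)"
    proof (rule not_inn_no_crossing_above)
      show "y q \<le> b + h - 1" if "q < N" for q using y_less[OF that] c by auto
    qed (use c corner in auto)
    ultimately show False by blast
  qed
  have eq: "phi k i = b"
  proof -
    have "inn i b" using inn[of i b] i size by auto
    then consider (1) l where "l < N" "hcov x l i" "y l = b" | (2) "b = y N" | (3) "c1 \<le> i" "b = c2" using change_up[of i b] i by auto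
    then show ?thesis
    proof cases
      case 1
      have L: "x (Suc l) \<le> i" "i < x l"
        using below_right[of l i] 1 inn[of i b] i size by (force simp: hcov_def)+
      have "l \<le> k"
      proof (rule ccontr)
        assume lk: "\<not> l \<le> k"
        then obtain r where r: "Suc k \<le> r" "r < l" "x r \<le> i" "i < x (Suc r)"
          using crossing_rightward[of "Suc k" l i] i k L by auto
        then have "y r < y l" using column_crossings_ascend[of r l i] 1 hcov_R by auto
        then show False using hi[of r i] r 1 i by auto
      qed
      obtain l' where l': "l'\<le>k" "x (Suc l') \<le> i" "i < x l'" "phi k i = y l'" "\<forall>q. l' < q \<and> q \<le> k \<longrightarrow> x q \<le> i \<and> x (Suc q) \<le> i"
        using phi_last_floor[of k i] i wd k by auto
      \<comment> \<open>The floor at height \<open>b\<close> could have been overlaid by a later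
        one, but later floors are higher and none over the window exceeds \<open>b\<close>.\<close>
      have "l \<le> l'" using l'(5) \<open>l \<le> k\<close> L by (meson leD not_le_imp_less)
      then have "y l \<le> y l'" using column_crossings_ascend[of l l' i] 1 hcov_L[of l' i] l' k by (cases "l = l'") auto
      then show ?thesis using le[of i] i l' 1 by auto
    next
      case 2 then show ?thesis using bN size by auto
    next
      case 3 then show ?thesis using not_inn_beyond_corner[of i b] \<open>inn i b\<close> by auto
    qed
  qed
  have "\<not> (c1 < a + w \<and> c2 < b + h)"
    using not_inn_beyond_corner[of "a + w - 1" "b + h - 1"] inn[of "a + w - 1" "b + h - 1"] size by auto
  moreover have "clear k b" using hi k size by (auto simp: clear_def)
  moreover have "candidate k b"
    using k j0 le eq i by (auto simp: candidate_def intro!: bexI[of _ i])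
  ultimately show ?thesis using k bN by blast
qed

end

section \<open>The sweep\<close>

type_synonym floor = "int \<times> int \<times> int \<times> int"

type_synonym lists = "(int \<times> int) list \<times> floor list \<times> (int \<times> int) list \<times> (int \<times> int) list"

text \<open>The four lists: high floors \<open>G\<close> (left end, height) of increasing height; visible floors \<open>S\<close>
  (right end, height, position and height of the next higher floor to the right); candidate
  locations \<open>P\<close> that still await the ceiling above their left side; reported locations.\<close>

definition blocked :: "int \<Rightarrow> int \<Rightarrow> floor \<Rightarrow> bool" where
  "blocked B z e \<longleftrightarrow> fst (snd (snd e)) < B \<and> snd (snd (snd e)) < z"

text \<open>Called for a ceiling at height \<open>z\<close> with right end \<open>X\<close>. A
  prefix of \<open>P\<close> is enough, since \<open>P\<close> is sorted by abscissa and no waiting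
  location lies left of the ceiling.\<close>

definition flush :: "int \<Rightarrow> int \<Rightarrow> int \<Rightarrow> int \<Rightarrow> int \<Rightarrow> int \<Rightarrow> lists \<Rightarrow> lists" where
  "flush w h c1 c2 X z = (\<lambda>(G, S, P, R). (G, S, dropWhile (\<lambda>e. fst e < X) P,
     rev (filter (\<lambda>e. snd e + h \<le> z \<and> \<not> (c1 < fst e + w \<and> c2 < snd e + h)) (takeWhile (\<lambda>e. fst e < X) P)) @ R))"

definition leftward :: "int \<Rightarrow> int \<Rightarrow> int \<Rightarrow> lists \<Rightarrow> lists" where
  "leftward X Y X' = (\<lambda>(G, S, P, R). let G' = dropWhile (\<lambda>e. snd e \<le> Y) G in
     ((X', Y) # G', (X, Y, hd G') # S, P, R))"

definition rightward :: "int \<Rightarrow> int \<Rightarrow> int \<Rightarrow> int \<Rightarrow> int \<Rightarrow> int \<Rightarrow> lists \<Rightarrow> lists" where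
  "rightward w h c1 c2 Y X' = (\<lambda>(G, S, P, R).
     flush w h c1 c2 X' Y (G, dropWhile (\<lambda>e. fst e \<le> X') S, P, R))"

definition upward :: "int \<Rightarrow> int \<Rightarrow> int \<Rightarrow> int \<Rightarrow> int \<Rightarrow> lists \<Rightarrow> lists" where
  "upward w h X Y Y' = (\<lambda>(G, S, P, R). let S' = dropWhile (blocked (X + w) Y') S; (b, v, nx, ny) = hd S' in
     (G, S', if X + w \<le> nx \<and> Y < v + h then (X, v) # P else P, R))"

definition hstep :: "int \<Rightarrow> int \<Rightarrow> int \<Rightarrow> int \<Rightarrow> int \<Rightarrow> int \<Rightarrow> int \<Rightarrow> lists \<Rightarrow> lists" where
  "hstep w h c1 c2 X Y X' = (if X' < X then leftward X Y X' else rightward w h c1 c2 Y X')"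

definition vstep :: "int \<Rightarrow> int \<Rightarrow> int \<Rightarrow> int \<Rightarrow> int \<Rightarrow> lists \<Rightarrow> lists" where
  "vstep w h X Y Y' = (if Y < Y' then upward w h X Y Y' else id)"

section \<open>Invariants of the sweep and the effect of each edge\<close>

context bls_chain
begin

primrec look :: "floor list \<Rightarrow> int \<Rightarrow> int" where
  "look [] i = y N"
| "look (e # S) i = (if i < fst e then fst (snd e) else look S i)"

primrec linked :: "floor list \<Rightarrow> bool" where
  "linked [] = True"
| "linked (e # S) \<longleftrightarrow> (case e of (b, v, nx, ny) \<Rightarrow> linked S \<and> (\<forall>e'\<in>set S. b < fst e') \<and> b \<le> nx \<and> b \<le> x 0 \<and> v < ny \<and>
     look S nx = ny \<and> (\<forall>i. b \<le> i \<and> i < nx \<longrightarrow> look S i \<le> v))"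

text \<open>Heights before piece \<open>k\<close>. The shift against \<open>phi\<close> lets the
  sweep start with nothing but wall.\<close>

primrec psi :: "nat \<Rightarrow> int \<Rightarrow> int" where
  "psi 0 i = y N"
| "psi (Suc k) i = phi k i"

lemma psi_Suc: "psi (Suc k) i = (if x (Suc k) \<le> i \<and> i < x k then y k else psi k i)"
  by (cases k) simp_all

text \<open>Narrow valleys may be filled: a stored height exceeds the true one only if every window of
  width \<open>w\<close> that contains the column also contains a column that is at least as high.\<close>

definition represents :: "(int \<Rightarrow> int) \<Rightarrow> int \<Rightarrow> nat \<Rightarrow> floor list \<Rightarrow> bool" where
  "represents f X K S \<longleftrightarrow> linked S \<and> (\<forall>e\<in>set S. X < fst e) \<and>
     (\<forall>i\<ge>X. f i \<le> look S i \<and> (f i < look S i \<longrightarrow>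
        (\<exists>u v. u < i \<and> i < v \<and> v \<le> u + w \<and> look S i \<le> f v \<and>
           (\<forall>l i'. K \<le> l \<and> l < N \<and> u \<le> i' \<and> hcov x l i' \<longrightarrow> look S i < y l) \<and> (u < X \<or> look S i \<le> f u))))"

text \<open>\<open>G\<close> answers where, from \<open>X\<close> on, the stored heights first
  exceed \<open>Y\<close>. After a rightward edge, which shortens \<open>S\<close> only, it may
  contain stale entries. The bound \<open>Yc\<close> restricts the claim to heights at or above that
  edge, and the next query is not lower because the chain then goes up.\<close>

definition indexes :: "int \<Rightarrow> int \<Rightarrow> (int \<times> int) list \<Rightarrow> floor list \<Rightarrow> bool" where
  "indexes Yc X G S \<longleftrightarrow> (\<forall>Y. Yc \<le> Y \<and> Y < y N \<longrightarrow> (\<exists>gx gy r. dropWhile (\<lambda>e. snd e \<le> Y) G = (gx, gy) # r \<and>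
     X \<le> gx \<and> (\<forall>i. X \<le> i \<and> i < gx \<longrightarrow> look S i \<le> Y) \<and> look S gx = gy))"

lemma look_append: "look (A @ S) i = (if \<exists>e\<in>set A. i < fst e then look A i else look S i)"
  by (induction A) auto

lemma look_in: "\<exists>e\<in>set A. i < fst e \<Longrightarrow> \<exists>e\<in>set A. look A i = fst (snd e)"
  by (induction A) auto

lemma linked_append: "linked (A @ S) \<Longrightarrow> linked S"
  by (induction A) auto

lemma linked_sorted: "linked S \<Longrightarrow> sorted_wrt (\<lambda>e e'. fst e < fst e') S"
  by (induction S) auto

lemma dropWhile_right:
  assumes "linked S" shows "\<forall>e\<in>set (dropWhile (\<lambda>e. fst e \<le> X) S). X < fst e"
  using linked_sorted[OF assms] by (induction S) auto

lemma look_dropWhile: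
  assumes "X \<le> i" shows "look (dropWhile (\<lambda>e. fst e \<le> X) S) i = look S i"
  using assms by (induction S) auto

lemma indexes_mono: "indexes Y X G S \<Longrightarrow> Y \<le> Y' \<Longrightarrow> indexes Y' X G S"
  unfolding indexes_def by (meson order_trans)

lemma leftward_step:
  assumes k: "k < N" and L: "x (Suc k) < x k"
    and r: "represents (psi k) (x k) k S" and g: "indexes (y k) (x k) G S"
    and G': "G' = dropWhile (\<lambda>e. snd e \<le> y k) G"
  shows "G' \<noteq> []" "represents (psi (Suc k)) (x (Suc k)) (Suc k) ((x k, y k, hd G') # S)"
    "indexes Yc (x (Suc k)) ((x (Suc k), y k) # G') ((x k, y k, hd G') # S)"
proof -
  have yk: "y k < y N" using y_less k by simp
  obtain gx gy r' where gg: "G' = (gx, gy) # r'" "x k \<le> gx" "\<forall>i. x k \<le> i \<and> i < gx \<longrightarrow> look S i \<le> y k" "look S gx = gy"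
    using g yk unfolding indexes_def G' by blast
  have gt: "y k < gy" using gg(1) hd_dropWhile[of "\<lambda>e. snd e \<le> y k" G] unfolding G' by fastforce
  show "G' \<noteq> []" using gg by simp
  let ?S = "(x k, y k, hd G') # S"
  have lS: "linked S" "\<forall>e\<in>set S. x k < fst e" using r by (auto simp: represents_def)
  have "x k \<le> x 0" using x_less[of k] k by (cases "k = 0") auto
  then have l: "linked ?S" using lS gg gt by auto
  show "represents (psi (Suc k)) (x (Suc k)) (Suc k) ?S"
    unfolding represents_def
  proof (intro conjI allI impI)
    show "linked ?S" by fact
    show "\<forall>e\<in>set ?S. x (Suc k) < fst e" using lS L by fastforce
    fix i assume i: "x (Suc k) \<le> i"
    show "psi (Suc k) i \<le> look ?S i"
      using r i by (cases "i < x k") (auto simp: psi_Suc represents_def simp del: psi.simps)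
    assume lt: "psi (Suc k) i < look ?S i"
    have ik: "x k \<le> i" using lt i by (auto simp: psi_Suc simp del: psi.simps split: if_splits)
    then have "psi k i < look S i" using lt by (simp add: psi_Suc del: psi.simps)
    then obtain u v where uv: "u < i" "i < v" "v \<le> u + w" "look S i \<le> psi k v"
      "\<And>l i'. k \<le> l \<Longrightarrow> l < N \<Longrightarrow> u \<le> i' \<Longrightarrow> hcov x l i' \<Longrightarrow> look S i < y l" "u < x k \<or> look S i \<le> psi k u"
      using r ik unfolding represents_def by blast
    \<comment> \<open>If the left bank \<open>u\<close> lies under the new floor, then piece
      \<open>k\<close> is one of the later pieces over \<open>u\<close>, so the new floor is itself
      above the filling and serves as the bank.\<close>
    have "u < x (Suc k) \<or> look S i \<le> psi (Suc k) u"
      using uv(5)[of k u] uv(6) hcov_L[of k u] k by (auto simp: psi_Suc simp del: psi.simps)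
    moreover have "look ?S i = look S i" using ik by simp
    moreover have "psi (Suc k) v = psi k v" using uv ik by (simp add: psi_Suc del: psi.simps)
    ultimately show "\<exists>u v. u < i \<and> i < v \<and> v \<le> u + w \<and> look ?S i \<le> psi (Suc k) v \<and>
           (\<forall>l i'. Suc k \<le> l \<and> l < N \<and> u \<le> i' \<and> hcov x l i' \<longrightarrow> look ?S i < y l) \<and> (u < x (Suc k) \<or> look ?S i \<le> psi (Suc k) u)"
      using uv by (metis Suc_leD)
  qed
  show "indexes Yc (x (Suc k)) ((x (Suc k), y k) # G') ?S"
    unfolding indexes_def
  proof (intro allI impI)
    fix Y assume Y: "Yc \<le> Y \<and> Y < y N"
    show "\<exists>gx gy r. dropWhile (\<lambda>e. snd e \<le> Y) ((x (Suc k), y k) # G') = (gx, gy) # r \<and> x (Suc k) \<le> gx \<and>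
       (\<forall>i. x (Suc k) \<le> i \<and> i < gx \<longrightarrow> look ?S i \<le> Y) \<and> look ?S gx = gy"
    proof (cases "y k \<le> Y")
      case True
      have d: "dropWhile (\<lambda>e. snd e \<le> Y) G' = dropWhile (\<lambda>e. snd e \<le> Y) G"
        unfolding G' using True by (induction G) auto
      obtain gx gy r' where gg: "dropWhile (\<lambda>e. snd e \<le> Y) G = (gx, gy) # r'" "x k \<le> gx"
          "\<forall>i. x k \<le> i \<and> i < gx \<longrightarrow> look S i \<le> Y" "look S gx = gy"
        using g True Y unfolding indexes_def by blast
      then show ?thesis using True d L by auto
    next
      case False
      then show ?thesis using L by auto
    qed
  qed
qed

text \<open>All heights stored under the ceiling are below it: true ones by the order within a
  column, filled ones by the clause on later pieces in \<open>represents\<close>. Hence an entry of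
  \<open>G\<close> above the ceiling lies beyond its end. The last claim prepares the filling at the
  upward edge that follows.\<close>

lemma rightward_step:
  assumes k: "k < N" and R: "x k < x (Suc k)"
    and r: "represents (psi k) (x k) k S" and g: "indexes (y k) (x k) G S"
    and S': "S' = dropWhile (\<lambda>e. fst e \<le> x (Suc k)) S"
  shows "represents (psi (Suc k)) (x (Suc k)) (Suc k) S'" "indexes (y k) (x (Suc k)) G S'"
    "look S' (x (Suc k)) < y (Suc k)"
proof -
  have k0: "0 < k" using first_left R by (cases k) auto
  have x0: "x (Suc k) < x 0" using x_less[of "Suc k"] k by simp
  have U: "y k < y (Suc k)" using right_up k R by simp
  have psi: "psi (Suc k) = psi k" using R by (auto simp: psi_Suc fun_eq_iff simp del: psi.simps)
  have lS: "linked S" "\<forall>e\<in>set S. x k < fst e" using r by (auto simp: represents_def)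
  have lS': "linked S'" unfolding S' by (metis lS(1) linked_append takeWhile_dropWhile_id)
  have rp: "psi k i \<le> look S i" "psi k i < look S i \<Longrightarrow>
        (\<exists>u v. u < i \<and> i < v \<and> v \<le> u + w \<and> look S i \<le> psi k v \<and>
           (\<forall>l i'. k \<le> l \<and> l < N \<and> u \<le> i' \<and> hcov x l i' \<longrightarrow> look S i < y l) \<and> (u < x k \<or> look S i \<le> psi k u))"
    if "x k \<le> i" for i using r that unfolding represents_def by blast+
  have last: "\<exists>l<k. x (Suc l) \<le> i \<and> i < x l \<and> psi k i = y l \<and> (\<forall>q. l < q \<and> q < k \<longrightarrow> x q \<le> i \<and> x (Suc q) \<le> i)"
    if "x k \<le> i" "i < x 0" for i
    using phi_last_floor[of "k - 1" i] that k0 by (cases k) (auto simp: less_Suc_eq_le)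
  have low: "look S i < y k" if i: "x k \<le> i" "i < x (Suc k)" for i
  proof (cases "psi k i < look S i")
    case True
    then show ?thesis using rp(2)[OF i(1)] hcov_R[of k i] i k by (metis less_imp_le order_refl)
  next
    case False
    obtain l where "l < k" "x (Suc l) \<le> i" "i < x l" "psi k i = y l" using last[of i] i x0 by auto
    then have "psi k i < y k" using column_crossings_ascend[of l k i] hcov_L[of l i] hcov_R[of k i] i k by simp
    then show ?thesis using False by simp
  qed
  show "represents (psi (Suc k)) (x (Suc k)) (Suc k) S'"
    unfolding represents_def psi
  proof (intro conjI allI impI)
    show "linked S'" by fact
    show "\<forall>e\<in>set S'. x (Suc k) < fst e" unfolding S' by (rule dropWhile_right) (rule lS)
    fix i assume i: "x (Suc k) \<le> i"
    have lk: "look S' i = look S i" unfolding S' by (rule look_dropWhile[OF i])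
    show "psi k i \<le> look S' i" using lk rp(1)[of i] i R by simp
    assume "psi k i < look S' i"
    then obtain u v where uv: "u < i" "i < v" "v \<le> u + w" "look S i \<le> psi k v"
      "\<And>l i'. k \<le> l \<Longrightarrow> l < N \<Longrightarrow> u \<le> i' \<Longrightarrow> hcov x l i' \<Longrightarrow> look S i < y l" "u < x k \<or> look S i \<le> psi k u"
      using rp(2)[of i] i R lk by auto
    then have "u < x (Suc k) \<or> look S i \<le> psi k u" using R by auto
    then show "\<exists>u v. u < i \<and> i < v \<and> v \<le> u + w \<and> look S' i \<le> psi k v \<and>
           (\<forall>l i'. Suc k \<le> l \<and> l < N \<and> u \<le> i' \<and> hcov x l i' \<longrightarrow> look S' i < y l) \<and> (u < x (Suc k) \<or> look S' i \<le> psi k u)"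
      using uv lk by (metis Suc_leD)
  qed
  show "indexes (y k) (x (Suc k)) G S'"
    unfolding indexes_def
  proof (intro allI impI)
    fix Y assume Y: "y k \<le> Y \<and> Y < y N"
    obtain gx gy r' where gg: "dropWhile (\<lambda>e. snd e \<le> Y) G = (gx, gy) # r'" "x k \<le> gx"
          "\<forall>i. x k \<le> i \<and> i < gx \<longrightarrow> look S i \<le> Y" "look S gx = gy"
      using g Y unfolding indexes_def by blast
    have "Y < gy" using gg(1) hd_dropWhile[of "\<lambda>e. snd e \<le> Y" G] by fastforce
    then have "x (Suc k) \<le> gx" using low[of gx] gg Y by force
    then show "\<exists>gx gy r. dropWhile (\<lambda>e. snd e \<le> Y) G = (gx, gy) # r \<and> x (Suc k) \<le> gx \<and>
       (\<forall>i. x (Suc k) \<le> i \<and> i < gx \<longrightarrow> look S' i \<le> Y) \<and> look S' gx = gy"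
      using gg R by (auto simp: S' look_dropWhile)
  qed
  have "look S (x (Suc k)) < y (Suc k)"
  proof (cases "psi k (x (Suc k)) < look S (x (Suc k))")
    case True
    then obtain u where "u < x (Suc k)" "\<forall>l i'. k \<le> l \<and> l < N \<and> u \<le> i' \<and> hcov x l i' \<longrightarrow> look S (x (Suc k)) < y l"
      using rp(2)[of "x (Suc k)"] R by auto
    \<comment> \<open>The column just left of the end is still under the ceiling and not left of the
      bank \<open>u\<close>, so the clause on later pieces applies to piece
      \<open>k\<close>.\<close>
    moreover have "u \<le> x (Suc k) - 1" using calculation by simp
    moreover have "hcov x k (x (Suc k) - 1)" using hcov_R[of k "x (Suc k) - 1"] R by simp
    ultimately have "look S (x (Suc k)) < y k" using k by blast
    then show ?thesis using U by simp
  next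
    case False
    obtain l where l: "l < k" "x (Suc l) \<le> x (Suc k)" "psi k (x (Suc k)) = y l" 
       "\<forall>q. l < q \<and> q < k \<longrightarrow> x q \<le> x (Suc k) \<and> x (Suc q) \<le> x (Suc k)"
      using last[of "x (Suc k)"] R x0 by auto
    have "y l < y (Suc k)"
    proof (rule ccontr)
      assume c: "\<not> y l < y (Suc k)"
      \<comment> \<open>A floor as high as the top of the next edge would force a descent through
        row \<open>y k\<close>. The upward edge crosses the same row later, hence further left,
        while after floor \<open>l\<close> the chain has not been right of that edge.\<close>
      have "\<exists>d. l \<le> d \<and> d < k \<and> y (Suc d) \<le> y k \<and> y k < y d"
      proof (rule ccontr)
        assume nd: "\<not> ?thesis"
        have "y k < y d" if "l \<le> d" "d \<le> k" for d
          using that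
        proof (induction d rule: dec_induct)
          case base then show ?case using c U by auto
        next
          case (step d) then show ?case using nd by (meson Suc_le_lessD less_or_eq_imp_le not_less)
        qed
        from this[of k] l show False by auto
      qed
      then obtain d where d: "l \<le> d" "d < k" "y (Suc d) \<le> y k" "y k < y d" by auto
      have "x (Suc k) < x (Suc d)" using row_crossings_descend[of d k "y k"] d k U by (auto simp: hcov_def)
      moreover have "x (Suc d) \<le> x (Suc k)" using l d by (cases "d = l") auto
      ultimately show False by simp
    qed
    then show ?thesis using False l by simp
  qed
  then show "look S' (x (Suc k)) < y (Suc k)" unfolding S' by (simp add: look_dropWhile)
qed

text \<open>The height seen from a position left of all entries.\<close>

definition level :: "floor list \<Rightarrow> int" where
  "level S = (case S of [] \<Rightarrow> y N | e # _ \<Rightarrow> fst (snd e))"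

lemma look_level: "linked S \<Longrightarrow> \<forall>e\<in>set S. i < fst e \<Longrightarrow> look S i = level S"
  by (cases S) (auto simp: level_def)

text \<open>The links form a staircase: a popped entry hands over to its next higher floor, which is
  still in the window and below \<open>z\<close>, so induction applies there. A surviving front is
  as high as every column before \<open>B\<close>, since a higher one would put its link before
  \<open>B\<close> and below \<open>z\<close>.\<close>

lemma level_dominates:
  assumes "linked S" "i < B" "\<And>i'. i' \<le> i \<Longrightarrow> look S i' < z" "z \<le> y N"
  shows "look S i \<le> level (dropWhile (blocked B z) S) \<and> level (dropWhile (blocked B z) S) < z"
  using assms(1-3)
proof (induction S arbitrary: i)
  case Nil then show ?case using assms(4) by fastforce
next
  case (Cons e T)
  obtain b v nx ny where e: "e = (b, v, nx, ny)" by (cases e)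
  have lT: "linked T" "\<forall>e'\<in>set T. b < fst e'" and ng: "b \<le> nx" "v < ny" "look T nx = ny" "\<And>i. b \<le> i \<Longrightarrow> i < nx \<Longrightarrow> look T i \<le> v"
    using Cons.prems(1) by (auto simp: e)
  have vz: "v < z" using Cons.prems(3)[of i] Cons.prems(3)[of "b - 1"] by (cases "i < b") (auto simp: e)
  have lTb: "look T i' = look T b" if "i' < b" for i'
    using look_level[OF lT(1), of b] look_level[OF lT(1), of i'] lT(2) that by fastforce
  show ?case
  proof (cases "blocked B z e")
    case True
    then have nn: "nx < B" "ny < z" by (auto simp: blocked_def e)
    have dT: "look T i' < z" if "i' \<le> nx" for i'
    proof -
      have "look T i'' < z" if "b \<le> i''" "i'' \<le> nx" for i'' using ng nn vz that by (cases "i'' = nx") force+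
      then show ?thesis using lTb[of i'] that ng by (cases "i' < b") auto
    qed
    have IH: "ny \<le> level (dropWhile (blocked B z) T) \<and> level (dropWhile (blocked B z) T) < z"
      using Cons.IH[OF lT(1) nn(1) dT] ng by simp
    show ?thesis
    proof (cases "i < b")
      case True then show ?thesis using IH ng \<open>blocked B z e\<close> by (simp add: e)
    next
      case False
      have "look T i' < z" if "i' \<le> i" for i'
        using Cons.prems(3)[of i'] Cons.prems(3)[of b] lTb[of i'] that False by (cases "i' < b") (auto simp: e)
      then show ?thesis using Cons.IH[OF lT(1), of i] Cons.prems False True by (simp add: e)
    qed
  next
    case False
    have "look (e # T) i \<le> v"
    proof (rule ccontr)
      assume c: "\<not> look (e # T) i \<le> v"
      then have "b \<le> i" "v < look T i" by (auto simp: e split: if_splits)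
      then have "nx \<le> i" using ng(4)[of i] by force
      then have "ny < z" using Cons.prems(3)[of nx] ng by (auto simp: e)
      then show False using False \<open>nx \<le> i\<close> Cons.prems by (auto simp: blocked_def e)
    qed
    then show ?thesis using False vz by (simp add: level_def e)
  qed
qed

text \<open>Links lead strictly upwards, so popping never lowers a stored height.\<close>

lemma popped_below_level:
  assumes "linked S" "level S < z" "z \<le> y N" "e \<in> set (takeWhile (blocked B z) S)"
  shows "fst (snd e) < level (dropWhile (blocked B z) S)"
  using assms
proof (induction S)
  case (Cons f T)
  obtain b v nx ny where f: "f = (b, v, nx, ny)" by (cases f)
  have lT: "linked T" "\<forall>e'\<in>set T. b < fst e'" and ng: "b \<le> nx" "v < ny" "look T nx = ny" "\<And>i. b \<le> i \<Longrightarrow> i < nx \<Longrightarrow> look T i \<le> v"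
    using Cons.prems(1) by (auto simp: f)
  have bl: "blocked B z f" using Cons.prems(4) by (auto split: if_splits)
  have nn: "nx < B" "ny < z" "v < z" using bl Cons.prems by (auto simp: blocked_def f level_def)
  have lTb: "look T i' = level T" if "i' \<le> b" for i'
    using look_level[OF lT(1), of i'] lT(2) that by fastforce
  have lvl: "level T < z" using lTb[of b] ng nn by (cases "b = nx") force+
  have dT: "look T i' < z" if "i' \<le> nx" for i'
  proof -
    have "look T i'' < z" if "b \<le> i''" "i'' \<le> nx" for i'' using ng nn that by (cases "i'' = nx") force+
    then show ?thesis using lTb[of i'] lvl that ng by (cases "i' < b") auto
  qed
  have "ny \<le> level (dropWhile (blocked B z) T)"
    using level_dominates[OF lT(1) nn(1) dT] Cons.prems ng by simp
  then show ?case using Cons.IH[OF lT(1) lvl] Cons.prems bl ng by (auto simp: f)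
qed simp

text \<open>Popping raises the popped columns to the height of the surviving front, a legal filling
  with left bank \<open>x (Suc k) - 1\<close>. The front then shows the maximum over the window,
  unless its link ends inside the window; in that case some column of the window is as high as the
  top of the edge.\<close>

lemma upward_step:
  assumes k: "k < N" and U: "y k < y (Suc k)"
    and r: "represents (psi (Suc k)) (x (Suc k)) (Suc k) S" and g: "indexes (y k) (x (Suc k)) G S"
    and lo: "look S (x (Suc k)) < y (Suc k)"
    and S': "S' = dropWhile (blocked (x (Suc k) + w) (y (Suc k))) S"
  shows "S' \<noteq> []" "represents (psi (Suc k)) (x (Suc k)) (Suc k) S'" "indexes (y (Suc k)) (x (Suc k)) G S'"
    "hd S' = (b, v, nx, ny) \<Longrightarrow> candidate k m \<longleftrightarrow> m = v \<and> x (Suc k) + w \<le> nx \<and> y k < v + h"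
proof -
  let ?X = "x (Suc k)" and ?z = "y (Suc k)" and ?f = "psi (Suc k)"
  define A where "A = takeWhile (blocked (?X + w) ?z) S"
  have SA: "S = A @ S'" by (simp add: A_def S')
  have zN: "?z \<le> y N" using y_le[of "Suc k"] k by simp
  have lS: "linked S" "\<forall>e\<in>set S. ?X < fst e" using r by (auto simp: represents_def)
  have lS': "linked S'" using lS SA linked_append by metis
  have lvS: "look S i = level S" if "i \<le> ?X" for i using look_level[OF lS(1), of i] lS(2) that by fastforce
  have lv: "level S' < ?z"
    using level_dominates[of S ?X "?X + w" ?z] lS lo lvS zN size by (simp add: S')
  then show ne: "S' \<noteq> []" using zN by (auto simp: level_def)
  have pop: "fst (snd e) < level S'" if "e \<in> set A" for e
    using popped_below_level[of S ?z e "?X + w"] lS lo lvS[of ?X] zN that by (simp add: A_def S')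
  have rp: "?f i \<le> look S i" "?f i < look S i \<Longrightarrow>
        (\<exists>u v. u < i \<and> i < v \<and> v \<le> u + w \<and> look S i \<le> ?f v \<and>
           (\<forall>l i'. Suc k \<le> l \<and> l < N \<and> u \<le> i' \<and> hcov x l i' \<longrightarrow> look S i < y l) \<and> (u < ?X \<or> look S i \<le> ?f u))"
    if "?X \<le> i" for i using r that unfolding represents_def by blast+
  have XS': "\<forall>e\<in>set S'. ?X < fst e" using lS SA by auto
  have same: "look S' i = look S i" if "\<not> (\<exists>e\<in>set A. i < fst e)" for i
    using that by (simp add: SA look_append)
  \<comment> \<open>\<open>b0\<close>, the right end of the last popped entry, is the first column
    that had the new height already before.\<close>
  have popd: "look S i < level S' \<and> look S' i = level S' \<and> (\<exists>b0. i < b0 \<and> b0 < ?X + w \<and> look S b0 = level S' \<and> (\<forall>i'<b0. look S i' < level S'))"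
    if ex: "\<exists>e\<in>set A. i < fst e" for i
  proof -
    define b0 where "b0 = fst (last A)"
    have A: "A \<noteq> []" using ex by auto
    have srt: "sorted_wrt (\<lambda>e e'. fst e < fst e') (A @ S')" using linked_sorted[OF lS(1)] SA by simp
    then have s1: "\<forall>e\<in>set S'. b0 < fst e" using A by (auto simp: sorted_wrt_append b0_def)
    have s2: "fst e \<le> b0" if "e \<in> set A" for e
    proof -
      have "sorted_wrt (\<lambda>e e'. fst e < fst e') (butlast A @ [last A])" using srt A by (simp add: sorted_wrt_append)
      moreover have "e \<in> set (butlast A) \<or> e = last A" using that A by (metis Un_iff append_butlast_last_id empty_iff insert_iff list.set(1,2) set_append)
      ultimately show ?thesis by (auto simp: sorted_wrt_append b0_def)
    qed
    have i: "i < b0" using ex s2 by fastforce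
    have lev: "look S' i' = level S'" if "i' \<le> b0" for i'
      using look_level[OF lS', of i'] s1 that by fastforce
    have lowA: "look S i' < level S'" if "i' < b0" for i'
    proof -
      have "\<exists>e\<in>set A. i' < fst e" using that A by (auto simp: b0_def intro!: bexI[of _ "last A"])
      then show ?thesis using look_in[of A i'] pop by (auto simp: SA look_append)
    qed
    have "last A \<in> set A" using A by simp
    then have "blocked (?X + w) ?z (last A)" by (auto simp: A_def dest: set_takeWhileD)
    moreover have "b0 \<le> fst (snd (snd (last A)))"
    proof -
      have "linked (butlast A @ [last A] @ S')" using lS(1) SA A by (metis append.assoc append_butlast_last_id)
      then have "linked ([last A] @ S')" by (rule linked_append)
      then show ?thesis by (auto simp: b0_def split: prod.splits)
    qed
    ultimately have "b0 < ?X + w" by (auto simp: blocked_def)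
    moreover have "look S b0 = level S'" using same[of b0] lev[of b0] s2 by fastforce
    ultimately show ?thesis using i lowA[OF i] lev[of i] lowA by auto
  qed
  show rS': "represents ?f ?X (Suc k) S'"
    unfolding represents_def
  proof (intro conjI allI impI)
    show "linked S'" by fact
    show "\<forall>e\<in>set S'. ?X < fst e" by fact
    fix i assume i: "?X \<le> i"
    show "?f i \<le> look S' i" using rp(1)[OF i] popd[of i] same[of i] by (cases "\<exists>e\<in>set A. i < fst e") auto
    assume lt: "?f i < look S' i"
    show "\<exists>u v. u < i \<and> i < v \<and> v \<le> u + w \<and> look S' i \<le> ?f v \<and>
           (\<forall>l i'. Suc k \<le> l \<and> l < N \<and> u \<le> i' \<and> hcov x l i' \<longrightarrow> look S' i < y l) \<and> (u < ?X \<or> look S' i \<le> ?f u)"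
    proof (cases "\<exists>e\<in>set A. i < fst e")
      case False
      then show ?thesis using rp(2)[OF i] lt same[OF False] by simp
    next
      case True
      obtain b0 where b0: "i < b0" "b0 < ?X + w" "look S b0 = level S'" "\<forall>i'<b0. look S i' < level S'"
        using popd[OF True] by auto
      have lk: "look S' i = level S'" using popd[OF True] by auto
      \<comment> \<open>The right bank must have this height truly. If column \<open>b0\<close> is
        itself filled, its own right bank serves; its left bank is left of \<open>?X\<close>, as
        otherwise a column before \<open>b0\<close> would be equally high.\<close>
      have "\<exists>v. i < v \<and> v \<le> ?X - 1 + w \<and> level S' \<le> ?f v"
      proof (cases "?f b0 < look S b0")
        case False then show ?thesis using b0 by (intro exI[of _ b0]) auto
      next
        case lt: True
        obtain u v where uv: "u < b0" "b0 < v" "v \<le> u + w" "look S b0 \<le> ?f v" "u < ?X \<or> look S b0 \<le> ?f u"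
          using rp(2)[of b0] lt b0 i by auto
        have "u < ?X"
        proof (rule ccontr)
          assume c: "\<not> u < ?X"
          then have "look S b0 \<le> look S u" using uv rp(1)[of u] by auto
          then show False using b0 uv by force
        qed
        then show ?thesis using uv b0 by (intro exI[of _ v]) auto
      qed
      then obtain v where v: "i < v" "v \<le> ?X - 1 + w" "level S' \<le> ?f v" by auto
      \<comment> \<open>The wall keeps all later pieces from column \<open>?X - 1\<close> on above
        the filling.\<close>
      have "look S' i < y l" if "Suc k \<le> l" "l < N" "?X - 1 \<le> i'" "hcov x l i'" for l i'
        using later_crossings_above[OF U, of l i'] that lv lk by auto
      then show ?thesis using v lk i by (intro exI[of _ "?X - 1"] exI[of _ v]) auto
    qed
  qed
  have sm: "Y \<ge> ?z \<Longrightarrow> look S i \<le> Y \<Longrightarrow> look S' i \<le> Y" for Y i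
    using popd[of i] same[of i] lv by (cases "\<exists>e\<in>set A. i < fst e") auto
  show "indexes ?z ?X G S'"
    unfolding indexes_def
  proof (intro allI impI)
    fix Y assume Y: "?z \<le> Y \<and> Y < y N"
    obtain gx gy r' where gg: "dropWhile (\<lambda>e. snd e \<le> Y) G = (gx, gy) # r'" "?X \<le> gx"
          "\<forall>i. ?X \<le> i \<and> i < gx \<longrightarrow> look S i \<le> Y" "look S gx = gy"
    proof -
      have "y k \<le> Y" using Y U by simp
      then show ?thesis using g Y that unfolding indexes_def by blast
    qed
    have "Y < gy" using gg(1) hd_dropWhile[of "\<lambda>e. snd e \<le> Y" G] by fastforce
    then have "look S' gx = gy" using popd[of gx] same[of gx] gg lv Y by (cases "\<exists>e\<in>set A. gx < fst e") auto
    then show "\<exists>gx gy r. dropWhile (\<lambda>e. snd e \<le> Y) G = (gx, gy) # r \<and> ?X \<le> gx \<and>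
       (\<forall>i. ?X \<le> i \<and> i < gx \<longrightarrow> look S' i \<le> Y) \<and> look S' gx = gy"
      using gg sm Y by auto
  qed
  assume hd: "hd S' = (b, v, nx, ny)"
  then obtain T where T: "S' = (b, v, nx, ny) # T" using ne by (cases S') auto
  have lT: "b \<le> nx" "v < ny" "look T nx = ny" "\<And>i. b \<le> i \<Longrightarrow> i < nx \<Longrightarrow> look T i \<le> v" "?X < b"
    using lS' XS' by (auto simp: T)
  have vz: "v < ?z" using lv by (simp add: T level_def)
  have rp': "?f i \<le> look S' i" "?f i < look S' i \<Longrightarrow>
        (\<exists>u v. u < i \<and> i < v \<and> v \<le> u + w \<and> look S' i \<le> ?f v \<and> (u < ?X \<or> look S' i \<le> ?f u))"
    if "?X \<le> i" for i using rS' that unfolding represents_def by blast+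
  have mx: "candidate k m \<longleftrightarrow> m = v \<and> y k < v + h" if nx: "?X + w \<le> nx"
  proof -
    have le: "?f i \<le> v" if i: "?X \<le> i" "i < ?X + w" for i
    proof -
      have "look S' i \<le> v" using lT(4)[of i] i nx by (auto simp: T)
      then show ?thesis using rp'(1)[OF i(1)] by (rule order_trans[rotated])
    qed
    \<comment> \<open>If the height at \<open>?X\<close> is a filling, its left bank is left of
      \<open>?X\<close>, so its right bank still belongs to the window and is truly as high.\<close>
    have "\<exists>i. ?X \<le> i \<and> i < ?X + w \<and> ?f i = v"
    proof (cases "?f ?X = v")
      case True then show ?thesis using size by auto
    next
      case False
      moreover have lX: "look S' ?X = v" using lT by (simp add: T)
      ultimately have "?f ?X < look S' ?X" using rp'(1)[of ?X] by auto
      then obtain u i where "u < ?X" "?X < i" "i \<le> u + w" "v \<le> ?f i" using rp'(2)[of ?X] lX by auto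
      then show ?thesis using le[of i] by (intro exI[of _ i]) auto
    qed
    then obtain i0 where i0: "?X \<le> i0" "i0 < ?X + w" "?f i0 = v" by auto
    show ?thesis
    proof
      assume c: "candidate k m"
      then obtain i1 where i1: "?X \<le> i1" "i1 < ?X + w" "?f i1 = m" by (auto simp: candidate_def)
      moreover have "?f i0 \<le> m" using c i0 unfolding candidate_def psi.simps by auto
      ultimately have "m = v" using le[of i1] i0 by auto
      then show "m = v \<and> y k < v + h" using c by (auto simp: candidate_def)
    next
      assume "m = v \<and> y k < v + h"
      then show "candidate k m" using k U vz le i0 by (auto simp: candidate_def)
    qed
  qed
  moreover have "\<not> candidate k m" if nx: "\<not> ?X + w \<le> nx"
  proof
    assume c: "candidate k m"
    have bd: "?f i < ?z" if "?X \<le> i" "i < ?X + w" for i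
    proof -
      have "?f i \<le> m" using c that unfolding candidate_def psi.simps by auto
      then show ?thesis using c by (auto simp: candidate_def)
    qed
    \<comment> \<open>The front survived although its link ends in the window, so the linked floor
      reaches the top \<open>?z\<close>. Filled or not, this puts a true height of at least
      \<open>?z\<close> into the window.\<close>
    have "\<not> blocked (?X + w) ?z (hd S')" unfolding S' by (rule hd_dropWhile) (use ne S' in simp)
    then have ny: "?z \<le> ny" using nx by (auto simp: hd blocked_def)
    have lk: "look S' nx = ny" using lT by (simp add: T)
    show False
    proof (cases "?f nx < look S' nx")
      case False then show False using bd[of nx] lk ny nx lT by auto
    next
      case True
      then obtain u i where "u < nx" "nx < i" "i \<le> u + w" "ny \<le> ?f i" "u < ?X \<or> ny \<le> ?f u"
        using rp'(2)[of nx] lk lT by auto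
      then show False using bd[of i] bd[of u] ny nx lT by (cases "u < ?X") auto
    qed
  qed
  ultimately show "candidate k m \<longleftrightarrow> m = v \<and> ?X + w \<le> nx \<and> y k < v + h" by blast
qed


text \<open>\<open>(x 0, y N)\<close> stands for the wall on the right, where \<open>look\<close>
  has its default. \<open>(x 0, 0)\<close> is a sentinel that is never popped, because no flush goes
  beyond \<open>x 0\<close>. So the loops on \<open>G\<close> and \<open>P\<close> cannot run off
  the bottom.\<close>

primrec run :: "nat \<Rightarrow> lists" where
  "run 0 = ([(x 0, y N)], [], [(x 0, 0)], [])"
| "run (Suc k) = vstep w h (x (Suc k)) (y k) (y (Suc k)) (hstep w h c1 c2 (x k) (y k) (x (Suc k)) (run k))"

section \<open>Locations that wait for their ceiling\<close>

definition covered :: "nat \<Rightarrow> nat \<Rightarrow> bool" where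
  "covered q k \<longleftrightarrow> (\<exists>l. q < l \<and> l < k \<and> x l \<le> x (Suc q) \<and> x (Suc q) < x (Suc l))"

text \<open>Upward edges before \<open>m\<close> have delivered their candidates, ceilings before
  \<open>k\<close> have been seen; the two counts differ between the horizontal and the vertical
  half of a step.\<close>

definition waiting :: "nat \<Rightarrow> nat \<Rightarrow> (int \<times> int) set" where
  "waiting m k = {(x (Suc q), b) | q b. q < m \<and> candidate q b \<and> \<not> covered q k}"

definition resolved :: "nat \<Rightarrow> nat \<Rightarrow> (int \<times> int) set" where
  "resolved m k = {(x (Suc q), b) | q b. q < m \<and> candidate q b \<and> covered q k \<and> clear q b \<and>
     \<not> (c1 < x (Suc q) + w \<and> c2 < b + h)}"

definition pending :: "nat \<Rightarrow> nat \<Rightarrow> (int \<times> int) list \<Rightarrow> (int \<times> int) list \<Rightarrow> bool" where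
  "pending m k P R \<longleftrightarrow> (\<exists>P'. P = P' @ [(x 0, 0)] \<and> set P' = waiting m k \<and> sorted_wrt (\<lambda>a b. fst a \<le> fst b) P') \<and>
     set R = resolved m k"

definition inv_h :: "nat \<Rightarrow> lists \<Rightarrow> bool" where
  "inv_h k = (\<lambda>(G, S, P, R). represents (psi k) (x k) k S \<and> indexes (y k) (x k) G S \<and> pending k k P R)"

text \<open>\<open>Y = y (Suc k)\<close> is listed separately because after a leftward edge the
  vertical one may descend below \<open>y k\<close>.\<close>

definition inv_v :: "nat \<Rightarrow> lists \<Rightarrow> bool" where
  "inv_v k = (\<lambda>(G, S, P, R). represents (psi (Suc k)) (x (Suc k)) (Suc k) S \<and>
     (\<forall>Y. y k \<le> Y \<or> Y = y (Suc k) \<longrightarrow> indexes Y (x (Suc k)) G S) \<and>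
     (y k < y (Suc k) \<longrightarrow> look S (x (Suc k)) < y (Suc k)) \<and> pending k (Suc k) P R)"

text \<open>To get past the left side of a location the chain must cross its first column
  rightwards, and that covers it.\<close>

lemma waiting_right:
  assumes "(a, b) \<in> waiting m k" "m \<le> k" shows "x k \<le> a" "a < x 0"
proof -
  obtain q where q: "a = x (Suc q)" "q < m" "candidate q b" "\<not> covered q k" using assms by (auto simp: waiting_def)
  show "x k \<le> a"
  proof (rule ccontr)
    assume "\<not> x k \<le> a"
    then obtain r where "Suc q \<le> r" "r < k" "x r \<le> a" "a < x (Suc r)"
      using crossing_rightward[of "Suc q" k a] q assms by auto
    then show False using q by (auto simp: covered_def)
  qed
  show "a < x 0" using candidate_width[OF q(3)] size q by simp
qed

lemma sorted_takeWhile: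
  assumes "sorted_wrt (\<lambda>a b. fst a \<le> fst b) P"
  shows "set (takeWhile (\<lambda>e. fst e < (X::int)) P) = {e \<in> set P. fst e < X} \<and>
    set (dropWhile (\<lambda>e. fst e < X) P) = {e \<in> set P. X \<le> fst e}"
  using assms
proof (induction P)
  case (Cons e P)
  show ?case
  proof (cases "fst e < X")
    case True then show ?thesis using Cons by auto
  next
    case False
    then have "\<forall>e'\<in>set P. X \<le> fst e'" using Cons.prems by fastforce
    then show ?thesis using False by auto
  qed
qed simp

lemma inv_h_0: "inv_h 0 (run 0)"
  by (simp add: inv_h_def represents_def indexes_def pending_def waiting_def resolved_def)

lemma covered_Suc: "covered q (Suc k) \<longleftrightarrow> covered q k \<or> q < k \<and> x k \<le> x (Suc q) \<and> x (Suc q) < x (Suc k)"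
  unfolding covered_def by (auto simp: less_Suc_eq)

lemma inv_hstep:
  assumes k: "k < N" and i: "inv_h k (G, S, P, R)"
  shows "inv_v k (hstep w h c1 c2 (x k) (y k) (x (Suc k)) (G, S, P, R))"
    "x (Suc k) < x k \<Longrightarrow> dropWhile (\<lambda>e. snd e \<le> y k) G \<noteq> []"
    "\<not> x (Suc k) < x k \<Longrightarrow> dropWhile (\<lambda>e. fst e \<le> x (Suc k)) S \<noteq> []"
    "dropWhile (\<lambda>e. fst e < x (Suc k)) P \<noteq> []"
proof -
  have r: "represents (psi k) (x k) k S" and g: "indexes (y k) (x k) G S" and p: "pending k k P R"
    using i by (auto simp: inv_h_def)
  obtain P' where P': "P = P' @ [(x 0, 0)]" "set P' = waiting k k" "sorted_wrt (\<lambda>a b. fst a \<le> fst b) P'" and R: "set R = resolved k k"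
    using p by (auto simp: pending_def)
  have x0: "x (Suc k) < x 0" using x_less[of "Suc k"] k by simp
  have dP: "dropWhile (\<lambda>e. fst e < x (Suc k)) P = dropWhile (\<lambda>e. fst e < x (Suc k)) P' @ [(x 0, 0)]"
    using x0 unfolding P'(1) by (induction P') auto
  have tP: "takeWhile (\<lambda>e. fst e < x (Suc k)) P = takeWhile (\<lambda>e. fst e < x (Suc k)) P'"
    using x0 unfolding P'(1) by (induction P') auto
  then show "dropWhile (\<lambda>e. fst e < x (Suc k)) P \<noteq> []" using dP by simp
  show "dropWhile (\<lambda>e. snd e \<le> y k) G \<noteq> []" if "x (Suc k) < x k"
    using leftward_step(1)[OF k that r g refl] .
  have xs: "x k < x (Suc k)" if "\<not> x (Suc k) < x k" using x_step[OF k] that by auto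
  show "dropWhile (\<lambda>e. fst e \<le> x (Suc k)) S \<noteq> []" if "\<not> x (Suc k) < x k"
  proof
    assume e: "dropWhile (\<lambda>e. fst e \<le> x (Suc k)) S = []"
    show False using rightward_step(3)[OF k xs[OF that] r g refl] y_le[of "Suc k"] k unfolding e by simp
  qed
  show "inv_v k (hstep w h c1 c2 (x k) (y k) (x (Suc k)) (G, S, P, R))"
  proof (cases "x (Suc k) < x k")
    case True
    have "waiting k (Suc k) = waiting k k" "resolved k (Suc k) = resolved k k"
      using True by (auto simp: waiting_def resolved_def covered_Suc)
    then have "pending k (Suc k) P R" using p by (simp add: pending_def)
    then show ?thesis
      using leftward_step(2,3)[OF k True r g refl] True
      by (auto simp: hstep_def leftward_def inv_v_def Let_def)
  next
    case False
    note st = rightward_step[OF k xs[OF False] r g refl]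
    let ?ok = "\<lambda>e. snd e + h \<le> y k \<and> \<not> (c1 < fst e + w \<and> c2 < snd e + h)"
    \<comment> \<open>By the order within a column the first ceiling over the left side is the
      lowest, so one comparison decides.\<close>
    have cl: "clear q b \<longleftrightarrow> b + h \<le> y k" if "q < k" "\<not> covered q k" "x k \<le> x (Suc q)" "x (Suc q) < x (Suc k)" for q b
    proof
      assume "clear q b" then show "b + h \<le> y k" using that k unfolding clear_def by blast
    next
      assume b: "b + h \<le> y k"
      show "clear q b" unfolding clear_def
      proof (intro allI impI)
        fix l assume l: "q < l \<and> l < N \<and> x l \<le> x (Suc q) \<and> x (Suc q) < x (Suc l)"
        then have "k \<le> l" using that(2) unfolding covered_def by (meson not_le)
        then show "b + h \<le> y l"
          using column_crossings_ascend[of k l "x (Suc q)"] hcov_R[of k "x (Suc q)"] hcov_R[of l "x (Suc q)"] that l b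
          by (cases "k = l") auto
      qed
    qed
    have w1: "waiting k (Suc k) = {e \<in> waiting k k. x (Suc k) \<le> fst e}"
    proof -
      have "x k \<le> x (Suc q)" if "q < k" "candidate q b" "\<not> covered q k" for q b
        using waiting_right(1)[of "x (Suc q)" b k k] that by (auto simp: waiting_def)
      then show ?thesis by (fastforce simp: waiting_def covered_Suc)
    qed
    have w2: "resolved k (Suc k) = {e \<in> waiting k k. fst e < x (Suc k) \<and> ?ok e} \<union> resolved k k"
    proof -
      have *: "x k \<le> x (Suc q)" if "q < k" "candidate q b" "\<not> covered q k" for q b
        using waiting_right(1)[of "x (Suc q)" b k k] that by (auto simp: waiting_def)
      show ?thesis
      proof (intro set_eqI iffI)
        fix e assume "e \<in> resolved k (Suc k)"
        then obtain q b where e: "e = (x (Suc q), b)" "q < k" "candidate q b" "covered q (Suc k)" "clear q b" "\<not> (c1 < x (Suc q) + w \<and> c2 < b + h)"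
          by (auto simp: resolved_def)
        show "e \<in> {e \<in> waiting k k. fst e < x (Suc k) \<and> ?ok e} \<union> resolved k k"
        proof (cases "covered q k")
          case True then show ?thesis using e by (auto simp: resolved_def)
        next
          case False
          then have "x k \<le> x (Suc q)" "x (Suc q) < x (Suc k)" using e by (auto simp: covered_Suc)
          moreover have "e \<in> waiting k k" using e False by (auto simp: waiting_def)
          ultimately show ?thesis using e cl[of q b] False by auto
        qed
      next
        fix e assume "e \<in> {e \<in> waiting k k. fst e < x (Suc k) \<and> ?ok e} \<union> resolved k k"
        then consider "e \<in> waiting k k" "fst e < x (Suc k)" "?ok e" | "e \<in> resolved k k" by blast
        then show "e \<in> resolved k (Suc k)"
        proof cases
          case 1
          then obtain q b where e: "e = (x (Suc q), b)" "q < k" "candidate q b" "\<not> covered q k" by (auto simp: waiting_def)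
          then show ?thesis using 1 cl[of q b] *[of q b] by (auto simp: resolved_def covered_Suc)
        next
          case 2 then show ?thesis by (auto simp: resolved_def covered_Suc)
        qed
      qed
    qed
    let ?R' = "rev (filter ?ok (takeWhile (\<lambda>e. fst e < x (Suc k)) P')) @ R"
    have "pending k (Suc k) (dropWhile (\<lambda>e. fst e < x (Suc k)) P' @ [(x 0, 0)]) ?R'"
    proof -
      have "sorted_wrt (\<lambda>a b. fst a \<le> fst b) (dropWhile (\<lambda>e. fst e < x (Suc k)) P')"
        using P'(3) by (metis sorted_wrt_append takeWhile_dropWhile_id)
      moreover have "set ?R' = resolved k (Suc k)"
        using sorted_takeWhile[OF P'(3), of "x (Suc k)"] P'(2) R w2 by auto
      ultimately show ?thesis
        using sorted_takeWhile[OF P'(3), of "x (Suc k)"] P'(2) w1 unfolding pending_def by auto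
    qed
    moreover have "indexes Y (x (Suc k)) G (dropWhile (\<lambda>e. fst e \<le> x (Suc k)) S)" if "y k \<le> Y \<or> Y = y (Suc k)" for Y
      using indexes_mono[OF st(2)] that right_up[OF k xs[OF False]] by auto
    ultimately show ?thesis
      using st False by (auto simp: hstep_def rightward_def flush_def inv_v_def dP tP)
  qed
qed

lemma inv_vstep:
  assumes k: "k < N" and i: "inv_v k (G, S, P, R)"
  shows "inv_h (Suc k) (vstep w h (x (Suc k)) (y k) (y (Suc k)) (G, S, P, R))"
    "y k < y (Suc k) \<Longrightarrow> dropWhile (blocked (x (Suc k) + w) (y (Suc k))) S \<noteq> []"
proof -
  have r: "represents (psi (Suc k)) (x (Suc k)) (Suc k) S" and p: "pending k (Suc k) P R"
    and g: "\<And>Y. y k \<le> Y \<or> Y = y (Suc k) \<Longrightarrow> indexes Y (x (Suc k)) G S"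
    and lo: "y k < y (Suc k) \<Longrightarrow> look S (x (Suc k)) < y (Suc k)"
    using i by (auto simp: inv_v_def)
  have nc: "\<not> covered k (Suc k)" by (auto simp: covered_def)
  have res: "resolved (Suc k) (Suc k) = resolved k (Suc k)"
    using nc by (auto simp: resolved_def less_Suc_eq)
  have wt: "waiting (Suc k) (Suc k) = waiting k (Suc k) \<union> {(x (Suc k), b) | b. candidate k b}"
    using nc by (auto simp: waiting_def less_Suc_eq)
  show "dropWhile (blocked (x (Suc k) + w) (y (Suc k))) S \<noteq> []" if "y k < y (Suc k)"
    using upward_step(1)[OF k that r g lo[OF that] refl] by simp
  show "inv_h (Suc k) (vstep w h (x (Suc k)) (y k) (y (Suc k)) (G, S, P, R))"
  proof (cases "y k < y (Suc k)")
    case False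
    then have "waiting (Suc k) (Suc k) = waiting k (Suc k)" unfolding wt by (auto simp: candidate_def)
    then show ?thesis using False r g p res by (auto simp: vstep_def inv_h_def pending_def)
  next
    case True
    obtain b v nx ny where hd: "hd (dropWhile (blocked (x (Suc k) + w) (y (Suc k))) S) = (b, v, nx, ny)"
      by (metis prod_cases4)
    have gk: "indexes (y k) (x (Suc k)) G S" using g by simp
    note st = upward_step[OF k True r gk lo[OF True] refl]
    obtain P' where P': "P = P' @ [(x 0, 0)]" "set P' = waiting k (Suc k)" "sorted_wrt (\<lambda>a b. fst a \<le> fst b) P'" and R: "set R = resolved k (Suc k)"
      using p by (auto simp: pending_def)
    let ?Q = "if x (Suc k) + w \<le> nx \<and> y k < v + h then (x (Suc k), v) # P' else P'"
    have le: "x (Suc k) \<le> fst e" if "e \<in> set P'" for e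
      using waiting_right(1)[of "fst e" "snd e" k "Suc k"] that P' by auto
    have "set ?Q = waiting (Suc k) (Suc k)" unfolding wt using P'(2) st(4)[OF hd] by auto
    moreover have "sorted_wrt (\<lambda>a b. fst a \<le> fst b) ?Q" using P'(3) le by auto
    moreover have "(if x (Suc k) + w \<le> nx \<and> y k < v + h then (x (Suc k), v) # P else P) = ?Q @ [(x 0, 0)]"
      using P'(1) by simp
    ultimately have "pending (Suc k) (Suc k) (if x (Suc k) + w \<le> nx \<and> y k < v + h then (x (Suc k), v) # P else P) R"
      using R res unfolding pending_def by blast
    then show ?thesis using True st hd by (simp add: vstep_def upward_def inv_h_def Let_def)
  qed
qed

lemma inv_run: "k \<le> N \<Longrightarrow> inv_h k (run k)"
proof (induction k)
  case (Suc k)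
  obtain G S P R where rk: "run k = (G, S, P, R)" by (metis prod_cases4)
  obtain G' S' P' R' where h: "hstep w h c1 c2 (x k) (y k) (x (Suc k)) (run k) = (G', S', P', R')" by (metis prod_cases4)
  have "inv_v k (G', S', P', R')" using inv_hstep(1)[of k G S P R] Suc rk h by simp
  then show ?case using inv_vstep(1)[of k G' S' P' R'] Suc.prems h by simp
qed (use inv_h_0 in simp)

theorem run_correct:
  "set (snd (snd (snd (flush w h c1 c2 (x 0) (y N) (run N))))) = {(a, b). stable a b}"
  "dropWhile (\<lambda>e. fst e < x 0) (fst (snd (snd (run N)))) \<noteq> []"
proof -
  obtain G S P R where rk: "run N = (G, S, P, R)" by (metis prod_cases4)
  have "pending N N P R" using inv_run[of N] rk by (simp add: inv_h_def)
  then obtain P' where P': "P = P' @ [(x 0, 0)]" "set P' = waiting N N" and R: "set R = resolved N N"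
    by (auto simp: pending_def)
  have lt: "fst e < x 0" if "e \<in> set P'" for e using waiting_right(2)[of "fst e" "snd e" N N] that P' by simp
  have t: "takeWhile (\<lambda>e. fst e < x 0) P = P'" using lt unfolding P'(1) by (simp add: takeWhile_append2)
  show "dropWhile (\<lambda>e. fst e < x 0) (fst (snd (snd (run N)))) \<noteq> []" using P' rk by simp
  have "set (snd (snd (snd (flush w h c1 c2 (x 0) (y N) (run N))))) =
     {e \<in> waiting N N. snd e + h \<le> y N \<and> \<not> (c1 < fst e + w \<and> c2 < snd e + h)} \<union> resolved N N"
    using t P' R rk by (auto simp: flush_def)
  also have "\<dots> = {(a, b). stable a b}"
  proof -
    \<comment> \<open>Locations still waiting have only the top edge above their left side; for
      resolved ones the test against \<open>y N\<close> is implied, as ceilings on the chain are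
      lower.\<close>
    have a: "clear q b" if "\<not> covered q N" for q b using that by (auto simp: clear_def covered_def)
    have b: "b + h \<le> y N" if "covered q N" "clear q b" for q b
      using that y_less unfolding clear_def covered_def by (meson less_imp_le order_trans)
    show ?thesis
    proof (intro set_eqI iffI)
      fix e assume "e \<in> {e \<in> waiting N N. snd e + h \<le> y N \<and> \<not> (c1 < fst e + w \<and> c2 < snd e + h)} \<union> resolved N N"
      then obtain q m where "e = (x (Suc q), m)" "candidate q m" "clear q m" "m + h \<le> y N" "\<not> (c1 < x (Suc q) + w \<and> c2 < m + h)"
        using a b by (auto simp: waiting_def resolved_def)
      then show "e \<in> {(a, b). stable a b}" using stableI by simp
    next
      fix e assume "e \<in> {(a, b). stable a b}"
      then obtain q m where e: "e = (x (Suc q), m)" "candidate q m" "clear q m" "m + h \<le> y N" "\<not> (c1 < x (Suc q) + w \<and> c2 < m + h)"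
        using stableD by fastforce
      then have "q < N" by (simp add: candidate_def)
      then show "e \<in> {e \<in> waiting N N. snd e + h \<le> y N \<and> \<not> (c1 < fst e + w \<and> c2 < snd e + h)} \<union> resolved N N"
        using e by (cases "covered q N") (auto simp: waiting_def resolved_def)
    qed
  qed
  finally show "set (snd (snd (snd (flush w h c1 c2 (x 0) (y N) (run N))))) = {(a, b). stable a b}" .
qed

end

section \<open>The sweep on the random access machine\<close>

text \<open>Termination in weakest precondition form, with the step count handed to the
  postcondition; straight-line code is then executed by the simplifier.\<close>

definition ter :: "com \<Rightarrow> state \<Rightarrow> (nat \<Rightarrow> state \<Rightarrow> bool) \<Rightarrow> bool" where
  "ter c s Q \<longleftrightarrow> (\<exists>t s'. exec c s t s' \<and> Q t s')"

inductive_cases exec_SkipE: "exec Skip s t s'"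
inductive_cases exec_AssignE: "exec (Assign r a) s t s'"
inductive_cases exec_StoreE: "exec (Store a b) s t s'"
inductive_cases exec_SeqE: "exec (Seq c d) s t s'"
inductive_cases exec_CondE: "exec (Cond b c d) s t s'"

lemma exec_Cond_iff:
  "exec (Cond b c d) s t s' \<longleftrightarrow> (\<exists>t'. t = 1 + bcost b + t' \<and> exec (if bval b s then c else d) s t' s')"
  by (auto elim!: exec_CondE intro: exec_CondT[simplified] exec_CondF[simplified])

lemma ter_simps [simp]:
  "ter Skip s Q \<longleftrightarrow> Q 1 s"
  "ter (Assign r a) s Q \<longleftrightarrow> Q (1 + acost a) (s\<lparr>reg := (reg s)(r := aval a s)\<rparr>)"
  "ter (Store a a') s Q \<longleftrightarrow> Q (1 + acost a + acost a') (s\<lparr>mem := (mem s)(aval a s := aval a' s)\<rparr>)"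
  "ter (Seq c d) s Q \<longleftrightarrow> ter c s (\<lambda>t s'. ter d s' (\<lambda>t'. Q (t + t')))"
  "ter (Cond b c d) s Q \<longleftrightarrow> ter (if bval b s then c else d) s (\<lambda>t. Q (1 + bcost b + t))"
  unfolding ter_def
  subgoal by (metis exec_SkipE exec_Skip)
  subgoal by (metis exec_AssignE exec_Assign)
  subgoal by (metis exec_StoreE exec_Store)
  subgoal by (blast elim: exec_SeqE intro: exec_Seq)
  subgoal unfolding exec_Cond_iff by blast
  done

lemma ter_WhileF: "\<not> bval b s \<Longrightarrow> Q (1 + bcost b) s \<Longrightarrow> ter (While b c) s Q"
  unfolding ter_def using exec_WhileF by blast

lemma ter_WhileT: "bval b s \<Longrightarrow> ter c s (\<lambda>t s'. ter (While b c) s' (\<lambda>t'. Q (1 + bcost b + t + t'))) \<Longrightarrow> ter (While b c) s Q"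
  unfolding ter_def using exec_WhileT by blast

lemma ter_mono: "ter c s Q \<Longrightarrow> (\<And>t s'. Q t s' \<Longrightarrow> Q' t s') \<Longrightarrow> ter c s Q'"
  unfolding ter_def by blast

text \<open>The head of the list is the top of the stack, at the highest address. Entries of
  \<open>S\<close> have four components and are described by two such stacks at offsets 0 and
  2.\<close>

primrec stk :: "(int \<Rightarrow> int) \<Rightarrow> int \<Rightarrow> (int \<times> int) list \<Rightarrow> bool" where
  "stk m A [] = True"
| "stk m A (e # T) \<longleftrightarrow> m (A + 8 * int (length T)) = fst e \<and> m (A + 8 * int (length T) + 1) = snd e \<and> stk m A T"

text \<open>Downward growth leaves the newest entry at the lowest address, so the pointer to it is
  the base address that \<open>reported\<close> expects. Input cells are positive and the stacks lie
  above them, so the negative addresses are free.\<close>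

primrec outs :: "(int \<Rightarrow> int) \<Rightarrow> (int \<times> int) list \<Rightarrow> bool" where
  "outs m [] = True"
| "outs m (e # R) \<longleftrightarrow> m (- 2 - 2 * int (length R)) = fst e \<and> m (- 1 - 2 * int (length R)) = snd e \<and> outs m R"

lemma stk_cong: "(\<And>n. 0 \<le> n \<Longrightarrow> n < int (length T) \<Longrightarrow> m' (A + 8 * n) = m (A + 8 * n) \<and> m' (A + 8 * n + 1) = m (A + 8 * n + 1)) \<Longrightarrow> stk m A T \<Longrightarrow> stk m' A T"
proof (induction T)
  case (Cons e T)
  have "stk m' A T" using Cons.prems by (intro Cons.IH) auto
  then show ?case using Cons.prems(1)[of "int (length T)"] Cons.prems(2) by simp
qed simp

lemma outs_cong: "(\<And>n. 0 < n \<Longrightarrow> n \<le> 2 * int (length R) \<Longrightarrow> m' (- n) = m (- n)) \<Longrightarrow> outs m R \<Longrightarrow> outs m' R"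
proof (induction R)
  case (Cons e R)
  have "outs m' R" using Cons.prems by (intro Cons.IH) auto
  then show ?case using Cons.prems(1)[of "2 + 2 * int (length R)"] Cons.prems(1)[of "1 + 2 * int (length R)"] Cons.prems(2) by simp
qed simp

lemma stk_upd: "stk m A T \<Longrightarrow> (\<And>n. 0 \<le> n \<Longrightarrow> n < int (length T) \<Longrightarrow> a \<noteq> A + 8 * n \<and> a \<noteq> A + 8 * n + 1) \<Longrightarrow> stk (m(a := v)) A T"
  by (rule stk_cong) auto

lemma outs_upd: "outs m R \<Longrightarrow> a \<ge> 0 \<or> a < - 2 * int (length R) \<Longrightarrow> outs (m(a := v)) R"
  by (rule outs_cong) auto

lemma outs_nth: "outs m R \<Longrightarrow> i < length R \<Longrightarrow> m (- 2 * int (length R) + 2 * int i) = fst (R ! i) \<and> m (- 2 * int (length R) + 2 * int i + 1) = snd (R ! i)"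
proof (induction R arbitrary: i)
  case (Cons e R)
  then show ?case
  proof (cases i)
    case (Suc j)
    have "m (- 2 * int (length R) + 2 * int j) = fst (R ! j) \<and> m (- 2 * int (length R) + 2 * int j + 1) = snd (R ! j)"
      using Cons Suc by auto
    moreover have "- 2 * int (length (e # R)) + 2 * int i = - 2 * int (length R) + 2 * int j" using Suc by simp
    ultimately show ?thesis using Suc by simp
  next
    case 0
    then show ?thesis using Cons.prems by simp
  qed
qed simp

text \<open>Three stacks share the free memory with stride 8; the output grows downwards from address 0.\<close>

definition rel :: "state \<Rightarrow> lists \<Rightarrow> bool" where
  "rel s = (\<lambda>(G, S, P, R). 0 < reg s 9 \<and>
     reg s 12 = reg s 9 + 8 * int (length G) - 4 \<and> stk (mem s) (reg s 9 + 4) G \<and>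
     reg s 13 = reg s 9 + 8 * int (length S) - 8 \<and> stk (mem s) (reg s 9) (map (\<lambda>e. (fst e, fst (snd e))) S) \<and>
     stk (mem s) (reg s 9 + 2) (map (\<lambda>e. snd (snd e)) S) \<and>
     reg s 14 = reg s 9 + 8 * int (length P) - 2 \<and> stk (mem s) (reg s 9 + 6) P \<and>
     reg s 15 = - 2 * int (length R) \<and> reg s 16 = int (length R) \<and> outs (mem s) R)"

text \<open>Exempt are the three stack pointers, the output pointer and counter, and the two
  arguments of the flush; the protected addresses are the input cells.\<close>

definition unchanged :: "state \<Rightarrow> state \<Rightarrow> bool" where
  "unchanged s s' \<longleftrightarrow> (\<forall>r. r \<notin> {12, 13, 14, 15, 16, 26, 27} \<longrightarrow> reg s' r = reg s r) \<and>
     (\<forall>a. 0 < a \<and> a < reg s 9 \<longrightarrow> mem s' a = mem s a)"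

lemma unchanged_trans: "unchanged s s' \<Longrightarrow> unchanged s' s'' \<Longrightarrow> unchanged s s''"
  by (auto simp: unchanged_def)

abbreviation move :: "nat \<Rightarrow> int \<Rightarrow> com" where
  "move r d \<equiv> Assign r (Plus (Reg r) (Const d))"

abbreviation cell :: "nat \<Rightarrow> int \<Rightarrow> aexp" where
  "cell r d \<equiv> Mem (Plus (Reg r) (Const d))"

text \<open>A pop costs \<open>5 + bcost b\<close>: the test, one step for the loop and four for the
  decrement. The loop stops above the bottom of the stack because \<open>dropWhile p T\<close> is
  nonempty, so test and \<open>p\<close> need to agree on nonempty suffixes only.\<close>

lemma ter_pop:
  assumes "\<And>T'. T' \<noteq> [] \<Longrightarrow> \<exists>A. T = A @ T' \<Longrightarrow>
      bval b (s\<lparr>reg := (reg s)(r := a + 8 * int (length T'))\<rparr>) = p (hd T')"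
    and "dropWhile p T \<noteq> []" "reg s r = a + 8 * int (length T)"
    and "Q ((1 + bcost b) + (5 + bcost b) * (length T - length (dropWhile p T)))
           (s\<lparr>reg := (reg s)(r := a + 8 * int (length (dropWhile p T)))\<rparr>)"
  shows "ter (While b (move r (- 8))) s Q"
  using assms
proof (induction T arbitrary: s Q)
  case (Cons e T)
  have s: "s\<lparr>reg := (reg s)(r := a + 8 * int (length (e # T)))\<rparr> = s" using Cons.prems(3) by (cases s) (auto simp: fun_eq_iff)
  have b: "bval b s = p e" using Cons.prems(1)[of "e # T"] unfolding s by simp
  show ?case
  proof (cases "p e")
    case False
    have "dropWhile p (e # T) = e # T" using False by simp
    then have "Q (1 + bcost b) s" using Cons.prems(4) unfolding s by (simp only: s) simp
    then show ?thesis using b False by (intro ter_WhileF) auto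
  next
    case True
    let ?s = "s\<lparr>reg := (reg s)(r := a + 8 * int (length T))\<rparr>"
    have len: "length (dropWhile p T) \<le> length T" by (simp add: length_dropWhile_le)
    have "ter (While b (move r (- 8))) ?s (\<lambda>t'. Q (1 + bcost b + 4 + t'))"
    proof (rule Cons.IH)
      fix T' :: "'a list" assume T': "T' \<noteq> []" "\<exists>A. T = A @ T'"
      then have "\<exists>A. e # T = A @ T'" by (metis append_Cons)
      then have "bval b (s\<lparr>reg := (reg s)(r := a + 8 * int (length T'))\<rparr>) = p (hd T')"
        using Cons.prems(1)[of T'] T' by blast
      moreover have "?s\<lparr>reg := (reg ?s)(r := a + 8 * int (length T'))\<rparr> = s\<lparr>reg := (reg s)(r := a + 8 * int (length T'))\<rparr>" by simp
      ultimately show "bval b (?s\<lparr>reg := (reg ?s)(r := a + 8 * int (length T'))\<rparr>) = p (hd T')"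
        by metis
    next
      show "dropWhile p T \<noteq> []" using Cons.prems(2) True by simp
      have "Suc (length T) - length (dropWhile p T) = Suc (length T - length (dropWhile p T))" using len by simp
      then have c: "(1 + bcost b) + (5 + bcost b) * (length (e # T) - length (dropWhile p T)) =
          1 + bcost b + 4 + (1 + bcost b + (5 + bcost b) * (length T - length (dropWhile p T)))"
        by simp
      have dw: "dropWhile p (e # T) = dropWhile p T" using True by simp
      have st: "?s\<lparr>reg := (reg ?s)(r := z)\<rparr> = s\<lparr>reg := (reg s)(r := z)\<rparr>" for z by simp
      show "Q (1 + bcost b + 4 + (1 + bcost b + (5 + bcost b) * (length T - length (dropWhile p T))))
          (?s\<lparr>reg := (reg ?s)(r := a + 8 * int (length (dropWhile p T)))\<rparr>)"
        using Cons.prems(4) unfolding dw c st .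
    qed simp
    moreover have "reg s r - 8 = a + 8 * int (length T)" using Cons.prems(3) by simp
    ultimately show ?thesis using b True by (intro ter_WhileT) (simp_all add: numeral_eq_Suc)
  qed
qed simp

lemma stk_hd: "stk m A T \<Longrightarrow> T \<noteq> [] \<Longrightarrow> m (A + 8 * int (length T) - 8) = fst (hd T) \<and> m (A + 8 * int (length T) - 7) = snd (hd T)"
  by (cases T) (auto simp: algebra_simps)

lemma stk_suffix: "stk m A (T @ T') \<Longrightarrow> stk m A T'"
  by (induction T) auto

text \<open>The potential of the amortised analysis. The output does not count, since an entry is
  added to it only when one leaves \<open>P\<close>.\<close>

definition lengths :: "lists \<Rightarrow> nat" where
  "lengths = (\<lambda>(G, S, P, R). length G + length S + length P)"

section \<open>Programs for single edges and their amortised cost\<close>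

definition left_com :: com where
  "left_com =
     Seq (While (Neg (Less (Reg 22) (cell 12 1))) (move 12 (- 8)))
    (Seq (move 13 8)
    (Seq (Store (Reg 13) (Reg 21))
    (Seq (Store (Plus (Reg 13) (Const 1)) (Reg 22))
    (Seq (Store (Plus (Reg 13) (Const 2)) (cell 12 0))
    (Seq (Store (Plus (Reg 13) (Const 3)) (cell 12 1))
    (Seq (move 12 8)
    (Seq (Store (Reg 12) (Reg 23))
         (Store (Plus (Reg 12) (Const 1)) (Reg 22)))))))))"

lemma relD:
  assumes "rel s (G, S, P, R)"
  shows "0 < reg s 9" "reg s 12 = reg s 9 + 8 * int (length G) - 4" "stk (mem s) (reg s 9 + 4) G"
    "reg s 13 = reg s 9 + 8 * int (length S) - 8" "stk (mem s) (reg s 9) (map (\<lambda>e. (fst e, fst (snd e))) S)"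
    "stk (mem s) (reg s 9 + 2) (map (\<lambda>e. snd (snd e)) S)"
    "reg s 14 = reg s 9 + 8 * int (length P) - 2" "stk (mem s) (reg s 9 + 6) P"
    "reg s 15 = - 2 * int (length R)" "reg s 16 = int (length R)" "outs (mem s) R"
  using assms by (simp_all add: rel_def)

text \<open>Each entry carries 100 units, more than a pop costs; the 300 pay for the two entries
  pushed and for the remaining constant work.\<close>

lemma leftward_ter:
  assumes r: "rel s (G, S, P, R)" and ne: "dropWhile (\<lambda>e. snd e \<le> reg s 22) G \<noteq> []"
  shows "ter left_com s (\<lambda>t s'. rel s' (leftward (reg s 21) (reg s 22) (reg s 23) (G, S, P, R)) \<and> unchanged s s' \<and>
    t + 100 * lengths (leftward (reg s 21) (reg s 22) (reg s 23) (G, S, P, R)) \<le> 100 * lengths (G, S, P, R) + 300)"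
proof -
  note f = relD[OF r]
  let ?p = "\<lambda>e. snd e \<le> reg s 22"
  define G' where "G' = dropWhile ?p G"
  define A where "A = reg s 9 + 8 * int (length S)"
  define g where "g = reg s 9 + 8 * int (length G') - 4"
  have G': "G' \<noteq> []" "length G' \<le> length G" "\<exists>A. G = A @ G'"
    using ne by (auto simp: G'_def length_dropWhile_le) (metis takeWhile_dropWhile_id)
  have sG: "stk (mem s) (reg s 9 + 4) G'" using f(3) G'(3) stk_suffix by auto
  have hd: "mem s g = fst (hd G')" "mem s (g + 1) = snd (hd G')"
    using stk_hd[OF sG G'(1)] by (auto simp: g_def algebra_simps)
  have a13: "reg s 13 = A - 8" using f by (simp add: A_def)
  define m' where "m' = (mem s)(A := reg s 21, A + 1 := reg s 22, A + 2 := fst (hd G'), A + 3 := snd (hd G'),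
     g + 8 := reg s 23, g + 8 + 1 := reg s 22)"
  \<comment> \<open>The stacks occupy different residues modulo 8 relative to
    \<open>reg s 9\<close>, so \<open>presburger\<close> can tell their cells apart whatever their
    lengths are.\<close>
  have ag: "g \<noteq> A" "g \<noteq> A + 1" "g \<noteq> A + 2" "g + 1 \<noteq> A" "g \<noteq> A + 3" "g \<noteq> A - 1"
    unfolding A_def g_def by presburger+
  have s2: "g \<noteq> 1 + A" "g \<noteq> 2 + A" "g \<noteq> 3 + A" "g + 1 \<noteq> A + 1" "g + 1 \<noteq> A + 2" "g + 1 \<noteq> A + 3" using ag by auto
  show ?thesis
    unfolding left_com_def ter_simps(4)
  proof (rule ter_pop[where T = G and p = ?p and a = "reg s 9 - 4"], goal_cases)
    case (1 T')
    then have "stk (mem s) (reg s 9 + 4) T'" using f(3) stk_suffix by auto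
    from stk_hd[OF this 1(1)] show ?case by (auto simp: algebra_simps)
  next
    case 2 show ?case by fact
  next
    case 3 show ?case using f by simp
  next
    case 4
    define s' where "s' = s\<lparr>reg := (reg s)(12 := g, 13 := A, 12 := g + 8), mem := m'\<rparr>"
    have "unchanged s s'"
      using f(1) unfolding unchanged_def s'_def m'_def A_def g_def by (simp add: G'(1))
    moreover have "rel s' ((reg s 23, reg s 22) # G', (reg s 21, reg s 22, hd G') # S, P, R)"
    proof -
      have 1: "stk m' (reg s 9 + 4) G'" unfolding m'_def A_def g_def
        by (intro stk_upd sG; presburger)
      have 2: "stk m' (reg s 9) (map (\<lambda>e. (fst e, fst (snd e))) S)" unfolding m'_def A_def g_def
        by (intro stk_upd f(5); simp; presburger)
      have 3: "stk m' (reg s 9 + 2) (map (\<lambda>e. snd (snd e)) S)" unfolding m'_def A_def g_def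
        by (intro stk_upd f(6); simp; presburger)
      have 4: "stk m' (reg s 9 + 6) P" unfolding m'_def A_def g_def
        by (intro stk_upd f(8); presburger)
      have 5: "outs m' R" unfolding m'_def A_def g_def
        using f(1) by (intro outs_upd f(11)) auto
      have 6: "m' A = reg s 21" "m' (A + 1) = reg s 22" "m' (A + 2) = fst (hd G')" "m' (A + 3) = snd (hd G')"
        "m' (g + 8) = reg s 23" "m' (g + 8 + 1) = reg s 22"
        unfolding m'_def A_def g_def by (simp_all; presburger)+
      show ?thesis
        using f 1 2 3 4 5 6 unfolding rel_def s'_def by (simp add: A_def g_def algebra_simps)
    qed
    moreover have "leftward (reg s 21) (reg s 22) (reg s 23) (G, S, P, R) = ((reg s 23, reg s 22) # G', (reg s 21, reg s 22, hd G') # S, P, R)"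
      by (simp add: leftward_def G'_def Let_def)
    moreover have "reg s 9 - 4 + 8 * int (length G') = g" by (simp add: g_def)
    ultimately show ?case
      unfolding G'_def[symmetric] using G'(2)
      by (simp add: a13 hd ag s2 s'_def m'_def lengths_def)
  qed
qed

definition fits :: bexp where
  "fits = Conj (Neg (Less (Reg 27) (Plus (cell 14 1) (Reg 1))))
     (Neg (Conj (Less (Reg 17) (Plus (cell 14 0) (Reg 0))) (Less (Reg 18) (Plus (cell 14 1) (Reg 1)))))"

definition flush_body :: com where
  "flush_body =
     Seq (Cond fits
           (Seq (move 15 (- 2)) (Seq (Store (Reg 15) (cell 14 0)) (Seq (Store (Plus (Reg 15) (Const 1)) (cell 14 1)) (move 16 1))))
           Skip)
         (move 14 (- 8))"

definition flush_com :: com where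
  "flush_com = While (Less (cell 14 0) (Reg 26)) flush_body"

lemma flush_Cons:
  "flush w h c1 c2 X z (G, S, e # P, R) = (if fst e < X
     then flush w h c1 c2 X z (G, S, P, if snd e + h \<le> z \<and> \<not> (c1 < fst e + w \<and> c2 < snd e + h) then e # R else R)
     else (G, S, e # P, R))"
  by (auto simp: flush_def)

text \<open>Each round pops one entry. Its at most 75 steps together with the test stay below the
  100 units released, whether or not the location is reported.\<close>

lemma flush_ter:
  assumes "rel s (G, S, P, R)" "dropWhile (\<lambda>e. fst e < reg s 26) P \<noteq> []"
  shows "ter flush_com s (\<lambda>t s'. rel s' (flush (reg s 0) (reg s 1) (reg s 17) (reg s 18) (reg s 26) (reg s 27) (G, S, P, R)) \<and>
    unchanged s s' \<and> t + 100 * length (dropWhile (\<lambda>e. fst e < reg s 26) P) \<le> 100 * length P + 20)"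
  using assms
proof (induction P arbitrary: s R)
  case (Cons e P)
  note f = relD[OF Cons.prems(1)]
  define p where "p = reg s 9 + 8 * int (length P) + 6"
  have p: "reg s 14 = p" "mem s p = fst e" "mem s (p + 1) = snd e" "0 < p"
    using f by (auto simp: p_def algebra_simps)
  have u0: "unchanged s s" by (simp add: unchanged_def)
  show ?case
  proof (cases "fst e < reg s 26")
    case False
    then show ?thesis using Cons.prems(1) p u0 unfolding flush_com_def
      by (intro ter_WhileF) (auto simp: flush_Cons)
  next
    case True
    define ok where "ok \<longleftrightarrow> snd e + reg s 1 \<le> reg s 27 \<and> \<not> (reg s 17 < fst e + reg s 0 \<and> reg s 18 < snd e + reg s 1)"
    define q where "q = - 2 - 2 * int (length R)"
    define s1 where "s1 = (if ok then s\<lparr>reg := (reg s)(15 := q, 16 := reg s 16 + 1, 14 := p - 8), mem := (mem s)(q := fst e, q + 1 := snd e)\<rparr>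
      else s\<lparr>reg := (reg s)(14 := p - 8)\<rparr>)"
    let ?R = "if ok then e # R else R"
    have b: "bval fits s = ok" "bcost fits = 28" using p by (auto simp: ok_def fits_def)
    have q: "reg s 15 - 2 = q" "q < 0" "q + 1 < 0" "p \<noteq> q" "p + 1 \<noteq> q" "p + 1 \<noteq> q + 1" using f p(4) by (auto simp: q_def)
    have rel1: "rel s1 (G, S, P, ?R)"
    proof (cases ok)
      case False
      then show ?thesis using f unfolding rel_def s1_def p_def by auto
    next
      case True
      let ?m = "(mem s)(q := fst e, q + 1 := snd e)"
      have 1: "stk ?m (reg s 9 + 4) G" using f(1) by (intro stk_upd f(3)) (auto simp: q_def)
      have 2: "stk ?m (reg s 9) (map (\<lambda>e. (fst e, fst (snd e))) S)" using f(1) by (intro stk_upd f(5)) (auto simp: q_def)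
      have 3: "stk ?m (reg s 9 + 2) (map (\<lambda>e. snd (snd e)) S)" using f(1) by (intro stk_upd f(6)) (auto simp: q_def)
      have "stk (mem s) (reg s 9 + 6) P" using f(8) by simp
      then have 4: "stk ?m (reg s 9 + 6) P" using f(1) by (intro stk_upd) (auto simp: q_def)
      have "outs ?m R" by (rule outs_cong[OF _ f(11)]) (auto simp: q_def)
      then have 5: "outs ?m (e # R)" by (simp add: q_def)
      show ?thesis using f 1 2 3 4 5 True unfolding rel_def s1_def p_def by (simp add: q_def)
    qed
    have un1: "unchanged s s1" "reg s1 26 = reg s 26" "reg s1 27 = reg s 27" "reg s1 0 = reg s 0" "reg s1 1 = reg s 1"
        "reg s1 17 = reg s 17" "reg s1 18 = reg s 18"
      using q by (auto simp: unchanged_def s1_def)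
    have IH: "ter flush_com s1 (\<lambda>t s'. rel s' (flush (reg s 0) (reg s 1) (reg s 17) (reg s 18) (reg s 26) (reg s 27) (G, S, P, ?R)) \<and>
       unchanged s s' \<and> t + 100 * length (dropWhile (\<lambda>e. fst e < reg s 26) P) \<le> 100 * length P + 20)"
      by (rule ter_mono[OF Cons.IH[OF rel1]]) (use un1 Cons.prems(2) True unchanged_trans[OF un1(1)] in auto)
    have fl: "flush (reg s 0) (reg s 1) (reg s 17) (reg s 18) (reg s 26) (reg s 27) (G, S, e # P, R) =
         flush (reg s 0) (reg s 1) (reg s 17) (reg s 18) (reg s 26) (reg s 27) (G, S, P, ?R)"
      using True by (simp add: flush_Cons ok_def)
    have body: "ter flush_body s (\<lambda>t s'. t \<le> 75 \<and> s' = s1)"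
      unfolding flush_body_def ter_simps(4,5) b
      using p q by (cases ok) (simp_all add: s1_def)
    show ?thesis unfolding flush_com_def
    proof (rule ter_WhileT, unfold flush_com_def[symmetric])
      show "bval (Less (cell 14 0) (Reg 26)) s" using True p by simp
      show "ter flush_body s (\<lambda>t s'. ter flush_com s' (\<lambda>t' s'. rel s' (flush (reg s 0) (reg s 1) (reg s 17) (reg s 18) (reg s 26) (reg s 27) (G, S, e # P, R)) \<and>
    unchanged s s' \<and> 1 + bcost (Less (cell 14 0) (Reg 26)) + t + t' + 100 * length (dropWhile (\<lambda>e. fst e < reg s 26) (e # P)) \<le> 100 * length (e # P) + 20))"
        unfolding fl by (rule ter_mono[OF body], clarify, rule ter_mono[OF IH]) (auto simp: True)
    qed
  qed
qed simp

definition right_com :: com where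
  "right_com = Seq (While (Neg (Less (Reg 23) (cell 13 0))) (move 13 (- 8)))
     (Seq (Assign 26 (Reg 23)) (Seq (Assign 27 (Reg 22)) flush_com))"

lemma rightward_ter:
  assumes r: "rel s (G, S, P, R)" and ne: "dropWhile (\<lambda>e. fst e \<le> reg s 23) S \<noteq> []"
    and neP: "dropWhile (\<lambda>e. fst e < reg s 23) P \<noteq> []"
  shows "ter right_com s (\<lambda>t s'. rel s' (rightward (reg s 0) (reg s 1) (reg s 17) (reg s 18) (reg s 22) (reg s 23) (G, S, P, R)) \<and> unchanged s s' \<and>
    t + 100 * lengths (rightward (reg s 0) (reg s 1) (reg s 17) (reg s 18) (reg s 22) (reg s 23) (G, S, P, R)) \<le> 100 * lengths (G, S, P, R) + 300)"
proof -
  note f = relD[OF r]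
  let ?p = "\<lambda>e. fst e \<le> reg s 23"
  define S' where "S' = dropWhile ?p S"
  have S': "S' \<noteq> []" "length S' \<le> length S" "\<exists>A. S = A @ S'"
    using ne by (auto simp: S'_def length_dropWhile_le) (metis takeWhile_dropWhile_id)
  show ?thesis
    unfolding right_com_def ter_simps(4)
  proof (rule ter_pop[where T = S and p = ?p and a = "reg s 9 - 8"], goal_cases)
    case (1 T')
    then have "stk (mem s) (reg s 9) (map (\<lambda>e. (fst e, fst (snd e))) T')" using f(5) stk_suffix by auto
    from stk_hd[OF this] show ?case using 1(1) by (auto simp: hd_map algebra_simps)
  next
    case 2 show ?case by fact
  next
    case 3 show ?case using f by simp
  next
    case 4
    define s1 where "s1 = s\<lparr>reg := (reg s)(13 := reg s 9 - 8 + 8 * int (length S'), 26 := reg s 23, 27 := reg s 22)\<rparr>"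
    have rel1: "rel s1 (G, S', P, R)"
    proof -
      have "stk (mem s) (reg s 9) (map (\<lambda>e. (fst e, fst (snd e))) S')" "stk (mem s) (reg s 9 + 2) (map (\<lambda>e. snd (snd e)) S')"
        using f(5,6) S'(3) stk_suffix by auto
      then show ?thesis using f unfolding rel_def s1_def by auto
    qed
    have un: "unchanged s s1" by (auto simp: unchanged_def s1_def)
    have v: "reg s1 0 = reg s 0" "reg s1 1 = reg s 1" "reg s1 17 = reg s 17" "reg s1 18 = reg s 18" "reg s1 26 = reg s 23" "reg s1 27 = reg s 22"
      by (auto simp: s1_def)
    have eq: "rightward (reg s 0) (reg s 1) (reg s 17) (reg s 18) (reg s 22) (reg s 23) (G, S, P, R) =
      flush (reg s 0) (reg s 1) (reg s 17) (reg s 18) (reg s 23) (reg s 22) (G, S', P, R)"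
      by (simp add: rightward_def S'_def)
    have len: "lengths (flush (reg s 0) (reg s 1) (reg s 17) (reg s 18) (reg s 23) (reg s 22) (G, S', P, R)) =
       length G + length S' + length (dropWhile (\<lambda>e. fst e < reg s 23) P)"
      by (simp add: flush_def lengths_def)
    have ft: "ter flush_com s1 (\<lambda>t s'. rel s' (flush (reg s 0) (reg s 1) (reg s 17) (reg s 18) (reg s 23) (reg s 22) (G, S', P, R)) \<and>
      unchanged s s' \<and> t + 100 * length (dropWhile (\<lambda>e. fst e < reg s 23) P) \<le> 100 * length P + 20)"
      by (rule ter_mono[OF flush_ter[OF rel1]]) (use v neP unchanged_trans[OF un] in auto)
    show ?case
      unfolding S'_def[symmetric] eq len ter_simps
      apply simp
      apply (rule ter_mono[OF ft[unfolded s1_def, simplified]])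
      using S'(2) by (auto simp: lengths_def)
  qed
qed

definition up_com :: com where
  "up_com = Seq (While (Conj (Less (cell 13 2) (Plus (Reg 23) (Reg 0))) (Less (cell 13 3) (Reg 24))) (move 13 (- 8)))
     (Cond (Conj (Neg (Less (cell 13 2) (Plus (Reg 23) (Reg 0)))) (Less (Reg 22) (Plus (cell 13 1) (Reg 1))))
       (Seq (move 14 8) (Seq (Store (Reg 14) (Reg 23)) (Store (Plus (Reg 14) (Const 1)) (cell 13 1))))
       Skip)"

lemma upward_ter:
  assumes r: "rel s (G, S, P, R)" and ne: "dropWhile (blocked (reg s 23 + reg s 0) (reg s 24)) S \<noteq> []"
  shows "ter up_com s (\<lambda>t s'. rel s' (upward (reg s 0) (reg s 1) (reg s 23) (reg s 22) (reg s 24) (G, S, P, R)) \<and> unchanged s s' \<and>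
    t + 100 * lengths (upward (reg s 0) (reg s 1) (reg s 23) (reg s 22) (reg s 24) (G, S, P, R)) \<le> 100 * lengths (G, S, P, R) + 300)"
proof -
  note f = relD[OF r]
  let ?p = "blocked (reg s 23 + reg s 0) (reg s 24)"
  define S' where "S' = dropWhile ?p S"
  have S': "S' \<noteq> []" "length S' \<le> length S" "\<exists>A. S = A @ S'"
    using ne by (auto simp: S'_def length_dropWhile_le) (metis takeWhile_dropWhile_id)
  have sS: "stk (mem s) (reg s 9) (map (\<lambda>e. (fst e, fst (snd e))) S')" "stk (mem s) (reg s 9 + 2) (map (\<lambda>e. snd (snd e)) S')"
    using f(5,6) S'(3) stk_suffix by auto
  obtain b v nx ny where hd: "hd S' = (b, v, nx, ny)" by (metis prod_cases4)
  define q where "q = reg s 9 - 8 + 8 * int (length S')"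
  define a where "a = reg s 9 + 8 * int (length P) + 6"
  have hq: "mem s (q + 1) = v" "mem s (q + 2) = nx" "mem s (q + 3) = ny"
    using stk_hd[OF sS(1)] stk_hd[OF sS(2)] S'(1) by (auto simp: hd_map hd q_def algebra_simps)
  have aq: "reg s 14 + 8 = a" "q + 1 \<noteq> a" using f(7) unfolding a_def q_def by (simp, presburger)
  show ?thesis
    unfolding up_com_def ter_simps(4)
  proof (rule ter_pop[where T = S and p = ?p and a = "reg s 9 - 8"], goal_cases)
    case (1 T')
    then have "stk (mem s) (reg s 9 + 2) (map (\<lambda>e. snd (snd e)) T')" using f(6) stk_suffix by auto
    from stk_hd[OF this] show ?case using 1(1) by (auto simp: hd_map algebra_simps blocked_def)
  next
    case 2 show ?case by fact
  next
    case 3 show ?case using f by simp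
  next
    case 4
    define c where "c \<longleftrightarrow> reg s 23 + reg s 0 \<le> nx \<and> reg s 22 < v + reg s 1"
    have eq: "upward (reg s 0) (reg s 1) (reg s 23) (reg s 22) (reg s 24) (G, S, P, R) = (G, S', if c then (reg s 23, v) # P else P, R)"
      unfolding upward_def by (simp add: S'_def[symmetric] hd c_def Let_def)
    define s1 where "s1 = (if c then s\<lparr>reg := (reg s)(13 := q, 14 := a), mem := (mem s)(a := reg s 23, a + 1 := v)\<rparr>
       else s\<lparr>reg := (reg s)(13 := q)\<rparr>)"
    have un: "unchanged s s1" using f(1) by (auto simp: unchanged_def s1_def a_def)
    have rel1: "rel s1 (G, S', if c then (reg s 23, v) # P else P, R)"
    proof (cases c)
      case False
      then show ?thesis using f sS unfolding rel_def s1_def q_def by auto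
    next
      case True
      let ?m = "(mem s)(a := reg s 23, a + 1 := v)"
      have 1: "stk ?m (reg s 9 + 4) G" unfolding a_def by (intro stk_upd f(3); presburger)
      have 2: "stk ?m (reg s 9) (map (\<lambda>e. (fst e, fst (snd e))) S')" unfolding a_def by (intro stk_upd sS; simp; presburger)
      have 3: "stk ?m (reg s 9 + 2) (map (\<lambda>e. snd (snd e)) S')" unfolding a_def by (intro stk_upd sS; simp; presburger)
      have 4: "stk ?m (reg s 9 + 6) P" unfolding a_def by (intro stk_upd f(8); presburger)
      have 5: "outs ?m R" unfolding a_def using f(1) by (intro outs_upd f(11)) auto
      have 6: "?m (reg s 9 + 6 + 8 * int (length P)) = reg s 23" "?m (reg s 9 + 6 + 8 * int (length P) + 1) = v"
        by (auto simp: a_def)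
      show ?thesis using f 1 2 3 4 5 6 True unfolding rel_def s1_def by (simp add: q_def a_def)
    qed
    have b: "bval (Conj (Neg (Less (cell 13 2) (Plus (Reg 23) (Reg 0)))) (Less (Reg 22) (Plus (cell 13 1) (Reg 1)))) (s\<lparr>reg := (reg s)(13 := q)\<rparr>) = c"
      using hq by (auto simp: c_def)
    show ?case
      unfolding S'_def[symmetric] q_def[symmetric] eq ter_simps(5) b
      using rel1 un S'(2) aq hq by (cases c) (simp_all add: s1_def lengths_def)
  qed
qed

section \<open>The complete program\<close>

definition step_com :: com where
  "step_com = Seq (Cond (Less (Reg 23) (Reg 21)) left_com right_com)
     (Cond (Less (Reg 22) (Reg 24)) up_com Skip)"

text \<open>One horizontal and one vertical edge. Registers 21 to 24 receive \<open>x k\<close>,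
  \<open>y k\<close>, \<open>x (Suc k)\<close>, \<open>y (Suc k)\<close>; the vertex between the two
  edges is held in register 25.\<close>

definition block_com :: com where
  "block_com =
     Seq (Assign 21 (cell 10 0))
    (Seq (Assign 22 (cell 10 1))
    (Seq (Assign 25 (cell 10 2))
    (Seq (Assign 23 (cell 25 0))
    (Seq (Assign 10 (cell 25 2))
    (Seq (Assign 24 (cell 10 1)) step_com)))))"

text \<open>Register 7 is the upper end of the rightmost edge, so its successor starts the chain.
  The chain ends at the left end of the top edge: one predecessor back, or three if the falling
  corner and the right end of the top edge lie in between.\<close>

definition init_com :: com where
  "init_com =
     Seq (Assign 10 (cell 7 2))
    (Seq (Assign 19 (cell 7 0))
    (Seq (Cond (Less (Const 0) (Reg 8))
           (Seq (Assign 11 (Mem (Plus (Mem (Plus (cell 7 3) (Const 3))) (Const 3))))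
           (Seq (Assign 17 (cell 8 0)) (Assign 18 (cell 8 1))))
           (Seq (Assign 11 (cell 7 3))
           (Seq (Assign 17 (cell 7 0)) (Assign 18 (cell 11 1)))))
    (Seq (Assign 20 (cell 11 1))
    (Seq (Assign 12 (Plus (Reg 9) (Const 4)))
    (Seq (Store (Reg 12) (Reg 19))
    (Seq (Store (Plus (Reg 12) (Const 1)) (Reg 20))
    (Seq (Assign 13 (Minus (Reg 9) (Const 8)))
    (Seq (Assign 14 (Plus (Reg 9) (Const 6)))
    (Seq (Store (Reg 14) (Reg 19))
    (Seq (Store (Plus (Reg 14) (Const 1)) (Const 0))
    (Seq (Assign 15 (Const 0)) (Assign 16 (Const 0)))))))))))))"

text \<open>The final flush treats the top edge as if it reached \<open>x 0\<close>; what lies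
  beyond a falling corner is rejected by the test on \<open>c1\<close> and
  \<open>c2\<close>.\<close>

definition main_com :: com where
  "main_com =
     Seq init_com
    (Seq (While (Neg (Conj (Neg (Less (Reg 10) (Reg 11))) (Neg (Less (Reg 11) (Reg 10))))) block_com)
    (Seq (Assign 26 (Reg 19))
    (Seq (Assign 27 (Reg 20))
    (Seq flush_com
    (Seq (Assign 0 (Reg 16)) (Assign 1 (Reg 15)))))))"

text \<open>The chain as stored in memory: the vertex \<open>(x k, y k)\<close> at address \<open>a k\<close> and
  \<open>(x (k + 1), y k)\<close> at address \<open>b k\<close>.\<close>

locale stored_chain = bls_chain +
  fixes m0 :: "int \<Rightarrow> int" and B :: int and a b :: "nat \<Rightarrow> int"
  assumes cells_a: "k \<le> N \<Longrightarrow> 0 < a k \<and> a k + 3 < B \<and> m0 (a k) = x k \<and> m0 (a k + 1) = y k"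
    and next_a: "k < N \<Longrightarrow> m0 (a k + 2) = b k"
    and cells_b: "k < N \<Longrightarrow> 0 < b k \<and> b k + 3 < B \<and> m0 (b k) = x (Suc k) \<and> m0 (b k + 2) = a (Suc k)"
    and a_inj: "k < N \<Longrightarrow> a k \<noteq> a N"
begin

definition loop_inv :: "nat \<Rightarrow> state \<Rightarrow> bool" where
  "loop_inv k s \<longleftrightarrow> rel s (run k) \<and> reg s 9 = B \<and> (\<forall>c. 0 < c \<and> c < B \<longrightarrow> mem s c = m0 c) \<and>
     reg s 0 = w \<and> reg s 1 = h \<and> reg s 17 = c1 \<and> reg s 18 = c2 \<and> reg s 19 = x 0 \<and> reg s 20 = y N \<and>
     reg s 10 = a k \<and> reg s 11 = a N"

text \<open>Amortised cost: the lists serve as potential, since every loop iteration pops an entry.\<close>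

lemma block_ter:
  assumes k: "k < N" and i: "loop_inv k s"
  shows "ter block_com s (\<lambda>t s'. loop_inv (Suc k) s' \<and> t + 100 * lengths (run (Suc k)) \<le> 100 * lengths (run k) + 700)"
proof -
  obtain G S P R where rk: "run k = (G, S, P, R)" by (metis prod_cases4)
  have ih: "inv_h k (G, S, P, R)" using inv_run[of k] k rk by simp
  have m: "\<And>c. 0 < c \<Longrightarrow> c < B \<Longrightarrow> mem s c = m0 c" and rs: "rel s (G, S, P, R)" and
    rg: "reg s 9 = B" "reg s 0 = w" "reg s 1 = h" "reg s 17 = c1" "reg s 18 = c2" "reg s 19 = x 0" "reg s 20 = y N" "reg s 10 = a k" "reg s 11 = a N"
    using i rk by (auto simp: loop_inv_def)
  have mm: "mem s (a k) = x k" "mem s (a k + 1) = y k" "mem s (a k + 2) = b k" "mem s (b k) = x (Suc k)" "mem s (b k + 2) = a (Suc k)" "mem s (a (Suc k) + 1) = y (Suc k)"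
    using cells_a[of k] next_a[of k] cells_b[of k] cells_a[of "Suc k"] k m by auto
  define s1 where "s1 = s\<lparr>reg := (reg s)(21 := x k, 22 := y k, 25 := b k, 23 := x (Suc k), 10 := a (Suc k), 24 := y (Suc k))\<rparr>"
  have r1: "rel s1 (G, S, P, R)" using rs by (simp add: rel_def s1_def)
  have g1: "reg s1 9 = B" "reg s1 0 = w" "reg s1 1 = h" "reg s1 17 = c1" "reg s1 18 = c2" "reg s1 19 = x 0" "reg s1 20 = y N"
    "reg s1 10 = a (Suc k)" "reg s1 11 = a N" "reg s1 21 = x k" "reg s1 22 = y k" "reg s1 23 = x (Suc k)" "reg s1 24 = y (Suc k)" "mem s1 = mem s"
    using rg by (auto simp: s1_def)
  obtain G' S' P' R' where hs: "hstep w h c1 c2 (x k) (y k) (x (Suc k)) (G, S, P, R) = (G', S', P', R')" by (metis prod_cases4)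
  have H: "ter (Cond (Less (Reg 23) (Reg 21)) left_com right_com) s1 (\<lambda>t s'. rel s' (G', S', P', R') \<and> unchanged s1 s' \<and>
      t + 100 * lengths (G', S', P', R') \<le> 100 * lengths (G, S, P, R) + 304)"
  proof (cases "x (Suc k) < x k")
    case True
    have eq: "leftward (x k) (y k) (x (Suc k)) (G, S, P, R) = (G', S', P', R')" using hs True by (simp add: hstep_def)
    show ?thesis
      using True inv_hstep(2)[OF k ih True] leftward_ter[OF r1] unfolding g1 eq
      by (simp add: g1) (erule ter_mono, auto)
  next
    case False
    have eq: "rightward w h c1 c2 (y k) (x (Suc k)) (G, S, P, R) = (G', S', P', R')" using hs False by (simp add: hstep_def)
    show ?thesis
      using False inv_hstep(3)[OF k ih False] inv_hstep(4)[OF k ih] rightward_ter[OF r1] unfolding g1 eq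
      by (simp add: g1) (erule ter_mono, auto)
  qed
  have iv: "inv_v k (G', S', P', R')" using inv_hstep(1)[OF k ih] hs by simp
  have rS: "run (Suc k) = vstep w h (x (Suc k)) (y k) (y (Suc k)) (G', S', P', R')" using rk hs by simp
  have V: "ter (Cond (Less (Reg 22) (Reg 24)) up_com Skip) s2 (\<lambda>t s'. loop_inv (Suc k) s' \<and> t + 100 * lengths (run (Suc k)) \<le> 100 * lengths (G', S', P', R') + 304)"
    if r2: "rel s2 (G', S', P', R')" and u: "unchanged s1 s2" for s2
  proof -
    have g2: "reg s2 0 = w" "reg s2 1 = h" "reg s2 22 = y k" "reg s2 23 = x (Suc k)" "reg s2 24 = y (Suc k)" "reg s2 9 = B"
      using u g1 by (auto simp: unchanged_def)
    have fin: "loop_inv (Suc k) s3" if "rel s3 (run (Suc k))" "unchanged s2 s3" for s3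
      using that unchanged_trans[OF u that(2)] g1 m by (auto simp: loop_inv_def unchanged_def)
    show ?thesis
    proof (cases "y k < y (Suc k)")
      case True
      have eq: "upward w h (x (Suc k)) (y k) (y (Suc k)) (G', S', P', R') = run (Suc k)" using rS True by (simp add: vstep_def)
      show ?thesis
        using True inv_vstep(2)[OF k iv True] upward_ter[OF r2] fin unfolding g2 eq
        by (simp add: g2 del: run.simps) (erule ter_mono, auto)
    next
      case False
      have "run (Suc k) = (G', S', P', R')" using rS False by (simp add: vstep_def)
      moreover have "unchanged s2 s2" by (simp add: unchanged_def)
      ultimately show ?thesis using fin[of s2] r2 False by (simp add: g2 del: run.simps)
    qed
  qed
  have "ter step_com s1
    (\<lambda>t s'. loop_inv (Suc k) s' \<and> t + 100 * lengths (run (Suc k)) \<le> 100 * lengths (G, S, P, R) + 608)"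
    unfolding step_com_def ter_simps(4) by (rule ter_mono[OF H], elim conjE, rule ter_mono[OF V]) auto
  then show ?thesis
    unfolding block_com_def rk
    by (simp add: rg mm s1_def[symmetric] del: run.simps) (erule ter_mono, auto simp del: run.simps)
qed

text \<open>The amortised bounds telescope; 750 covers the 700 of a block and the loop test.\<close>

lemma loop_ter:
  assumes "k \<le> N" "loop_inv k s"
  shows "ter (While (Neg (Conj (Neg (Less (Reg 10) (Reg 11))) (Neg (Less (Reg 11) (Reg 10))))) block_com) s
    (\<lambda>t s'. loop_inv N s' \<and> t + 100 * lengths (run N) \<le> 100 * lengths (run k) + 750 * (N - k) + 20)"
  using assms
proof (induction "N - k" arbitrary: k s)
  case 0
  then have "k = N" by simp
  then show ?case using 0 by (intro ter_WhileF) (auto simp: loop_inv_def)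
next
  case (Suc n)
  then have k: "k < N" by simp
  have ne: "reg s 10 \<noteq> reg s 11" using Suc.prems a_inj[OF k] by (auto simp: loop_inv_def)
  have IH: "ter (While (Neg (Conj (Neg (Less (Reg 10) (Reg 11))) (Neg (Less (Reg 11) (Reg 10))))) block_com) s'
    (\<lambda>t s'. loop_inv N s' \<and> t + 100 * lengths (run N) \<le> 100 * lengths (run (Suc k)) + 750 * (N - Suc k) + 20)" if "loop_inv (Suc k) s'" for s'
    using Suc.hyps(1)[of "Suc k" s'] Suc.hyps(2) that k by simp
  have nk: "N - k = Suc (N - Suc k)" using k by simp
  show ?case
  proof (rule ter_WhileT)
    show "bval (Neg (Conj (Neg (Less (Reg 10) (Reg 11))) (Neg (Less (Reg 11) (Reg 10))))) s" using ne by auto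
    show "ter block_com s (\<lambda>t s'. ter (While (Neg (Conj (Neg (Less (Reg 10) (Reg 11))) (Neg (Less (Reg 11) (Reg 10))))) block_com) s'
      (\<lambda>t' s'. loop_inv N s' \<and> 1 + bcost (Neg (Conj (Neg (Less (Reg 10) (Reg 11))) (Neg (Less (Reg 11) (Reg 10))))) + t + t' + 100 * lengths (run N) \<le> 100 * lengths (run k) + 750 * (N - k) + 20))"
      unfolding nk by (rule ter_mono[OF block_ter[OF k Suc.prems(2)]], elim conjE, rule ter_mono[OF IH]) auto
  qed
qed

theorem main_ter:
  assumes s: "reg s 9 = B" "reg s 0 = w" "reg s 1 = h" "mem s = m0" "m0 (reg s 7 + 2) = a 0" "m0 (reg s 7) = x 0"
    and c: "if 0 < reg s 8 then m0 (m0 (m0 (reg s 7 + 3) + 3) + 3) = a N \<and> m0 (reg s 8) = c1 \<and> m0 (reg s 8 + 1) = c2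
      else m0 (reg s 7 + 3) = a N \<and> c1 = x 0 \<and> c2 = y N"
  shows "\<exists>t s'. exec main_com s t s' \<and> t \<le> 2000 * N + 1000 \<and> reported s' = pt ` {(p, q). stable p q}"
proof -
  have B: "0 < B" using cells_a[of 0] by auto
  have yN: "m0 (a N + 1) = y N" using cells_a[of N] by simp
  have init: "ter init_com s (\<lambda>t s'. loop_inv 0 s' \<and> t \<le> 200)"
  proof -
    define s1 where "s1 = s\<lparr>reg := (reg s)(10 := a 0, 19 := x 0, 11 := a N, 17 := c1, 18 := c2, 20 := y N, 12 := B + 4, 13 := B - 8, 14 := B + 6,
      15 := 0, 16 := 0), mem := m0(B + 4 := x 0, B + 4 + 1 := y N, B + 6 := x 0, B + 6 + 1 := 0)\<rparr>"
    have g: "reg s1 9 = B" "reg s1 0 = w" "reg s1 1 = h" "reg s1 17 = c1" "reg s1 18 = c2" "reg s1 19 = x 0" "reg s1 20 = y N"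
      "reg s1 10 = a 0" "reg s1 11 = a N" "reg s1 12 = B + 4" "reg s1 13 = B - 8" "reg s1 14 = B + 6" "reg s1 15 = 0" "reg s1 16 = 0"
      by (simp_all add: s1_def s(1-3) s(3)[simplified])
    have m: "mem s1 (B + 4) = x 0" "mem s1 (B + 4 + 1) = y N" "mem s1 (B + 6) = x 0" "mem s1 (B + 6 + 1) = 0" "\<And>c. c < B \<Longrightarrow> mem s1 c = m0 c"
      by (simp_all add: s1_def)
    have "loop_inv 0 s1" using m B unfolding loop_inv_def rel_def run.simps g by simp
    moreover have "ter init_com s (\<lambda>t s'. s' = s1 \<and> t \<le> 200)"
    proof (cases "0 < reg s 8")
      case True
      have "m0 (m0 (m0 (reg s 7 + 3) + 3) + 3) = a N" "m0 (reg s 8) = c1" "m0 (reg s 8 + 1) = c2" using c True by auto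
      then show ?thesis unfolding init_com_def s1_def
        by (simp add: s yN True)
    next
      case False
      have "m0 (reg s 7 + 3) = a N" "c1 = x 0" "c2 = y N" using c False by auto
      then show ?thesis unfolding init_com_def s1_def
        by (simp add: s yN False)
    qed
    ultimately show ?thesis by (auto elim: ter_mono)
  qed
  have l0: "lengths (run 0) = 2" by (simp add: lengths_def)
  obtain G S P R where rN: "run N = (G, S, P, R)" by (metis prod_cases4)
  obtain G' S' P' R' where fl: "flush w h c1 c2 (x 0) (y N) (run N) = (G', S', P', R')"
    by (rule prod_cases4)
  have R': "set R' = {(p, q). stable p q}" using run_correct(1) unfolding fl snd_conv .
  have fin: "ter (Seq (Assign 26 (Reg 19)) (Seq (Assign 27 (Reg 20)) (Seq flush_com (Seq (Assign 0 (Reg 16)) (Assign 1 (Reg 15)))))) s2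
     (\<lambda>t s'. reported s' = pt ` set R' \<and> t \<le> 100 * lengths (run N) + 100)" if i: "loop_inv N s2" for s2
  proof -
    define s3 where "s3 = s2\<lparr>reg := (reg s2)(26 := x 0, 27 := y N)\<rparr>"
    have "rel s2 (G, S, P, R)" using i rN by (simp add: loop_inv_def)
    then have r3: "rel s3 (G, S, P, R)" by (simp add: rel_def s3_def)
    have g3: "reg s3 26 = x 0" "reg s3 27 = y N" "reg s3 0 = w" "reg s3 1 = h" "reg s3 17 = c1" "reg s3 18 = c2"
      using i by (auto simp: loop_inv_def s3_def)
    have nP: "dropWhile (\<lambda>e. fst e < x 0) P \<noteq> []" using run_correct(2) rN by simp
    have ft: "ter flush_com s3 (\<lambda>t s'. rel s' (G', S', P', R') \<and> t \<le> 100 * lengths (run N) + 20)"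
      using flush_ter[OF r3] nP unfolding g3 fl[unfolded rN]
      by (simp add: g3) (erule ter_mono, auto simp: rN lengths_def)
    have rp: "reported (s4\<lparr>reg := (reg s4)(0 := reg s4 16, 1 := reg s4 15)\<rparr>) = pt ` set R'" if r4: "rel s4 (G', S', P', R')" for s4
    proof -
      have 1: "reg s4 15 = - 2 * int (length R')" "reg s4 16 = int (length R')" "outs (mem s4) R'" using relD[OF r4] by auto
      have "reported (s4\<lparr>reg := (reg s4)(0 := reg s4 16, 1 := reg s4 15)\<rparr>) = (\<lambda>i. pt (R' ! i)) ` {..<length R'}"
        unfolding reported_def using outs_nth[OF 1(3)] by (intro image_cong) (auto simp: 1)
      also have "\<dots> = pt ` ((!) R' ` {..<length R'})" by (simp add: image_image)
      also have "(!) R' ` {..<length R'} = set R'" by (auto simp: set_conv_nth)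
      finally show ?thesis .
    qed
    have e: "reg s2 19 = x 0" "reg s2 20 = y N" using i by (auto simp: loop_inv_def)
    show ?thesis
      by (simp add: e s3_def[symmetric]) (rule ter_mono[OF ft], use rp in auto)
  qed
  have "ter main_com s (\<lambda>t s'. reported s' = pt ` set R' \<and> t \<le> 2000 * N + 1000)"
  proof -
    have L: "ter (While (Neg (Conj (Neg (Less (Reg 10) (Reg 11))) (Neg (Less (Reg 11) (Reg 10))))) block_com) s1
       (\<lambda>t s'. loop_inv N s' \<and> t + 100 * lengths (run N) \<le> 220 + 750 * N)" if "loop_inv 0 s1" for s1
      by (rule ter_mono[OF loop_ter[of 0 s1]]) (use that l0 in auto)
    show ?thesis
      unfolding main_com_def ter_simps(4)[of init_com] ter_simps(4)[of "While _ _"]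
      by (rule ter_mono[OF init], elim conjE, rule ter_mono[OF L], assumption, elim conjE, rule ter_mono[OF fin]) auto
  qed
  then show ?thesis unfolding ter_def R' by blast
qed

end

section \<open>Rectilinear Jordan curves\<close>

text \<open>Carries the Jordan curve theorem over from the complex plane along a linear bijection
  and identifies its two components as \<open>inside\<close> and \<open>outside\<close>.\<close>

lemma Jordan_plane:
  fixes g :: "real \<Rightarrow> real \<times> real"
  assumes "simple_path g" "pathfinish g = pathstart g"
  shows "open (inside (path_image g))" "connected (inside (path_image g))"
    "bounded (inside (path_image g))" "inside (path_image g) \<noteq> {}"
    "frontier (inside (path_image g)) = path_image g"
    "frontier (outside (path_image g)) = path_image g"
proof -
  define f where "f = (\<lambda>p::real\<times>real. Complex (fst p) (snd p))"
  define f' where "f' = (\<lambda>z. (Re z, Im z))"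
  have lf: "linear f"
    unfolding f_def by (intro linearI) (auto simp: complex_eq_iff)
  have lf': "linear f'"
    unfolding f'_def by (intro linearI) auto
  have ff': "f (f' z) = z" and f'f: "f' (f p) = p" for z p
    by (auto simp: f_def f'_def)
  have cf: "continuous_on A f" and cf': "continuous_on B f'" for A B
    using lf lf' linear_continuous_on linear_conv_bounded_linear by blast+
  have bl: "bounded_linear f'" using lf' linear_conv_bounded_linear by blast
  have hom: "homeomorphism UNIV UNIV f' f"
    by (rule homeomorphismI) (auto simp: cf cf' ff' f'f)
  have injf: "inj f" by (metis f'f injI)
  have sp: "simple_path (f \<circ> g)"
    using assms(1) cf injf by (intro simple_path_continuous_image) (auto intro: inj_on_subset)
  have lp: "pathfinish (f \<circ> g) = pathstart (f \<circ> g)"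
    using assms(2) by (simp add: pathfinish_compose pathstart_compose)
  obtain inner outer where io:
    "inner \<noteq> {}" "open inner" "connected inner"
    "outer \<noteq> {}" "open outer" "connected outer"
    "bounded inner" "\<not> bounded outer" "inner \<inter> outer = {}"
    "inner \<union> outer = - path_image (f \<circ> g)"
    "frontier inner = path_image (f \<circ> g)" "frontier outer = path_image (f \<circ> g)"
    using Jordan_curve[OF sp lp] by blast
  have im: "f' ` path_image (f \<circ> g) = path_image g"
    by (auto simp: path_image_compose image_image f'f)
  have opn: "open (f' ` S)" if "open S" for S
    using hom that by (metis homeomorphism_imp_open_map open_openin openin_open_eq subtopology_UNIV open_UNIV)
  have clo: "closure (f' ` S) = f' ` closure S" for S
    using closure_injective_linear_image[OF lf'] by (metis ff' injI)
  have inj': "inj f'" by (metis ff' injI)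
  have fro: "frontier (f' ` S) = f' ` frontier S" if "open S" for S
    using that opn[OF that] by (simp add: frontier_def clo interior_open image_set_diff[OF inj'])
  define inn out where "inn = f' ` inner" and "out = f' ` outer"
  have F: "frontier inn = path_image g" "frontier out = path_image g"
    using io by (simp_all add: inn_def out_def fro im)
  have "inn \<inter> out = f' ` (inner \<inter> outer)" unfolding inn_def out_def by (rule image_Int[OF inj', symmetric])
  then have ino: "open inn" "connected inn" "bounded inn" "inn \<noteq> {}" "inn \<inter> out = {}"
    using io unfolding inn_def
    by (auto intro!: opn connected_continuous_image cf' bounded_linear_image[OF _ bl])
  have out: "open out" "connected out" unfolding out_def using io
    by (auto intro!: opn connected_continuous_image cf')
  have un: "inn \<union> out = - path_image g"
  proof -
    have "inn \<union> out = f' ` (- path_image (f \<circ> g))" by (simp add: inn_def out_def io(10)[symmetric] image_Un)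
    also have "\<dots> = - path_image g"
      using bij_image_Compl_eq[of f'] im hom by (metis bij_betw_def ff' f'f inj' surj_def)
    finally show ?thesis .
  qed
  have unb: "\<not> bounded out"
  proof
    assume "bounded out"
    then have "bounded (f ` out)" 
      using bounded_linear_image lf linear_conv_bounded_linear by blast
    then show False using io(8) by (simp add: out_def image_image ff')
  qed
  have I: "inside (path_image g) = inn"
  proof
    show "inside (path_image g) \<subseteq> inn"
      by (rule inside_subset[OF out(2) unb un])
    show "inn \<subseteq> inside (path_image g)"
      using interior_inside_frontier[OF ino(3)] F ino(1) by (metis interior_eq)
  qed
  have O: "outside (path_image g) = out"
    using un ino(5) I outside_inside[of "path_image g"] by auto
  show "open (inside (path_image g))" "connected (inside (path_image g))"
    "bounded (inside (path_image g))" "inside (path_image g) \<noteq> {}"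
    "frontier (inside (path_image g)) = path_image g"
    "frontier (outside (path_image g)) = path_image g"
    using I O F ino by auto
qed

text \<open>The curve leaves \<open>z\<close> in direction \<open>d\<close>. For an axis direction
  at a point of a rectilinear curve the alternative is an initial piece of the ray that avoids the
  curve, by \<open>local_box\<close>.\<close>

definition germ :: "point set \<Rightarrow> point \<Rightarrow> point \<Rightarrow> bool" where
  "germ J z d \<longleftrightarrow> (\<exists>\<epsilon>>0. \<forall>t. 0 < t \<and> t < \<epsilon> \<longrightarrow> z + t *\<^sub>R d \<in> J)"

lemma finite_common_eps:
  fixes P :: "'a \<Rightarrow> real \<Rightarrow> bool"
  assumes "finite S" "\<And>s. s \<in> S \<Longrightarrow> \<exists>\<epsilon>>0. P s \<epsilon>" "\<And>s \<epsilon> \<epsilon>'. P s \<epsilon> \<Longrightarrow> 0 < \<epsilon>' \<Longrightarrow> \<epsilon>' \<le> \<epsilon> \<Longrightarrow> P s \<epsilon>'"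
  shows "\<exists>\<epsilon>>0. \<forall>s\<in>S. P s \<epsilon>"
  using assms(1,2)
proof (induction S)
  case empty show ?case by (auto intro: exI[of _ 1])
next
  case (insert s S)
  then obtain e1 e2 where e: "e1 > 0" "\<forall>s\<in>S. P s e1" "e2 > 0" "P s e2" by (meson insertCI)
  then have "\<forall>s'\<in>insert s S. P s' (min e1 e2)" using assms(3) by (metis insert_iff min.cobounded1 min.cobounded2 min_less_iff_conj)
  then show ?case using e by (intro exI[of _ "min e1 e2"]) auto
qed

lemma segment_ray:
  fixes a b z d :: point
  assumes "z \<in> closed_segment a b"
  shows "\<exists>\<epsilon>>0. (\<forall>t. 0 < t \<and> t < \<epsilon> \<longrightarrow> z + t *\<^sub>R d \<in> closed_segment a b) \<or>
     (\<forall>t. 0 < t \<and> t < \<epsilon> \<longrightarrow> z + t *\<^sub>R d \<notin> closed_segment a b)"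
proof (cases "\<exists>t0>0. z + t0 *\<^sub>R d \<in> closed_segment a b")
  case True
  then obtain t0 where t0: "t0 > 0" "z + t0 *\<^sub>R d \<in> closed_segment a b" by blast
  have "z + t *\<^sub>R d \<in> closed_segment a b" if "0 < t" "t < t0" for t
  proof -
    have "z + t *\<^sub>R d = (1 - t / t0) *\<^sub>R z + (t / t0) *\<^sub>R (z + t0 *\<^sub>R d)"
      using t0 by (simp add: algebra_simps)
    moreover have "0 \<le> t / t0" "t / t0 \<le> 1" using that t0 by auto
    ultimately show ?thesis using assms t0(2) convex_closed_segment[of a b] by (auto simp: convex_alt)
  qed
  then show ?thesis using t0 by blast
next
  case False
  then show ?thesis by (intro exI[of _ 1]) auto
qed

lemma hseg: "closed_segment (a, y) (b, y) = {p. snd p = y \<and> min a b \<le> fst p \<and> fst p \<le> max a (b::real)}" for y :: real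
proof -
  have "closed_segment (a, y) (b, y) = closed_segment a b \<times> {y}"
  proof (intro set_eqI iffI)
    fix p assume "p \<in> closed_segment (a, y) (b, y)"
    then obtain u where u: "0 \<le> u" "u \<le> 1" "p = (1 - u) *\<^sub>R (a, y) + u *\<^sub>R (b, y)" by (auto simp: in_segment)
    then have "fst p = (1 - u) *\<^sub>R a + u *\<^sub>R b" "snd p = y" by (auto simp: algebra_simps)
    then show "p \<in> closed_segment a b \<times> {y}" using u(1,2) by (cases p) (auto simp: in_segment)
  next
    fix p assume "p \<in> closed_segment a b \<times> {y}"
    then obtain u where u: "0 \<le> u" "u \<le> 1" "fst p = (1 - u) *\<^sub>R a + u *\<^sub>R b" "snd p = y" by (cases p) (auto simp: in_segment)
    then have "p = (1 - u) *\<^sub>R (a, y) + u *\<^sub>R (b, y)" by (cases p) (auto simp: algebra_simps)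
    then show "p \<in> closed_segment (a, y) (b, y)" using u(1,2) by (auto simp: in_segment)
  qed
  moreover have "closed_segment a b = {min a b..max a b}" by (simp add: closed_segment_eq_real_ivl min_def max_def)
  ultimately show ?thesis by (simp add: set_eq_iff conj_commute)
qed

lemma vseg: "closed_segment (x, a) (x, b) = {p. fst p = x \<and> min a b \<le> snd p \<and> snd p \<le> max a (b::real)}" for x :: real
proof -
  have "closed_segment (x, a) (x, b) = {x} \<times> closed_segment a b"
  proof (intro set_eqI iffI)
    fix p assume "p \<in> closed_segment (x, a) (x, b)"
    then obtain u where u: "0 \<le> u" "u \<le> 1" "p = (1 - u) *\<^sub>R (x, a) + u *\<^sub>R (x, b)" by (auto simp: in_segment)
    then have "snd p = (1 - u) *\<^sub>R a + u *\<^sub>R b" "fst p = x" by (auto simp: algebra_simps)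
    then show "p \<in> {x} \<times> closed_segment a b" using u(1,2) by (cases p) (auto simp: in_segment)
  next
    fix p assume "p \<in> {x} \<times> closed_segment a b"
    then obtain u where u: "0 \<le> u" "u \<le> 1" "snd p = (1 - u) *\<^sub>R a + u *\<^sub>R b" "fst p = x" by (cases p) (auto simp: in_segment)
    then have "p = (1 - u) *\<^sub>R (x, a) + u *\<^sub>R (x, b)" by (cases p) (auto simp: algebra_simps)
    then show "p \<in> closed_segment (x, a) (x, b)" using u(1,2) by (auto simp: in_segment)
  qed
  moreover have "closed_segment a b = {min a b..max a b}" by (simp add: closed_segment_eq_real_ivl min_def max_def)
  ultimately show ?thesis by (simp add: set_eq_iff conj_commute)
qed

lemma axis_segment_coords:
  assumes "axis_parallel a b" "p \<in> closed_segment a b" "q \<in> closed_segment a b"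
  shows "fst p = fst q \<or> snd p = snd q"
  using assms by (cases a; cases b) (auto simp: axis_parallel_def hseg vseg)

section \<open>Local structure of a rectilinear boundary\<close>

locale rectilinear =
  fixes J :: "point set"
  assumes arc: "closed_rectilinear_arc J"
begin

lemma J_facts: "closed J" "bounded J" "open (inside J)" "connected (inside J)" "bounded (inside J)"
  "frontier (inside J) = J" "frontier (outside J) = J" "open (outside J)"
proof -
  obtain g where g: "simple_path g" "pathfinish g = pathstart g" "path_image g = J"
    using arc by (auto simp: closed_rectilinear_arc_def)
  show "closed J" using g closed_simple_path_image by blast
  then show "open (outside J)" by (rule open_outside)
  show "bounded J" using g bounded_simple_path_image by blast
  show "open (inside J)" "connected (inside J)" "bounded (inside J)" "frontier (inside J) = J" "frontier (outside J) = J"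
    using Jordan_plane[OF g(1,2)] g(3) by auto
qed

lemma in_out: "p \<in> inside J \<or> p \<in> outside J \<or> p \<in> J" "p \<in> inside J \<Longrightarrow> p \<notin> outside J" "p \<in> inside J \<Longrightarrow> p \<notin> J" "p \<in> outside J \<Longrightarrow> p \<notin> J"
  subgoal by (metis ComplI UnE inside_Un_outside)
  subgoal by (metis disjoint_iff inside_Int_outside)
  subgoal by (metis disjoint_iff inside_no_overlap)
  subgoal by (metis disjoint_iff outside_no_overlap)
  done

lemma connected_side:
  assumes "connected C" "C \<inter> J = {}" "p \<in> C" "p \<in> inside J"
  shows "C \<subseteq> inside J"
proof -
  have "inside J \<inter> C = {} \<or> outside J \<inter> C = {}"
    using assms(1,2) J_facts in_out by (intro connectedD) auto
  then show ?thesis using assms in_out by blast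
qed

lemma near_J:
  assumes "z \<in> J" "0 < e"
  shows "\<exists>p. dist p z < e \<and> p \<in> inside J" "\<exists>p. dist p z < e \<and> p \<in> outside J"
proof -
  have "z \<in> closure (inside J)" "z \<in> closure (outside J)" using assms J_facts(6,7) by (auto simp: frontier_def)
  then show "\<exists>p. dist p z < e \<and> p \<in> inside J" "\<exists>p. dist p z < e \<and> p \<in> outside J"
    using assms(2) unfolding closure_approachable by blast+
qed

text \<open>A slanted segment meets each axis-parallel one in at most one point, so finitely many of
  these cannot cover it.\<close>

lemma axis_segment:
  assumes "closed_segment a b \<subseteq> J" "a \<noteq> b"
  shows "axis_parallel a b"
proof (rule ccontr)
  assume n: "\<not> axis_parallel a b"
  obtain S where S: "finite S" "\<And>s. s\<in>S \<Longrightarrow> \<exists>a b. axis_parallel a b \<and> s = closed_segment a b" "J = \<Union>S"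
    using arc by (auto simp: closed_rectilinear_arc_def)
  have "finite (closed_segment a b \<inter> s)" if "s \<in> S" for s
  proof -
    have "p = q" if "p \<in> closed_segment a b \<inter> s" "q \<in> closed_segment a b \<inter> s" for p q
    proof -
      have c: "fst p = fst q \<or> snd p = snd q" using S(2)[OF \<open>s \<in> S\<close>] that axis_segment_coords by blast
      have "p \<in> closed_segment a b" "q \<in> closed_segment a b" using that by auto
      then obtain u v where u: "p = (1 - u) *\<^sub>R a + u *\<^sub>R b" and v: "q = (1 - v) *\<^sub>R a + v *\<^sub>R b" unfolding in_segment by blast
      have "fst p - fst q = (u - v) * (fst b - fst a)" "snd p - snd q = (u - v) * (snd b - snd a)"
        by (auto simp: u v algebra_simps)
      then have "u = v" using c n by (auto simp: axis_parallel_def)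
      then show ?thesis by (simp add: u v)
    qed
    then have "\<exists>c. closed_segment a b \<inter> s \<subseteq> {c}" by blast
    then show ?thesis by (meson finite.emptyI finite.insertI finite_subset)
  qed
  then have "finite (\<Union>s\<in>S. closed_segment a b \<inter> s)" using S(1) by blast
  moreover have "closed_segment a b = (\<Union>s\<in>S. closed_segment a b \<inter> s)" using assms(1) S(3) by blast
  ultimately show False using assms(2) by (metis finite_closed_segment)
qed

text \<open>The finitely many segments through \<open>z\<close> lie on the axes through
  \<open>z\<close>, the others keep a positive distance.\<close>

lemma local_box:
  assumes "z \<in> J"
  shows "\<exists>\<epsilon>>0. (\<forall>p\<in>J. \<bar>fst p - fst z\<bar> < \<epsilon> \<and> \<bar>snd p - snd z\<bar> < \<epsilon> \<longrightarrow> fst p = fst z \<or> snd p = snd z) \<and>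
     (\<forall>d\<in>{(1,0), (-1,0), (0,1), (0,-1)}. (\<forall>t. 0 < t \<and> t < \<epsilon> \<longrightarrow> z + t *\<^sub>R d \<in> J) \<or> (\<forall>t. 0 < t \<and> t < \<epsilon> \<longrightarrow> z + t *\<^sub>R d \<notin> J))"
proof -
  obtain S where S: "finite S" "\<And>s. s\<in>S \<Longrightarrow> \<exists>a b. axis_parallel a b \<and> s = closed_segment a b" "J = \<Union>S"
    using arc by (auto simp: closed_rectilinear_arc_def)
  let ?D = "{(1,0), (-1,0), (0,1), (0,-1::real)} :: point set"
  let ?Q = "\<lambda>s d \<epsilon>. (\<forall>t. 0 < t \<and> t < \<epsilon> \<longrightarrow> z + t *\<^sub>R d \<in> s) \<or> (\<forall>t. 0 < t \<and> t < \<epsilon> \<longrightarrow> z + t *\<^sub>R d \<notin> s)"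
  let ?P = "\<lambda>s \<epsilon>. (\<forall>p\<in>s. \<bar>fst p - fst z\<bar> < \<epsilon> \<and> \<bar>snd p - snd z\<bar> < \<epsilon> \<longrightarrow> fst p = fst z \<or> snd p = snd z) \<and> (\<forall>d\<in>?D. ?Q s d \<epsilon>)"
  have "\<exists>\<epsilon>>0. \<forall>s\<in>S. ?P s \<epsilon>"
  proof (rule finite_common_eps[OF S(1)])
    fix s assume "s \<in> S"
    then obtain a b where ab: "axis_parallel a b" "s = closed_segment a b" using S(2) by blast
    show "\<exists>\<epsilon>>0. ?P s \<epsilon>"
    proof (cases "z \<in> s")
      case True
      have "\<exists>\<epsilon>>0. \<forall>d\<in>?D. ?Q s d \<epsilon>"
      proof (rule finite_common_eps)
        show "\<exists>\<epsilon>>0. ?Q s d \<epsilon>" for d using segment_ray True ab(2) by blast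
        show "?Q s d \<epsilon>'" if "?Q s d \<epsilon>" "0 < \<epsilon>'" "\<epsilon>' \<le> \<epsilon>" for d \<epsilon> \<epsilon>' using that by (meson order_less_le_trans)
      qed simp
      moreover have "\<forall>p\<in>s. fst p = fst z \<or> snd p = snd z" using axis_segment_coords[OF ab(1)] ab(2) True by blast
      ultimately show ?thesis by blast
    next
      case False
      have "open (- s)" "z \<in> - s" using False ab(2) by auto
      then obtain e where e: "e > 0" "ball z e \<subseteq> - s" using open_contains_ball by blast
      have nb: "p \<notin> s" if "\<bar>fst p - fst z\<bar> < e/2" "\<bar>snd p - snd z\<bar> < e/2" for p
      proof -
        have "dist z p \<le> dist (fst z) (fst p) + dist (snd z) (snd p)"
          unfolding dist_prod_def by (rule sqrt_sum_squares_le_sum) auto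
        moreover have "dist (fst z) (fst p) < e/2" "dist (snd z) (snd p) < e/2" using that by (auto simp: dist_real_def abs_minus_commute)
        ultimately have "dist z p < e" by linarith
        then show ?thesis using e by auto
      qed
      have "z + t *\<^sub>R d \<notin> s" if "d \<in> ?D" "0 < t" "t < e/2" for d t
        using nb[of "z + t *\<^sub>R d"] that e(1) by auto
      then have "\<forall>d\<in>?D. ?Q s d (e/2)" by blast
      moreover have "\<forall>p\<in>s. \<bar>fst p - fst z\<bar> < e/2 \<and> \<bar>snd p - snd z\<bar> < e/2 \<longrightarrow> fst p = fst z \<or> snd p = snd z"
        using nb by blast
      moreover have "0 < e/2" using e by simp
      ultimately show ?thesis by (intro exI[of _ "e/2"] conjI)
    qed
  next
    fix s \<epsilon> \<epsilon>' assume P: "?P s \<epsilon>" and e: "0 < \<epsilon>'" "\<epsilon>' \<le> (\<epsilon>::real)"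
    have "\<forall>p\<in>s. \<bar>fst p - fst z\<bar> < \<epsilon>' \<and> \<bar>snd p - snd z\<bar> < \<epsilon>' \<longrightarrow> fst p = fst z \<or> snd p = snd z"
      using conjunct1[OF P] e by force
    moreover have "?Q s d \<epsilon>'" if "d \<in> ?D" for d
      using bspec[OF conjunct2[OF P] that] e by (meson order_less_le_trans)
    ultimately show "?P s \<epsilon>'" by blast
  qed
  then obtain \<epsilon> where e: "\<epsilon> > 0" "\<forall>s\<in>S. ?P s \<epsilon>" by blast
  have "?Q J d \<epsilon>" if d: "d \<in> ?D" for d
  proof (cases "\<exists>s\<in>S. \<forall>t. 0 < t \<and> t < \<epsilon> \<longrightarrow> z + t *\<^sub>R d \<in> s")
    case True
    then obtain s where "s \<in> S" "\<forall>t. 0 < t \<and> t < \<epsilon> \<longrightarrow> z + t *\<^sub>R d \<in> s" by blast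
    then have "\<forall>t. 0 < t \<and> t < \<epsilon> \<longrightarrow> z + t *\<^sub>R d \<in> J" using S(3) by auto
    then show ?thesis ..
  next
    case False
    have "z + t *\<^sub>R d \<notin> s" if s: "s \<in> S" and t: "0 < t" "t < \<epsilon>" for s t
    proof -
      have "?Q s d \<epsilon>" using e(2) s d by (meson bspec)
      then show ?thesis using False s t by blast
    qed
    then have "\<forall>t. 0 < t \<and> t < \<epsilon> \<longrightarrow> z + t *\<^sub>R d \<notin> J" using S(3) by auto
    then show ?thesis ..
  qed
  then have "\<forall>d\<in>?D. ?Q J d \<epsilon>" by (intro ballI)
  moreover have "\<forall>p\<in>J. \<bar>fst p - fst z\<bar> < \<epsilon> \<and> \<bar>snd p - snd z\<bar> < \<epsilon> \<longrightarrow> fst p = fst z \<or> snd p = snd z"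
  proof (intro ballI impI)
    fix p assume p: "p \<in> J" "\<bar>fst p - fst z\<bar> < \<epsilon> \<and> \<bar>snd p - snd z\<bar> < \<epsilon>"
    then obtain s where s: "s \<in> S" "p \<in> s" using S(3) by blast
    show "fst p = fst z \<or> snd p = snd z" using bspec[OF conjunct1[OF bspec[OF e(2) s(1)]] s(2)] p(2) by simp
  qed
  ultimately show ?thesis using e(1) by (intro exI[of _ \<epsilon>] conjI)
qed

text \<open>The four open quadrants of a small box around \<open>z\<close> avoid the curve, so each
  lies on one side; \<open>q\<close> records which. A half axis carries a germ exactly if the two
  quadrants beside it differ. Going once around \<open>z\<close>, the number of changes is
  even.\<close>

lemma germ_parity:
  assumes z: "z \<in> J"
  shows "(germ J z (1,0) \<noteq> germ J z (-1,0)) = (germ J z (0,1) \<noteq> germ J z (0,-1))"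
    "germ J z (1,0) \<or> germ J z (-1,0) \<or> germ J z (0,1) \<or> germ J z (0,-1)"
    "\<exists>\<epsilon>>0. \<exists>q. (\<forall>\<sigma>\<in>{1,-1}. \<forall>\<tau>\<in>{1,-1}. \<forall>u v. 0 < u \<and> u < \<epsilon> \<and> 0 < v \<and> v < \<epsilon> \<longrightarrow>
         z + (\<sigma> * u, \<tau> * v) \<in> (if q \<sigma> \<tau> then inside J else outside J)) \<and>
       (\<forall>\<sigma>\<in>{1,-1}. germ J z (\<sigma>, 0) \<longleftrightarrow> q \<sigma> 1 \<noteq> q \<sigma> (-1)) \<and> (\<forall>\<tau>\<in>{1,-1}. germ J z (0, \<tau>) \<longleftrightarrow> q 1 \<tau> \<noteq> q (-1) \<tau>)"
proof -
  let ?D = "{(1,0), (-1,0), (0,1), (0,-1::real)} :: point set"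
  obtain \<epsilon> where e: "\<epsilon> > 0" and cr: "\<forall>p\<in>J. \<bar>fst p - fst z\<bar> < \<epsilon> \<and> \<bar>snd p - snd z\<bar> < \<epsilon> \<longrightarrow> fst p = fst z \<or> snd p = snd z"
    and ray: "\<forall>d\<in>?D. (\<forall>t. 0 < t \<and> t < \<epsilon> \<longrightarrow> z + t *\<^sub>R d \<in> J) \<or> (\<forall>t. 0 < t \<and> t < \<epsilon> \<longrightarrow> z + t *\<^sub>R d \<notin> J)"
    using local_box[OF z] by blast
  have gm: "germ J z d \<longleftrightarrow> (\<forall>t. 0 < t \<and> t < \<epsilon> \<longrightarrow> z + t *\<^sub>R d \<in> J)" "\<not> germ J z d \<longleftrightarrow> (\<forall>t. 0 < t \<and> t < \<epsilon> \<longrightarrow> z + t *\<^sub>R d \<notin> J)" if d: "d \<in> ?D" for d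
  proof -
    have *: "\<not> (\<forall>t. 0 < t \<and> t < \<epsilon> \<longrightarrow> z + t *\<^sub>R d \<notin> J)" if "germ J z d"
    proof -
      obtain e' where e': "e' > 0" "\<forall>t. 0 < t \<and> t < e' \<longrightarrow> z + t *\<^sub>R d \<in> J" using \<open>germ J z d\<close> by (auto simp: germ_def)
      obtain t where "0 < t" "t < e'" "t < \<epsilon>" using e' e field_lbound_gt_zero by metis
      then show ?thesis using e' by blast
    qed
    have **: "germ J z d" if "\<forall>t. 0 < t \<and> t < \<epsilon> \<longrightarrow> z + t *\<^sub>R d \<in> J" using that e by (auto simp: germ_def)
    show "germ J z d \<longleftrightarrow> (\<forall>t. 0 < t \<and> t < \<epsilon> \<longrightarrow> z + t *\<^sub>R d \<in> J)" "\<not> germ J z d \<longleftrightarrow> (\<forall>t. 0 < t \<and> t < \<epsilon> \<longrightarrow> z + t *\<^sub>R d \<notin> J)"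
      using * ** ray d by blast+
  qed
  obtain a b where zab: "z = (a, b)" by (cases z)
  define Bx where "Bx = (\<lambda>u1 u2 v1 v2. {a + u1<..<a + u2} \<times> {b + v1<..<b + v2})"
  have con: "connected (Bx u1 u2 v1 v2)" for u1 u2 v1 v2 unfolding Bx_def by (intro connected_Times) auto
  define q where "q = (\<lambda>\<sigma> \<tau>. (a + \<sigma> * (\<epsilon>/2), b + \<tau> * (\<epsilon>/2)) \<in> inside J)"
  have qd: "(if 0 < \<sigma> then Bx 0 \<epsilon> else Bx (-\<epsilon>) 0) (if 0 < \<tau> then 0 else -\<epsilon>) (if 0 < \<tau> then \<epsilon> else 0) \<subseteq> (if q \<sigma> \<tau> then inside J else outside J)"
    if st: "\<sigma> \<in> {1, -1}" "\<tau> \<in> {1, -1}" for \<sigma> \<tau> :: real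
  proof -
    let ?C = "(if 0 < \<sigma> then Bx 0 \<epsilon> else Bx (-\<epsilon>) 0) (if 0 < \<tau> then 0 else -\<epsilon>) (if 0 < \<tau> then \<epsilon> else 0)"
    have c: "connected ?C" using con by simp
    have d: "?C \<inter> J = {}"
    proof (rule ccontr)
      assume "?C \<inter> J \<noteq> {}"
      then obtain r where r: "r \<in> ?C" "r \<in> J" by blast
      have "fst r \<noteq> a" "snd r \<noteq> b" "\<bar>fst r - a\<bar> < \<epsilon>" "\<bar>snd r - b\<bar> < \<epsilon>"
        using r(1) e by (auto simp: Bx_def abs_less_iff split: if_splits)
      then show False using cr r(2) zab by auto
    qed
    have p: "(a + \<sigma> * (\<epsilon>/2), b + \<tau> * (\<epsilon>/2)) \<in> ?C" using st e by (auto simp: Bx_def)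
    show ?thesis
    proof (cases "q \<sigma> \<tau>")
      case True then show ?thesis using connected_side[OF c d p] by (simp add: q_def)
    next
      case False
      have "r \<in> outside J" if "r \<in> ?C" for r
        using connected_side[OF c d that] in_out(1)[of r] p d that False by (auto simp: q_def)
      then show ?thesis using False by auto
    qed
  qed
  have nearp: "\<exists>r\<in>X. \<bar>fst r - fst m\<bar> < \<delta> \<and> \<bar>snd r - snd m\<bar> < \<delta>" if n: "m \<in> J" "0 < \<delta>" "X = inside J \<or> X = outside J" for m \<delta> X
  proof -
    obtain r where r: "dist r m < \<delta>" "r \<in> X" using near_J[OF n(1,2)] n(3) by blast
    have "dist (fst r) (fst m) < \<delta>" "dist (snd r) (snd m) < \<delta>"
      using r(1) dist_fst_le[of r m] dist_snd_le[of r m] by auto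
    then show ?thesis using r(2) by (auto simp: dist_real_def)
  qed
  have H: "germ J z (\<sigma>, 0) \<longleftrightarrow> q \<sigma> 1 \<noteq> q \<sigma> (-1)" if s: "\<sigma> \<in> {1, -1}" for \<sigma> :: real
  proof -
    have sD: "(\<sigma>, 0) \<in> ?D" using s by auto
    show ?thesis
    proof (cases "germ J z (\<sigma>, 0)")
      case True
      let ?m = "(a + \<sigma> * (\<epsilon>/2), b)"
      have on: "(a + \<sigma> * t, b) \<in> J" if "0 < t" "t < \<epsilon>" for t
        using gm(1)[OF sD] True that by (auto simp: zab mult.commute)
      have m: "?m \<in> J" using on[of "\<epsilon>/2"] e by simp
      \<comment> \<open>Points of both sides accumulate at \<open>?m\<close>. The ray itself belongs
        to the curve, so they come from the two quadrants beside it.\<close>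
      have "q \<sigma> 1 \<noteq> q \<sigma> (-1)"
      proof
        assume eq: "q \<sigma> 1 = q \<sigma> (-1)"
        let ?X = "if q \<sigma> 1 then outside J else inside J"
        have X: "?X = inside J \<or> ?X = outside J" by simp
        have "0 < \<epsilon>/2" using e by simp
        from nearp[OF m this X] obtain r where r: "r \<in> ?X" "\<bar>fst r - fst ?m\<bar> < \<epsilon>/2" "\<bar>snd r - snd ?m\<bar> < \<epsilon>/2" by blast
        have nJ: "r \<notin> J" using r(1) in_out by (auto split: if_splits)
        define t where "t = \<sigma> * (fst r - a)"
        have "- (\<epsilon>/2) < fst r - (a + \<sigma> * (\<epsilon>/2))" "fst r - (a + \<sigma> * (\<epsilon>/2)) < \<epsilon>/2"
          using r(2) unfolding fst_conv by linarith+
        then have t: "0 < t" "t < \<epsilon>" "fst r = a + \<sigma> * t" using s by (auto simp: t_def)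
        have "snd r \<noteq> b" using on[OF t(1,2)] nJ t(3) by (metis prod.collapse)
        then have "r \<in> (if 0 < \<sigma> then Bx 0 \<epsilon> else Bx (-\<epsilon>) 0) 0 \<epsilon> \<or> r \<in> (if 0 < \<sigma> then Bx 0 \<epsilon> else Bx (-\<epsilon>) 0) (-\<epsilon>) 0"
          using t s r(3) e by (cases r) (auto simp: Bx_def abs_less_iff)
        then have "r \<in> (if q \<sigma> 1 then inside J else outside J)" using qd[of \<sigma> 1] qd[of \<sigma> "-1"] s eq by auto
        then show False using r(1) in_out(2)[of r] by (auto split: if_splits)
      qed
      then show ?thesis using True by simp
    next
      case False
      \<comment> \<open>Without the germ the two quadrants and the ray between them form one
        connected box off the curve.\<close>
      let ?C = "(if 0 < \<sigma> then Bx 0 \<epsilon> else Bx (-\<epsilon>) 0) (-\<epsilon>) \<epsilon>"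
      have d: "?C \<inter> J = {}"
      proof -
        have False if r: "r \<in> ?C" "r \<in> J" for r
        proof -
          have "fst r \<noteq> a" "\<bar>fst r - a\<bar> < \<epsilon>" "\<bar>snd r - b\<bar> < \<epsilon>"
            using r(1) e by (auto simp: Bx_def abs_less_iff split: if_splits)
          then have sr: "snd r = b" using cr r(2) zab by auto
          define t where "t = \<sigma> * (fst r - a)"
          have "0 < t" "t < \<epsilon>" "r = z + t *\<^sub>R (\<sigma>, 0)" using r(1) s sr by (cases r; auto simp: t_def Bx_def zab)+
          then show False using gm(2)[OF sD] False r(2) by auto
        qed
        then show ?thesis by blast
      qed
      have c: "connected ?C" using con by simp
      have "(a + \<sigma> * (\<epsilon>/2), b + \<tau> * (\<epsilon>/2)) \<in> ?C" if "\<tau> \<in> {1,-1}" for \<tau> using that s e by (auto simp: Bx_def)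
      from this[of 1] this[of "-1"] have "q \<sigma> 1 = q \<sigma> (-1)"
        using connected_side[OF c d, of "(a + \<sigma> * (\<epsilon>/2), b + 1 * (\<epsilon>/2))"] connected_side[OF c d, of "(a + \<sigma> * (\<epsilon>/2), b + (-1) * (\<epsilon>/2))"]
        unfolding q_def by blast
      then show ?thesis using False by simp
    qed
  qed
  have V: "germ J z (0, \<tau>) \<longleftrightarrow> q 1 \<tau> \<noteq> q (-1) \<tau>" if s: "\<tau> \<in> {1, -1}" for \<tau> :: real
  proof -
    have sD: "(0, \<tau>) \<in> ?D" using s by auto
    let ?v1 = "if 0 < \<tau> then 0 else -\<epsilon>" and ?v2 = "if 0 < \<tau> then \<epsilon> else 0"
    show ?thesis
    proof (cases "germ J z (0, \<tau>)")
      case True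
      let ?m = "(a, b + \<tau> * (\<epsilon>/2))"
      have on: "(a, b + \<tau> * t) \<in> J" if "0 < t" "t < \<epsilon>" for t
        using gm(1)[OF sD] True that by (auto simp: zab mult.commute)
      have m: "?m \<in> J" using on[of "\<epsilon>/2"] e by simp
      have "q 1 \<tau> \<noteq> q (-1) \<tau>"
      proof
        assume eq: "q 1 \<tau> = q (-1) \<tau>"
        let ?X = "if q 1 \<tau> then outside J else inside J"
        have X: "?X = inside J \<or> ?X = outside J" by simp
        have "0 < \<epsilon>/2" using e by simp
        from nearp[OF m this X] obtain r where r: "r \<in> ?X" "\<bar>fst r - fst ?m\<bar> < \<epsilon>/2" "\<bar>snd r - snd ?m\<bar> < \<epsilon>/2" by blast
        have nJ: "r \<notin> J" using r(1) in_out by (auto split: if_splits)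
        define t where "t = \<tau> * (snd r - b)"
        have "- (\<epsilon>/2) < snd r - (b + \<tau> * (\<epsilon>/2))" "snd r - (b + \<tau> * (\<epsilon>/2)) < \<epsilon>/2"
          using r(3) unfolding snd_conv by linarith+
        then have t: "0 < t" "t < \<epsilon>" "snd r = b + \<tau> * t" using s by (auto simp: t_def)
        have "fst r \<noteq> a" using on[OF t(1,2)] nJ t(3) by (metis prod.collapse)
        then have "r \<in> Bx 0 \<epsilon> ?v1 ?v2 \<or> r \<in> Bx (-\<epsilon>) 0 ?v1 ?v2"
          using t s r(2) e by (cases r) (auto simp: Bx_def abs_less_iff)
        then have "r \<in> (if q 1 \<tau> then inside J else outside J)" using qd[of 1 \<tau>] qd[of "-1" \<tau>] s eq by auto
        then show False using r(1) in_out(2)[of r] by (auto split: if_splits)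
      qed
      then show ?thesis using True by simp
    next
      case False
      let ?C = "Bx (-\<epsilon>) \<epsilon> ?v1 ?v2"
      have d: "?C \<inter> J = {}"
      proof -
        have False if r: "r \<in> ?C" "r \<in> J" for r
        proof -
          have "snd r \<noteq> b" "\<bar>fst r - a\<bar> < \<epsilon>" "\<bar>snd r - b\<bar> < \<epsilon>"
            using r(1) e by (auto simp: Bx_def abs_less_iff split: if_splits)
          then have sr: "fst r = a" using cr r(2) zab by auto
          define t where "t = \<tau> * (snd r - b)"
          have "0 < t" "t < \<epsilon>" "r = z + t *\<^sub>R (0, \<tau>)" using r(1) s sr by (cases r; auto simp: t_def Bx_def zab)+
          then show False using gm(2)[OF sD] False r(2) by auto
        qed
        then show ?thesis by blast
      qed
      have c: "connected ?C" using con by simp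
      have "(a + \<sigma> * (\<epsilon>/2), b + \<tau> * (\<epsilon>/2)) \<in> ?C" if "\<sigma> \<in> {1,-1}" for \<sigma> using that s e by (auto simp: Bx_def)
      from this[of 1] this[of "-1"] have "q 1 \<tau> = q (-1) \<tau>"
        using connected_side[OF c d, of "(a + 1 * (\<epsilon>/2), b + \<tau> * (\<epsilon>/2))"] connected_side[OF c d, of "(a + (-1) * (\<epsilon>/2), b + \<tau> * (\<epsilon>/2))"]
        unfolding q_def by blast
      then show ?thesis using False by simp
    qed
  qed
  have QQ: "z + (\<sigma> * u, \<tau> * v) \<in> (if q \<sigma> \<tau> then inside J else outside J)"
    if "\<sigma> \<in> {1,-1}" "\<tau> \<in> {1,-1}" "0 < u" "u < \<epsilon>" "0 < v" "v < \<epsilon>" for \<sigma> \<tau> u v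
  proof -
    have "z + (\<sigma> * u, \<tau> * v) \<in> (if 0 < \<sigma> then Bx 0 \<epsilon> else Bx (-\<epsilon>) 0) (if 0 < \<tau> then 0 else -\<epsilon>) (if 0 < \<tau> then \<epsilon> else 0)"
      using that by (auto simp: zab Bx_def)
    then show ?thesis using qd[OF that(1,2)] by blast
  qed
  then show "\<exists>\<epsilon>>0. \<exists>q. (\<forall>\<sigma>\<in>{1,-1}. \<forall>\<tau>\<in>{1,-1}. \<forall>u v. 0 < u \<and> u < \<epsilon> \<and> 0 < v \<and> v < \<epsilon> \<longrightarrow>
         z + (\<sigma> * u, \<tau> * v) \<in> (if q \<sigma> \<tau> then inside J else outside J)) \<and>
       (\<forall>\<sigma>\<in>{1,-1}. germ J z (\<sigma>, 0) \<longleftrightarrow> q \<sigma> 1 \<noteq> q \<sigma> (-1)) \<and> (\<forall>\<tau>\<in>{1,-1}. germ J z (0, \<tau>) \<longleftrightarrow> q 1 \<tau> \<noteq> q (-1) \<tau>)"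
    using H V e by (intro exI[of _ \<epsilon>] conjI exI[of _ q]) blast+
  show "(germ J z (1,0) \<noteq> germ J z (-1,0)) = (germ J z (0,1) \<noteq> germ J z (0,-1))"
    using H[of 1] H[of "-1"] V[of 1] V[of "-1"] by auto
  show "germ J z (1,0) \<or> germ J z (-1,0) \<or> germ J z (0,1) \<or> germ J z (0,-1)"
  proof (rule ccontr)
    \<comment> \<open>All quadrants and half axes near \<open>z\<close> would lie on one side,
      whereas \<open>z\<close> is a limit of points of the other side.\<close>
    assume n: "\<not> ?thesis"
    then have qs: "q \<sigma> \<tau> = q 1 1" if "\<sigma> \<in> {1,-1}" "\<tau> \<in> {1,-1}" for \<sigma> \<tau>
      using H[of 1] H[of "-1"] V[of 1] V[of "-1"] that by auto
    let ?X = "if q 1 1 then outside J else inside J"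
    have X: "?X = inside J \<or> ?X = outside J" by simp
    from nearp[OF z e X] obtain r where r: "r \<in> ?X" "\<bar>fst r - a\<bar> < \<epsilon>" "\<bar>snd r - b\<bar> < \<epsilon>" unfolding zab by auto
    have rz: "r \<noteq> z" using r(1) z in_out(3)[of z] in_out(4)[of z] by (auto split: if_splits)
    define C where "C = (\<lambda>d::point. {z + t *\<^sub>R d | t. 0 < t \<and> t < \<epsilon>})"
    have ax: "z + t *\<^sub>R d \<in> (if q 1 1 then inside J else outside J)" if d: "d \<in> ?D" and t: "0 < t" "t < \<epsilon>" for d t
    proof -
      let ?p = "z + t *\<^sub>R d"
      have nJ: "?p \<notin> J" using gm(2)[OF d] n d t by auto
      then have "?p \<in> inside J \<or> ?p \<in> outside J" using in_out(1) by blast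
      moreover obtain \<delta> where dl: "\<delta> > 0" "ball ?p \<delta> \<subseteq> - J" using nJ J_facts(1) open_contains_ball[of "- J"] by blast
      obtain k where k: "0 < k" "k < \<delta>" "k < \<epsilon>" using dl(1) e by (metis field_lbound_gt_zero)
      \<comment> \<open>A point of a half axis inherits its side from an adjacent quadrant through a
        small ball off the curve.\<close>
      define r' where "r' = ?p + (if fst d = 0 then (k, 0) else (0, k))"
      have r'b: "r' \<in> ball ?p \<delta>" using k by (auto simp: r'_def dist_norm)
      have "r' \<in> (if q 1 1 then inside J else outside J)"
      proof -
        have "\<exists>\<sigma> \<tau> u v. \<sigma>\<in>{1,-1} \<and> \<tau>\<in>{1,-1} \<and> 0 < u \<and> u < \<epsilon> \<and> 0 < v \<and> v < \<epsilon> \<and> r' = z + (\<sigma> * u, \<tau> * v)"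
        proof (cases "fst d = 0")
          case True
          then show ?thesis using d t k
            by (intro exI[of _ 1] exI[of _ "snd d"] exI[of _ k] exI[of _ t]) (auto simp: r'_def)
        next
          case False
          then show ?thesis using d t k
            by (intro exI[of _ "fst d"] exI[of _ 1] exI[of _ t] exI[of _ k]) (auto simp: r'_def)
        qed
        then obtain \<sigma> \<tau> u v where st: "\<sigma>\<in>{1,-1}" "\<tau>\<in>{1,-1}" "0 < u" "u < \<epsilon>" "0 < v" "v < \<epsilon>" "r' = z + (\<sigma> * u, \<tau> * v)" by blast
        then show ?thesis using QQ[OF st(1-6)] qs[OF st(1,2)] by simp
      qed
      moreover have "ball ?p \<delta> \<inter> J = {}" using dl by auto
      moreover have "?p \<in> ball ?p \<delta>" using dl(1) by simp
      ultimately show ?thesis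
        using connected_side[of "ball ?p \<delta>" r'] connected_side[of "ball ?p \<delta>" ?p] r'b in_out(2)[of r'] connected_ball[of ?p \<delta>]
        by (smt (verit, best) subsetD)
    qed
    have "r \<in> (if q 1 1 then inside J else outside J)"
    proof (cases "fst r = a \<or> snd r = b")
      case True
      then consider "r = z + (fst r - a) *\<^sub>R (1,0)" "0 < fst r - a" | "r = z + (a - fst r) *\<^sub>R (-1,0)" "0 < a - fst r"
        | "r = z + (snd r - b) *\<^sub>R (0,1)" "0 < snd r - b" | "r = z + (b - snd r) *\<^sub>R (0,-1)" "0 < b - snd r"
        using rz zab by (cases r) fastforce
      then show ?thesis
      proof cases
        case 1 then show ?thesis using ax[of "(1,0)" "fst r - a"] r by auto
      next
        case 2 then show ?thesis using ax[of "(-1,0)" "a - fst r"] r by auto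
      next
        case 3 then show ?thesis using ax[of "(0,1)" "snd r - b"] r by auto
      next
        case 4 then show ?thesis using ax[of "(0,-1)" "b - snd r"] r by auto
      qed
    next
      case False
      have st: "sgn (fst r - a) \<in> {1,-1}" "sgn (snd r - b) \<in> {1,-1}" using False by (auto simp: sgn_if)
      have "r = z + (sgn (fst r - a) * \<bar>fst r - a\<bar>, sgn (snd r - b) * \<bar>snd r - b\<bar>)"
        by (cases r) (simp add: zab sgn_mult_abs)
      then show ?thesis using QQ[OF st, of "\<bar>fst r - a\<bar>" "\<bar>snd r - b\<bar>"] qs[OF st] r(2,3) False by simp
    qed
    then show False using r(1) in_out(2)[of r] by (auto split: if_splits)
  qed
qed

end

abbreviation dirs :: "point set" where
  "dirs \<equiv> {(1,0), (-1,0), (0,1), (0,-1)}"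

definition heading :: "point \<Rightarrow> point \<Rightarrow> point" where
  "heading a b = (sgn (fst b - fst a), sgn (snd b - snd a))"

lemma heading_commute: "heading b a = - heading a b"
  by (auto simp: heading_def sgn_if)

lemma heading_param:
  assumes "axis_parallel a b" "a \<noteq> b"
  obtains l where "0 < l" "b = a + l *\<^sub>R heading a b" "heading a b \<in> dirs"
proof
  let ?l = "\<bar>fst b - fst a\<bar> + \<bar>snd b - snd a\<bar>"
  show "0 < ?l" using assms(2) by (cases a; cases b) (auto simp: add_pos_nonneg add_nonneg_pos)
  show "b = a + ?l *\<^sub>R heading a b" "heading a b \<in> dirs"
    using assms by (cases a; cases b; auto simp: axis_parallel_def heading_def sgn_if)+
qed

lemma segment_points:
  fixes a d :: point
  assumes "0 \<le> t" "t \<le> l"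
  shows "a + t *\<^sub>R d \<in> closed_segment a (a + l *\<^sub>R d)"
proof (cases "l = 0")
  case False
  then have "a + t *\<^sub>R d = (1 - t / l) *\<^sub>R a + (t / l) *\<^sub>R (a + l *\<^sub>R d)" "0 \<le> t / l" "t / l \<le> 1"
    using assms by (auto simp: algebra_simps)
  then show ?thesis unfolding in_segment by blast
qed (use assms in auto)

lemma segment_pointsE:
  fixes a d :: point
  assumes "p \<in> closed_segment a (a + l *\<^sub>R d)" "0 \<le> l"
  obtains t where "0 \<le> t" "t \<le> l" "p = a + t *\<^sub>R d"
proof -
  obtain u where u: "0 \<le> u" "u \<le> 1" "p = (1 - u) *\<^sub>R a + u *\<^sub>R (a + l *\<^sub>R d)" using assms unfolding in_segment by blast
  then have "p = a + (u * l) *\<^sub>R d" by (simp add: algebra_simps)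
  then show ?thesis using that[of "u * l"] u assms(2) by (simp add: mult_left_le_one_le)
qed

lemma is_edge_commute: "is_edge J a b \<longleftrightarrow> is_edge J b a"
  by (auto simp: is_edge_def closed_segment_commute)

section \<open>Edges as maximal segments\<close>

context rectilinear
begin

lemma edge_axis: "is_edge J a b \<Longrightarrow> axis_parallel a b"
  using axis_segment by (auto simp: is_edge_def)

lemma edge_param:
  assumes "is_edge J a b"
  obtains l where "0 < l" "b = a + l *\<^sub>R heading a b" "heading a b \<in> dirs"
  using heading_param[OF edge_axis[OF assms]] assms by (auto simp: is_edge_def)

text \<open>Maximality: a germ backwards at the start would prolong the edge.\<close>

lemma edge_germ:
  assumes e: "is_edge J a b"
  shows "germ J a (heading a b)" "\<not> germ J a (- heading a b)"
proof -
  obtain l where l: "0 < l" "b = a + l *\<^sub>R heading a b" "heading a b \<in> dirs" using edge_param[OF e] .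
  define d where "d = heading a b"
  have sub: "closed_segment a b \<subseteq> J" and mx: "\<And>c e. closed_segment a b \<subseteq> closed_segment c e \<Longrightarrow> closed_segment c e \<subseteq> J \<Longrightarrow> closed_segment c e = closed_segment a b"
    using e unfolding is_edge_def by blast+
  have d0: "d \<noteq> 0" using l(3) by (auto simp: d_def zero_prod_def)
  show "germ J a (heading a b)"
    unfolding germ_def using l sub segment_points[of _ l a "heading a b"] by (intro exI[of _ l]) force
  show "\<not> germ J a (- heading a b)"
  proof
    assume "germ J a (- heading a b)"
    then obtain \<epsilon> where ep: "\<epsilon> > 0" "\<And>t. 0 < t \<Longrightarrow> t < \<epsilon> \<Longrightarrow> a + t *\<^sub>R (- d) \<in> J" by (auto simp: germ_def d_def)
    define c where "c = a + (\<epsilon>/2) *\<^sub>R (- d)"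
    have aJ: "a \<in> J" using sub by auto
    have "a = c + (\<epsilon>/2) *\<^sub>R d" "b = c + (\<epsilon>/2 + l) *\<^sub>R d" using l by (auto simp: c_def d_def algebra_simps)
    then have ac: "a \<in> closed_segment c b" using segment_points[of "\<epsilon>/2" "\<epsilon>/2 + l" c d] ep l by simp
    have "closed_segment a c \<subseteq> J"
    proof
      fix p assume "p \<in> closed_segment a c"
      then obtain t where t: "0 \<le> t" "t \<le> \<epsilon>/2" "p = a + t *\<^sub>R (- d)" using segment_pointsE[of p a "\<epsilon>/2" "- d"] ep unfolding c_def by auto
      then show "p \<in> J" using ep aJ by (cases "t = 0") auto
    qed
    then have "closed_segment c b \<subseteq> J" using Un_closed_segment[OF ac] sub by (auto simp: closed_segment_commute)
    moreover have "closed_segment a b \<subseteq> closed_segment c b" using ac by (simp add: subset_closed_segment)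
    ultimately have "c \<in> closed_segment a b" using mx by (metis ends_in_segment(1))
    then obtain t where t: "0 \<le> t" "c = a + t *\<^sub>R d" using segment_pointsE[of c a l d] l by (auto simp: d_def)
    then have "(t + \<epsilon>/2) *\<^sub>R d = 0" by (simp add: c_def algebra_simps)
    then show False using d0 t ep by simp
  qed
qed

lemma edge_unique:
  assumes e: "is_edge J a b" "is_edge J a c" "heading a b = heading a c"
  shows "b = c"
proof -
  obtain l where l: "0 < l" "b = a + l *\<^sub>R heading a b" using edge_param[OF e(1)] .
  obtain l' where l': "0 < l'" "c = a + l' *\<^sub>R heading a b" using edge_param[OF e(2)] e(3) by metis
  have *: "b = c" if "is_edge J a b" "is_edge J a c" "b \<in> closed_segment a c" for b c
  proof -
    have "closed_segment a b \<subseteq> closed_segment a c" using that(3) by (simp add: subset_closed_segment)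
    then have "closed_segment a c = closed_segment a b" using that(1,2) unfolding is_edge_def by blast
    then have "{a, c} = {a, b}" by (simp add: closed_segment_eq)
    then show ?thesis using that by (auto simp: doubleton_eq_iff)
  qed
  show ?thesis
  proof (cases "l \<le> l'")
    case True
    then have "b \<in> closed_segment a c" using segment_points[of l l' a "heading a b"] l l' by simp
    then show ?thesis using * e by blast
  next
    case False
    then have "c \<in> closed_segment a b" using segment_points[of l' l a "heading a b"] l l' by simp
    then show ?thesis using * e by blast
  qed
qed

lemma germ_interior:
  assumes "z + s *\<^sub>R d \<in> J" "0 < s" "closed_segment z (z + s *\<^sub>R d) \<subseteq> J"
  shows "germ J z d"
  unfolding germ_def using assms(2,3) segment_points[of _ s z d] by (intro exI[of _ s]) force

lemma edge_interior_germ: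
  assumes e: "is_edge J a b" and z: "z \<in> closed_segment a b" "z \<noteq> a" "z \<noteq> b"
  shows "germ J z (heading a b)" "germ J z (- heading a b)"
proof -
  obtain l where l: "0 < l" "b = a + l *\<^sub>R heading a b" "heading a b \<in> dirs" using edge_param[OF e] .
  define d where "d = heading a b"
  have sub: "closed_segment a b \<subseteq> J" using e by (auto simp: is_edge_def)
  obtain t where t: "0 \<le> t" "t \<le> l" "z = a + t *\<^sub>R d" using segment_pointsE[of z a l d] z(1) l by (auto simp: d_def)
  have t': "0 < t" "t < l" using t z l by (auto simp: d_def le_less)
  have eq: "z + (l - t) *\<^sub>R d = b" "z + t *\<^sub>R (- d) = a" using t l by (auto simp: d_def algebra_simps)
  have "closed_segment z b \<subseteq> J" "closed_segment z a \<subseteq> J"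
    using z(1) sub by (meson subset_closed_segment ends_in_segment order_trans)+
  then show "germ J z (heading a b)" "germ J z (- heading a b)"
    using germ_interior[of z "l - t" d, unfolded eq(1)] germ_interior[of z t "- d", unfolded eq(2)] t' ends_in_segment(2)
    by (auto simp: d_def)
qed

text \<open>Both germs along the edge exist, so each separates differing quadrants. The germ along
  \<open>n\<close> is excluded by the inside points there, the opposite one by parity. Hence the two
  quadrants on the far side are outside, and so is the ray between them.\<close>

lemma two_sided:
  assumes e: "is_edge J a b" and z: "z \<in> open_segment a b"
    and n: "n = (snd b - snd a, - (fst b - fst a))"
    and i: "\<epsilon> > 0" "\<And>t. 0 < t \<Longrightarrow> t < \<epsilon> \<Longrightarrow> z + t *\<^sub>R n \<in> inside J"
  shows "\<exists>\<delta>>0. \<forall>t. 0 < t \<and> t < \<delta> \<longrightarrow> z - t *\<^sub>R n \<in> outside J"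
proof -
  have zab: "z \<in> closed_segment a b" "z \<noteq> a" "z \<noteq> b" using z by (auto simp: open_segment_def)
  have zJ: "z \<in> J" using zab e by (auto simp: is_edge_def)
  note gi = edge_interior_germ[OF e zab]
  obtain l where l: "0 < l" "b = a + l *\<^sub>R heading a b" "heading a b \<in> dirs" using edge_param[OF e] .
  define d where "d = heading a b"
  define m where "m = (snd d, - fst d)"
  have nm: "n = l *\<^sub>R m"
  proof -
    have "fst b - fst a = l * fst d" "snd b - snd a = l * snd d" using arg_cong[OF l(2), of fst] arg_cong[OF l(2), of snd] by (auto simp: d_def)
    then show ?thesis by (simp add: n m_def)
  qed
  obtain \<eta> q where h: "\<eta> > 0" and Q: "\<And>\<sigma> \<tau> u v. \<sigma>\<in>{1,-1} \<Longrightarrow> \<tau>\<in>{1,-1} \<Longrightarrow> 0 < u \<Longrightarrow> u < \<eta> \<Longrightarrow> 0 < v \<Longrightarrow> v < \<eta> \<Longrightarrow>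
         z + (\<sigma> * u, \<tau> * v) \<in> (if q \<sigma> \<tau> then inside J else outside J)"
    and QH: "\<And>\<sigma>. \<sigma>\<in>{1,-1} \<Longrightarrow> germ J z (\<sigma>, 0) \<longleftrightarrow> q \<sigma> 1 \<noteq> q \<sigma> (-1)" and QV: "\<And>\<tau>. \<tau>\<in>{1,-1} \<Longrightarrow> germ J z (0, \<tau>) \<longleftrightarrow> q 1 \<tau> \<noteq> q (-1) \<tau>"
  proof -
    from germ_parity(3)[OF zJ] obtain \<eta> q where "\<eta> > 0"
      "\<forall>\<sigma>\<in>{1,-1}. \<forall>\<tau>\<in>{1,-1}. \<forall>u v. 0 < u \<and> u < \<eta> \<and> 0 < v \<and> v < \<eta> \<longrightarrow>
         z + (\<sigma> * u, \<tau> * v) \<in> (if q \<sigma> \<tau> then inside J else outside J)"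
      "\<forall>\<sigma>\<in>{1,-1}. germ J z (\<sigma>, 0) \<longleftrightarrow> q \<sigma> 1 \<noteq> q \<sigma> (-1)" "\<forall>\<tau>\<in>{1,-1}. germ J z (0, \<tau>) \<longleftrightarrow> q 1 \<tau> \<noteq> q (-1) \<tau>"
      by (elim exE conjE)
    then show ?thesis by (intro that[of \<eta> q]) (assumption | blast)+
  qed
  have im: "z + t *\<^sub>R m \<in> inside J" if "0 < t" "t < \<epsilon> * l" for t
    using i(2)[of "t / l"] that l(1) by (simp add: nm field_simps)
  have gm: "\<not> germ J z m"
  proof
    assume "germ J z m"
    then obtain e' where e': "e' > 0" "\<And>t. 0 < t \<Longrightarrow> t < e' \<Longrightarrow> z + t *\<^sub>R m \<in> J" by (auto simp: germ_def)
    obtain t where "0 < t" "t < e'" "t < \<epsilon> * l" using e'(1) i(1) l(1) field_lbound_gt_zero[of e' "\<epsilon> * l"] by auto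
    then show False using e'(2) im in_out(3) by blast
  qed
  have gg: "germ J z d" "germ J z (- d)" using gi by (auto simp: d_def)
  have gm': "\<not> germ J z (- m)"
    using germ_parity(1)[OF zJ] gg gm l(3) unfolding d_def[symmetric] m_def by auto
  obtain t0 where t0: "0 < t0" "t0 < \<epsilon> * l" "t0 < \<eta>" using h i(1) l(1) field_lbound_gt_zero[of \<eta> "\<epsilon> * l"] by auto
  have "z + t0 *\<^sub>R m \<in> inside J" using im t0 by auto
  then obtain \<rho> where rho: "\<rho> > 0" "ball (z + t0 *\<^sub>R m) \<rho> \<subseteq> inside J" using J_facts(3) open_contains_ball by blast
  obtain k where k: "0 < k" "k < \<rho>" "k < \<eta>" using rho(1) h field_lbound_gt_zero by metis
  \<comment> \<open>A small shift along the edge takes an inside point of the normal ray into a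
    quadrant and so determines \<open>q\<close> there.\<close>
  have "z + (t0 *\<^sub>R m + k *\<^sub>R d) \<in> inside J"
  proof -
    have "norm d = 1" using l(3) by (auto simp: d_def norm_Pair)
    then have "dist (z + t0 *\<^sub>R m) (z + (t0 *\<^sub>R m + k *\<^sub>R d)) < \<rho>" using k by (simp add: dist_norm)
    then show ?thesis using rho by auto
  qed
  then have qT: "q (fst (m + d)) (snd (m + d))"
    using Q[of "fst (m + d)" "snd (m + d)" "if fst d = 0 then t0 else k" "if fst d = 0 then k else t0"] t0 k l(3) in_out(2)[of "z + (t0 *\<^sub>R m + k *\<^sub>R d)"]
    unfolding d_def[symmetric] m_def by (auto split: if_splits)
  have qF: "\<not> q (fst (d - m)) (snd (d - m))" "\<not> q (fst (- d - m)) (snd (- d - m))"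
    using qT QH[of 1] QH[of "-1"] QV[of 1] QV[of "-1"] gg gm gm' l(3) unfolding d_def[symmetric] m_def by auto
  have out: "z - t *\<^sub>R m \<in> outside J" if t: "0 < t" "t < \<eta>'" and e': "\<And>t. 0 < t \<Longrightarrow> t < \<eta>' \<Longrightarrow> z - t *\<^sub>R m \<notin> J" "\<eta>' \<le> \<eta>" for t \<eta>'
  proof (rule ccontr)
    assume "z - t *\<^sub>R m \<notin> outside J"
    then have "z - t *\<^sub>R m \<in> inside J" using in_out(1) e' t by blast
    then obtain \<rho> where rho: "\<rho> > 0" "ball (z - t *\<^sub>R m) \<rho> \<subseteq> inside J" using J_facts(3) open_contains_ball by blast
    obtain k where k: "0 < k" "k < \<rho>" "k < \<eta>" using rho(1) h field_lbound_gt_zero by metis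
    have "norm d = 1" using l(3) by (auto simp: d_def norm_Pair)
    then have "dist (z - t *\<^sub>R m) (z + (k *\<^sub>R d - t *\<^sub>R m)) < \<rho>" using k by (simp add: dist_norm)
    then have "z + (k *\<^sub>R d - t *\<^sub>R m) \<in> inside J" using rho by auto
    then show False
      using Q[of "fst (d - m)" "snd (d - m)" "if fst d = 0 then t else k" "if fst d = 0 then k else t"] t e'(2) k l(3) in_out(2)[of "z + (k *\<^sub>R d - t *\<^sub>R m)"] qF(1)
      unfolding d_def[symmetric] m_def by (auto split: if_splits)
  qed
  have "\<exists>\<eta>'>0. \<forall>t. 0 < t \<and> t < \<eta>' \<longrightarrow> z - t *\<^sub>R m \<notin> J"
  proof -
    have "- m \<in> dirs" using l(3) unfolding d_def[symmetric] m_def by auto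
    then obtain e' where e': "e' > 0" "(\<forall>t. 0 < t \<and> t < e' \<longrightarrow> z + t *\<^sub>R (- m) \<in> J) \<or> (\<forall>t. 0 < t \<and> t < e' \<longrightarrow> z + t *\<^sub>R (- m) \<notin> J)"
      using local_box[OF zJ] by blast
    then have "\<forall>t. 0 < t \<and> t < e' \<longrightarrow> z + t *\<^sub>R (- m) \<notin> J" using gm' unfolding germ_def by blast
    then show ?thesis using e'(1) by auto
  qed
  then obtain \<eta>' where e': "\<eta>' > 0" "\<forall>t. 0 < t \<and> t < \<eta>' \<longrightarrow> z - t *\<^sub>R m \<notin> J" by blast
  define \<delta> where "\<delta> = min \<eta> \<eta>' / l"
  have "z - t *\<^sub>R n \<in> outside J" if "0 < t" "t < \<delta>" for t
  proof -
    have "0 < t * l" "t * l < min \<eta> \<eta>'" using that l(1) by (auto simp: \<delta>_def field_simps)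
    then show ?thesis using out[of "t * l" "min \<eta> \<eta>'"] e'(2) by (auto simp: nm)
  qed
  moreover have "\<delta> > 0" using h e'(1) l(1) by (simp add: \<delta>_def)
  ultimately show ?thesis by blast
qed

text \<open>Otherwise the inside would lie on both sides of the midpoint, against
  \<open>two_sided\<close>.\<close>

lemma cw_edge_asym: "cw_edge J a b \<Longrightarrow> \<not> cw_edge J b a"
proof
  assume ab: "cw_edge J a b" and ba: "cw_edge J b a"
  let ?z = "midpoint a b" and ?n = "(snd b - snd a, - (fst b - fst a))"
  have e: "is_edge J a b" using ab by (simp add: cw_edge_def)
  have z: "?z \<in> open_segment a b" using e by (simp add: midpoint_in_open_segment is_edge_def)
  obtain e1 where e1: "e1 > 0" "\<And>t. 0 < t \<Longrightarrow> t < e1 \<Longrightarrow> ?z + t *\<^sub>R ?n \<in> inside J"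
    using ab z unfolding cw_edge_def interior_on_def by blast
  obtain e2 where e2: "e2 > 0" "\<And>t. 0 < t \<Longrightarrow> t < e2 \<Longrightarrow> ?z + t *\<^sub>R (snd a - snd b, - (fst a - fst b)) \<in> inside J"
    using ba z unfolding cw_edge_def interior_on_def by (metis open_segment_commute)
  obtain e3 where e3: "e3 > 0" "\<forall>t. 0 < t \<and> t < e3 \<longrightarrow> ?z - t *\<^sub>R ?n \<in> outside J"
    using two_sided[OF e z refl e1] by blast
  obtain t where t: "0 < t" "t < e2" "t < e3" using e2(1) e3(1) field_lbound_gt_zero by metis
  have "?z + t *\<^sub>R (snd a - snd b, - (fst a - fst b)) = ?z - t *\<^sub>R ?n" by (simp add: prod_eq_iff algebra_simps)
  then show False using e2(2)[OF t(1,2)] e3(2) t in_out(2) by metis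
qed


text \<open>The supremum of the admissible lengths is attained because the curve is closed, and a
  germ at the point reached would exceed it.\<close>

lemma ray_extent:
  assumes z: "z \<in> J" and d: "norm d = 1"
  obtains s where "0 \<le> s" "\<And>u. 0 \<le> u \<Longrightarrow> u \<le> s \<Longrightarrow> z + u *\<^sub>R d \<in> J" "\<not> germ J (z + s *\<^sub>R d) d"
proof -
  define T where "T = {t. 0 \<le> t \<and> (\<forall>u. 0 \<le> u \<and> u \<le> t \<longrightarrow> z + u *\<^sub>R d \<in> J)}"
  have 0: "0 \<in> T" using z by (auto simp: T_def)
  obtain B where B: "\<And>p. p \<in> J \<Longrightarrow> norm p \<le> B" using J_facts(2) by (auto simp: bounded_iff)
  have bd: "t \<le> B + norm z" if "t \<in> T" for t
  proof -
    have "0 \<le> t" "z + t *\<^sub>R d \<in> J" using that by (auto simp: T_def)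
    then have "norm (t *\<^sub>R d) \<le> B + norm z" using B[of "z + t *\<^sub>R d"] norm_triangle_ineq4[of "z + t *\<^sub>R d" z] by simp
    then show ?thesis using d \<open>0 \<le> t\<close> by simp
  qed
  define s where "s = Sup T"
  have bdd: "bdd_above T" by (rule bdd_aboveI) (rule bd)
  have s0: "0 \<le> s" unfolding s_def using 0 bdd by (rule cSup_upper)
  have lt: "z + u *\<^sub>R d \<in> J" if u: "0 \<le> u" "u < s" for u
  proof -
    obtain t where "t \<in> T" "u < t" using u(2) less_cSupD[of T u] 0 unfolding s_def by auto
    then show ?thesis using u by (auto simp: T_def)
  qed
  have at: "z + s *\<^sub>R d \<in> J"
  proof (rule ccontr)
    assume n: "z + s *\<^sub>R d \<notin> J"
    then obtain e where e: "e > 0" "ball (z + s *\<^sub>R d) e \<subseteq> - J" using J_facts(1) open_contains_ball[of "- J"] by auto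
    have "s \<noteq> 0" using n z by auto
    then have sp: "0 < s" using s0 by simp
    obtain k where k: "0 < k" "k < e" "k < s" using e(1) sp field_lbound_gt_zero by metis
    have "z + (s - k) *\<^sub>R d \<in> J" using lt[of "s - k"] k by simp
    moreover have "dist (z + s *\<^sub>R d) (z + (s - k) *\<^sub>R d) < e" using k d by (simp add: dist_norm algebra_simps)
    then have "z + (s - k) *\<^sub>R d \<in> ball (z + s *\<^sub>R d) e" by (simp only: mem_ball)
    ultimately show False using e(2) by blast
  qed
  have le: "z + u *\<^sub>R d \<in> J" if "0 \<le> u" "u \<le> s" for u using that lt at by (cases "u = s") auto
  have "\<not> germ J (z + s *\<^sub>R d) d"
  proof
    assume "germ J (z + s *\<^sub>R d) d"
    then obtain e where e: "e > 0" "\<And>t. 0 < t \<Longrightarrow> t < e \<Longrightarrow> z + s *\<^sub>R d + t *\<^sub>R d \<in> J" by (auto simp: germ_def)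
    have "s + e/2 \<in> T"
      unfolding T_def
    proof (intro CollectI conjI allI impI)
      show "0 \<le> s + e/2" using s0 e by simp
      fix u assume u: "0 \<le> u \<and> u \<le> s + e/2"
      show "z + u *\<^sub>R d \<in> J"
      proof (cases "u \<le> s")
        case False
        then show ?thesis using e(2)[of "u - s"] u e(1) by (simp add: algebra_simps)
      qed (use le u in auto)
    qed
    then have "s + e/2 \<le> s" unfolding s_def by (rule cSup_upper) (rule bdd)
    then show False using e(1) by simp
  qed
  then show ?thesis using that[of s] s0 le by blast
qed

lemma dirs_norm: "d \<in> dirs \<Longrightarrow> norm d = 1" and dirs_minus: "d \<in> dirs \<Longrightarrow> - d \<in> dirs"
  by (auto simp: norm_Pair)

text \<open>The segment through \<open>z\<close> is extended both ways as far as the curve goes. A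
  longer segment in the curve would provide a germ beyond one of its ends.\<close>

lemma maximal_edge:
  assumes z: "z \<in> J" and d: "d \<in> dirs" and g: "germ J z d"
  obtains s t where "0 \<le> s" "0 < t" "is_edge J (z - s *\<^sub>R d) (z + t *\<^sub>R d)" "heading (z - s *\<^sub>R d) (z + t *\<^sub>R d) = d"
proof -
  obtain t where t: "0 \<le> t" "\<And>u. 0 \<le> u \<Longrightarrow> u \<le> t \<Longrightarrow> z + u *\<^sub>R d \<in> J" "\<not> germ J (z + t *\<^sub>R d) d"
    using ray_extent[OF z dirs_norm[OF d]] by blast
  obtain s where s: "0 \<le> s" "\<And>u. 0 \<le> u \<Longrightarrow> u \<le> s \<Longrightarrow> z + u *\<^sub>R (- d) \<in> J" "\<not> germ J (z + s *\<^sub>R (- d)) (- d)"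
    using ray_extent[OF z dirs_norm[OF dirs_minus[OF d]]] by blast
  have tp: "0 < t" using t g by (cases "t = 0") auto
  define a b where "a = z - s *\<^sub>R d" and "b = z + t *\<^sub>R d"
  have ba: "b = a + (s + t) *\<^sub>R d" by (simp add: a_def b_def algebra_simps)
  have d0: "d \<noteq> 0" using d by (auto simp: zero_prod_def)
  have hd: "heading a b = d" using d tp s(1) by (auto simp: heading_def ba sgn_if)
  have ab: "a \<noteq> b" using d0 ba tp s(1) by simp
  have pt: "a + u *\<^sub>R d \<in> J" if "0 \<le> u" "u \<le> s + t" for u
  proof (cases "u \<le> s")
    case True
    have "a + u *\<^sub>R d = z + (s - u) *\<^sub>R (- d)" by (simp add: a_def algebra_simps)
    then show ?thesis using s(2)[of "s - u"] that True by simp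
  next
    case False
    have "a + u *\<^sub>R d = z + (u - s) *\<^sub>R d" by (simp add: a_def algebra_simps)
    then show ?thesis using t(2)[of "u - s"] that False by simp
  qed
  have sub: "closed_segment a b \<subseteq> J"
  proof
    fix p assume "p \<in> closed_segment a b"
    then obtain u where "0 \<le> u" "u \<le> s + t" "p = a + u *\<^sub>R d" using segment_pointsE[of p a "s + t" d] ba s(1) tp by auto
    then show "p \<in> J" using pt by simp
  qed
  have "is_edge J a b"
    unfolding is_edge_def
  proof (intro conjI allI impI)
    show "a \<noteq> b" by fact
    show "closed_segment a b \<subseteq> J" by fact
    fix c e assume ce: "closed_segment a b \<subseteq> closed_segment c e \<and> closed_segment c e \<subseteq> J"
    have abc: "a \<in> closed_segment c e" "b \<in> closed_segment c e" using ce by auto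
    have "c \<noteq> e" using abc ab by auto
    then have ax: "axis_parallel c e" using axis_segment ce by auto
    have cd: "closed_segment a c \<subseteq> J" "closed_segment b e \<subseteq> J" "closed_segment b c \<subseteq> J" "closed_segment a e \<subseteq> J"
      using abc ce by (meson subset_closed_segment ends_in_segment order_trans)+
    \<comment> \<open>Every segment in the curve is axis-parallel, so one that contains the edge
      lies on the same line.\<close>
    have line: "\<exists>r. p = a + r *\<^sub>R d" if "p \<in> closed_segment c e" for p
    proof -
      have h: "\<And>p q. p \<in> closed_segment c e \<Longrightarrow> q \<in> closed_segment c e \<Longrightarrow> (fst c = fst e \<longrightarrow> fst p = fst q) \<and> (snd c = snd e \<longrightarrow> snd p = snd q)"
        by (cases c; cases e) (auto simp: hseg vseg)
      show ?thesis
      proof (cases "fst d = 0")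
        case True
        then have "snd a \<noteq> snd b" using ba d tp s(1) by auto
        then have "fst c = fst e" using h[OF abc] ax by (auto simp: axis_parallel_def)
        then have "fst p = fst a" using h[OF that abc(1)] by simp
        then show ?thesis using True d by (intro exI[of _ "(snd p - snd a) * snd d"]) (auto simp: prod_eq_iff)
      next
        case False
        then have "fst a \<noteq> fst b" "snd d = 0" using ba d tp s(1) by auto
        then have "snd c = snd e" using h[OF abc] ax by (auto simp: axis_parallel_def)
        then have "snd p = snd a" using h[OF that abc(1)] by simp
        then show ?thesis using False d \<open>snd d = 0\<close> by (intro exI[of _ "(fst p - fst a) * fst d"]) (auto simp: prod_eq_iff)
      qed
    qed
    have range: "p \<in> closed_segment a b" if p: "p \<in> closed_segment c e" for p
    proof -
      obtain r where r: "p = a + r *\<^sub>R d" using line[OF p] by blast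
      have pa: "closed_segment a p \<subseteq> J" "closed_segment b p \<subseteq> J" using p abc ce by (meson subset_closed_segment order_trans)+
      have "0 \<le> r"
      proof (rule ccontr)
        assume n: "\<not> 0 \<le> r"
        have eq: "a + (- r) *\<^sub>R (- d) = p" using r by simp
        have "germ J a (- d)" using germ_interior[of a "- r" "- d"] pa n unfolding eq by auto
        then show False using s(3) by (simp add: a_def)
      qed
      moreover have "r \<le> s + t"
      proof (rule ccontr)
        assume n: "\<not> r \<le> s + t"
        have eq: "b + (r - (s + t)) *\<^sub>R d = p" using r ba by (simp add: algebra_simps)
        have "germ J b d" using germ_interior[of b "r - (s + t)" d] pa n unfolding eq by auto
        then show False using t(3) by (simp add: b_def)
      qed
      ultimately show ?thesis using segment_points[of r "s + t" a d] r ba by simp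
    qed
    then show "closed_segment c e = closed_segment a b" using ce by blast
  qed
  then show ?thesis using that[of s t] s(1) tp hd by (simp add: a_def b_def)
qed

end

section \<open>Boundary vertices in clockwise order\<close>

context rectilinear
begin

lemma heading_dirs: "is_edge J a b \<Longrightarrow> heading a b \<in> dirs"
  using edge_param by blast

text \<open>At an end of an edge exactly one of two opposite germs is present. Parity yields a
  perpendicular germ, and this one belongs to a second edge.\<close>

lemma endpoint_vertex:
  assumes e: "is_edge J a b"
  shows "a \<in> vertices J"
proof -
  have aJ: "a \<in> J" using e by (auto simp: is_edge_def)
  have "\<exists>d\<in>dirs. germ J a d \<and> d \<noteq> c \<and> d \<noteq> - c" if "germ J a c" "\<not> germ J a (- c)" "c \<in> dirs" for c
    using germ_parity(1)[OF aJ] that by (elim insertE emptyE) (simp; metis prod.inject zero_neq_one zero_neq_neg_one)+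
  then obtain d where d: "d \<in> dirs" "germ J a d" "d \<noteq> heading a b" "d \<noteq> - heading a b"
    using edge_germ[OF e] heading_dirs[OF e] by blast
  obtain s t where st: "0 \<le> s" "0 < t" "is_edge J (a - s *\<^sub>R d) (a + t *\<^sub>R d)" "heading (a - s *\<^sub>R d) (a + t *\<^sub>R d) = d"
    using maximal_edge[OF aJ d(1,2)] .
  let ?p = "a - s *\<^sub>R d" and ?q = "a + t *\<^sub>R d"
  have eq: "?p + s *\<^sub>R d = a" "?p + (s + t) *\<^sub>R d = ?q" by (simp_all add: algebra_simps)
  have "a \<in> closed_segment ?p ?q" using segment_points[of s "s + t" ?p d, unfolded eq] st(1,2) by simp
  moreover have "closed_segment ?p ?q \<noteq> closed_segment a b"
  proof
    assume "closed_segment ?p ?q = closed_segment a b"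
    then have "{?p, ?q} = {a, b}" by (rule iffD1[OF closed_segment_eq])
    then have "?p = a \<and> ?q = b \<or> ?p = b \<and> ?q = a" by (rule iffD1[OF doubleton_eq_iff])
    then have "heading ?p ?q = heading a b \<or> heading ?p ?q = heading b a" by metis
    then show False using st(4) d(3,4) heading_commute[of b a] by argo
  qed
  moreover have "closed_segment a b \<in> edges J" "closed_segment ?p ?q \<in> edges J" using e st(3) unfolding edges_def by blast+
  moreover have "a \<in> closed_segment a b" by simp
  ultimately show ?thesis unfolding vertices_def by blast
qed

text \<open>If one of the two edges ended first, the other would continue it, against
  maximality.\<close>

lemma edges_overlap:
  assumes e: "is_edge J a b" "is_edge J c f" "heading a b = heading c f" "z \<in> open_segment a b" "z \<in> open_segment c f"
  shows "b = f"
proof -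
  define d where "d = heading a b"
  have zz: "z \<in> closed_segment a b" "z \<in> closed_segment c f" using e(4,5) by (auto simp: open_segment_def)
  have par: "\<exists>l>0. b' = z + l *\<^sub>R d" if E: "is_edge J a' b'" "heading a' b' = d" "z \<in> open_segment a' b'" for a' b'
  proof -
    obtain l where l: "0 < l" "b' = a' + l *\<^sub>R d" using edge_param[OF E(1)] E(2) by metis
    have z: "z \<in> closed_segment a' b'" "z \<noteq> b'" using E(3) by (auto simp: open_segment_def)
    obtain t where t: "0 \<le> t" "t \<le> l" "z = a' + t *\<^sub>R d" using segment_pointsE[of z a' l d] z(1) l by auto
    have "t \<noteq> l" using z(2) t l by auto
    then show ?thesis using t l by (intro exI[of _ "l - t"]) (auto simp: algebra_simps)
  qed
  obtain l where l: "0 < l" "b = z + l *\<^sub>R d" using par[OF e(1) _ e(4)] d_def by blast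
  obtain l' where l': "0 < l'" "f = z + l' *\<^sub>R d" using par[OF e(2) _ e(5)] e(3) d_def by metis
  have less: "\<not> l < l'" if "is_edge J a b" "is_edge J c f" "heading a b = d" "0 < l" "b = z + l *\<^sub>R d" "f = z + l' *\<^sub>R d" "z \<in> closed_segment c f" for a b c f l l'
  proof
    assume lt: "l < l'"
    have "closed_segment z f \<subseteq> J" using that(2,7) unfolding is_edge_def by (meson subset_closed_segment ends_in_segment order_trans)
    moreover have "b \<in> closed_segment z f" using segment_points[of l l' z d] that lt by simp
    ultimately have "closed_segment b f \<subseteq> J" by (meson subset_closed_segment ends_in_segment order_trans)
    moreover have "f = b + (l' - l) *\<^sub>R d" using that by (simp add: algebra_simps)
    ultimately have "germ J b d" using germ_interior[of b "l' - l" d] lt by auto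
    moreover have "\<not> germ J b (- heading b a)" using edge_germ(2)[of b a] that(1) is_edge_commute by blast
    ultimately show False using heading_commute[of b a] that(3) by simp
  qed
  have "l = l'" using less[OF e(1,2) d_def[symmetric] l l'(2) zz(2)] less[OF e(2,1) _ l' l(2) zz(1)] e(3) d_def by fastforce
  then show ?thesis using l l' by simp
qed

end

section \<open>The listed sides and how they meet\<close>

locale vertex_list = rectilinear +
  fixes vs :: "(int \<times> int) list"
  assumes vs_list: "cw_vertex_list J vs" and vs_ne: "vs \<noteq> []"
begin

abbreviation "n \<equiv> length vs"

definition vx :: "nat \<Rightarrow> point" where "vx i = pt (cyc vs i)"

lemma n_pos: "0 < n" using vs_ne by simp

lemma vx_mod: "vx (i mod n) = vx i" by (simp add: vx_def cyc_def)

lemma vx_eq_iff: "vx i = vx j \<longleftrightarrow> i mod n = j mod n"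
proof -
  have "inj pt" by (auto simp: inj_on_def pt_def prod_eq_iff)
  then have "vx i = vx j \<longleftrightarrow> vs ! (i mod n) = vs ! (j mod n)" unfolding vx_def cyc_def by (rule inj_eq)
  then show ?thesis using vs_list n_pos nth_eq_iff_index_eq[of vs "i mod n" "j mod n"] by (auto simp: cw_vertex_list_def)
qed

lemma vx_cong: "i mod n = j mod n \<Longrightarrow> vx i = vx j" using vx_eq_iff by blast

lemma vx_Suc_cong:
  assumes "i mod n = j mod n"
  shows "vx (Suc i) = vx (Suc j)"
proof (rule vx_cong)
  have "Suc i mod n = Suc (i mod n) mod n" by (rule mod_Suc_eq[symmetric])
  also have "\<dots> = Suc (j mod n) mod n" by (simp only: assms)
  also have "\<dots> = Suc j mod n" by (rule mod_Suc_eq)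
  finally show "Suc i mod n = Suc j mod n" .
qed

lemma cw: "cw_edge J (vx i) (vx (Suc i))"
proof -
  have "cw_edge J (vx (i mod n)) (vx (Suc (i mod n)))" using vs_list n_pos by (auto simp: cw_vertex_list_def vx_def)
  moreover have "vx (Suc (i mod n)) = vx (Suc i)" by (rule vx_cong) (simp add: mod_Suc_eq)
  ultimately show ?thesis by (simp add: vx_mod)
qed

lemma edge: "is_edge J (vx i) (vx (Suc i))" using cw by (auto simp: cw_edge_def)

lemma vertexE:
  assumes "z \<in> vertices J"
  obtains i where "z = vx (Suc i)"
proof -
  have "z \<in> pt ` set vs" using assms vs_list by (simp add: cw_vertex_list_def)
  then obtain k where k: "k < n" "z = pt (vs ! k)" by (auto simp: in_set_conv_nth)
  have "z = vx k" using k by (simp add: vx_def cyc_def)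
  also have "\<dots> = vx (Suc (k + n - 1))" using n_pos by (intro vx_cong) simp
  finally show ?thesis using that by blast
qed

definition dir :: "nat \<Rightarrow> point" where "dir i = heading (vx i) (vx (Suc i))"

lemma dir_dirs: "dir i \<in> dirs" unfolding dir_def by (rule heading_dirs[OF edge])

lemma dir_cong: "i mod n = j mod n \<Longrightarrow> dir i = dir j"
  unfolding dir_def by (rule arg_cong2[where f=heading]) (rule vx_cong vx_Suc_cong, assumption)+

lemma vx_germs:
  shows "germ J (vx (Suc i)) (- dir i)" "\<not> germ J (vx (Suc i)) (dir i)" "germ J (vx (Suc i)) (dir (Suc i))" "\<not> germ J (vx (Suc i)) (- dir (Suc i))"
proof -
  have "is_edge J (vx (Suc i)) (vx i)" using edge is_edge_commute by blast
  from edge_germ[OF this] show "germ J (vx (Suc i)) (- dir i)" "\<not> germ J (vx (Suc i)) (dir i)"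
    unfolding dir_def heading_commute[of "vx (Suc i)" "vx i"] by auto
  from edge_germ[OF edge] show "germ J (vx (Suc i)) (dir (Suc i))" "\<not> germ J (vx (Suc i)) (- dir (Suc i))"
    unfolding dir_def by auto
qed

text \<open>Going straight on contradicts maximality; turning back would make one edge clockwise in
  both directions.\<close>

lemma dir_turn: "dir (Suc i) \<noteq> dir i" "dir (Suc i) \<noteq> - dir i"
proof -
  show "dir (Suc i) \<noteq> dir i" using vx_germs by metis
  show "dir (Suc i) \<noteq> - dir i"
  proof
    assume "dir (Suc i) = - dir i"
    then have "heading (vx (Suc i)) (vx i) = heading (vx (Suc i)) (vx (Suc (Suc i)))"
      unfolding dir_def using heading_commute by metis
    then have "vx i = vx (Suc (Suc i))" using edge_unique edge is_edge_commute by blast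
    then have "cw_edge J (vx (Suc i)) (vx i)" using cw[of "Suc i"] by simp
    then show False using cw_edge_asym cw by blast
  qed
qed

lemma vx_germ_iff:
  assumes "d \<in> dirs"
  shows "germ J (vx (Suc i)) d \<longleftrightarrow> d = - dir i \<or> d = dir (Suc i)"
proof
  assume g: "germ J (vx (Suc i)) d"
  then have "d \<noteq> dir i" "d \<noteq> - dir (Suc i)" using vx_germs by metis+
  then show "d = - dir i \<or> d = dir (Suc i)" using assms dir_dirs[of i] dir_dirs[of "Suc i"] dir_turn[of i] by auto
next
  assume "d = - dir i \<or> d = dir (Suc i)"
  then show "germ J (vx (Suc i)) d" using vx_germs by auto
qed

lemma edge_from_vx:
  assumes "is_edge J (vx (Suc i)) b"
  shows "b = vx i \<or> b = vx (Suc (Suc i))"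
proof -
  have g: "heading (vx (Suc i)) b = - dir i \<or> heading (vx (Suc i)) b = dir (Suc i)"
    using vx_germ_iff[OF heading_dirs[OF assms]] edge_germ(1)[OF assms] by blast
  then show ?thesis
  proof
    assume "heading (vx (Suc i)) b = - dir i"
    then have "heading (vx (Suc i)) b = heading (vx (Suc i)) (vx i)" by (metis dir_def heading_commute)
    then show ?thesis using edge_unique[OF assms] edge is_edge_commute by blast
  next
    assume "heading (vx (Suc i)) b = dir (Suc i)"
    then show ?thesis using edge_unique[OF assms edge] unfolding dir_def by blast
  qed
qed

text \<open>The list only promises that consecutive vertices span clockwise edges. That no edge is
  missing follows because every edge starts at a listed vertex, where just two directions carry
  germs.\<close>

lemma edge_listed:
  assumes "is_edge J a b"
  obtains i where "a = vx i" "b = vx (Suc i)" | i where "a = vx (Suc i)" "b = vx i"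
proof -
  obtain i where "a = vx (Suc i)" using vertexE[OF endpoint_vertex[OF assms]] .
  then show ?thesis using edge_from_vx assms that by metis
qed

lemma cw_edge_listed:
  assumes "cw_edge J a b"
  obtains i where "a = vx i" "b = vx (Suc i)"
proof -
  have "is_edge J a b" using assms by (simp add: cw_edge_def)
  then show ?thesis using that assms cw cw_edge_asym by (metis edge_listed)
qed

definition side :: "nat \<Rightarrow> point set" where "side i = closed_segment (vx i) (vx (Suc i))"

lemma side_cong: "i mod n = j mod n \<Longrightarrow> side i = side j"
  unfolding side_def by (rule arg_cong2[where f=closed_segment]) (rule vx_cong vx_Suc_cong, assumption)+

lemma side_sub: "side i \<subseteq> J" using edge by (auto simp: side_def is_edge_def)

lemma J_sides:
  assumes "z \<in> J"
  obtains i where "i < n" "z \<in> side i"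
proof -
  obtain d where d: "d \<in> dirs" "germ J z d" using germ_parity(2)[OF assms] by auto
  obtain s t where st: "0 \<le> s" "0 < t" "is_edge J (z - s *\<^sub>R d) (z + t *\<^sub>R d)" "heading (z - s *\<^sub>R d) (z + t *\<^sub>R d) = d"
    using maximal_edge[OF assms d] .
  let ?p = "z - s *\<^sub>R d"
  have eq: "?p + s *\<^sub>R d = z" "?p + (s + t) *\<^sub>R d = z + t *\<^sub>R d" by (simp_all add: algebra_simps)
  have "z \<in> closed_segment (z - s *\<^sub>R d) (z + t *\<^sub>R d)" using segment_points[of s "s + t" ?p d, unfolded eq] st(1,2) by simp
  moreover obtain i where "closed_segment (z - s *\<^sub>R d) (z + t *\<^sub>R d) = side i"
    using st(3) unfolding side_def by (metis edge_listed closed_segment_commute)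
  ultimately have "z \<in> side (i mod n)" using side_cong[of "i mod n" i] by simp
  then show ?thesis using that n_pos by (meson mod_less_divisor)
qed

text \<open>The inside adjoins on the clockwise normal, so there is no germ there, and parity
  removes the opposite one.\<close>

lemma inner_germs:
  assumes z: "z \<in> open_segment (vx i) (vx (Suc i))" and d: "d \<in> dirs"
  shows "germ J z d \<longleftrightarrow> d = dir i \<or> d = - dir i"
proof -
  have zc: "z \<in> closed_segment (vx i) (vx (Suc i))" "z \<noteq> vx i" "z \<noteq> vx (Suc i)" using z by (auto simp: open_segment_def)
  note g = edge_interior_germ[OF edge zc, folded dir_def]
  have zJ: "z \<in> J" using zc(1) side_sub[of i] by (auto simp: side_def)
  let ?m = "(snd (dir i), - fst (dir i))"
  obtain l where l: "0 < l" "vx (Suc i) = vx i + l *\<^sub>R dir i" using edge_param[OF edge[of i]] unfolding dir_def by blast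
  have nm: "(snd (vx (Suc i)) - snd (vx i), - (fst (vx (Suc i)) - fst (vx i))) = l *\<^sub>R ?m"
    unfolding l(2) by simp
  obtain e where e: "e > 0" "\<And>t. 0 < t \<Longrightarrow> t < e \<Longrightarrow> z + t *\<^sub>R (l *\<^sub>R ?m) \<in> inside J"
    using cw[of i] z unfolding cw_edge_def interior_on_def nm by blast
  have nmg: "\<not> germ J z ?m"
  proof
    assume "germ J z ?m"
    then obtain f where f: "f > 0" "\<And>t. 0 < t \<Longrightarrow> t < f \<Longrightarrow> z + t *\<^sub>R ?m \<in> J" unfolding germ_def by blast
    obtain t where t: "0 < t" "t < f / l" "t < e" using f(1) l(1) e(1) field_lbound_gt_zero[of "f / l" e] by auto
    have "z + (t * l) *\<^sub>R ?m \<in> J" using f(2)[of "t * l"] t l(1) by (simp add: field_simps)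
    moreover have "z + t *\<^sub>R (l *\<^sub>R ?m) \<in> inside J" using e(2) t by blast
    ultimately show False using in_out(3)[of "z + t *\<^sub>R (l *\<^sub>R ?m)"] unfolding scaleR_scaleR by blast
  qed
  have "germ J z d \<longleftrightarrow> d = c \<or> d = - c" if "c \<in> dirs" "germ J z c" "germ J z (- c)" "\<not> germ J z (snd c, - fst c)" for c
    using germ_parity(1)[OF zJ] d that by (elim insertE emptyE; simp)
  then show ?thesis using dir_dirs[of i] g nmg by blast
qed

lemma inner_not_vertex: "z \<in> open_segment (vx i) (vx (Suc i)) \<Longrightarrow> z \<noteq> vx k"
proof
  assume z: "z \<in> open_segment (vx i) (vx (Suc i))" "z = vx k"
  have "vx k = vx (Suc (k + n - 1))" using n_pos by (intro vx_cong) simp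
  then obtain k' where k: "z = vx (Suc k')" using z(2) by metis
  have g: "germ J z (dir k') \<longleftrightarrow> germ J z (- dir k')" for k' using inner_germs[OF z(1) dir_dirs[of k']] inner_germs[OF z(1), of "- dir k'"] dirs_minus[OF dir_dirs[of k']] by (metis minus_minus)
  show False using g vx_germs unfolding k by blast
qed

text \<open>At a common inner point the germs force the same line, so the two edges coincide; equal
  directions contradict the distinctness of the list, opposite ones \<open>cw_edge_asym\<close>.
  Hence sides meet in end points only, and these are distinct vertices.\<close>

lemma sides_meet:
  assumes z: "z \<in> side i" "z \<in> side j" and ij: "i mod n \<noteq> j mod n"
  shows "z = vx j \<and> j mod n = Suc i mod n \<or> z = vx i \<and> i mod n = Suc j mod n"
proof -
  have ends: "z = vx k \<or> z = vx (Suc k) \<or> z \<in> open_segment (vx k) (vx (Suc k))" if "z \<in> side k" for k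
    using that by (auto simp: side_def open_segment_def)
  show ?thesis
  proof (cases "z \<in> open_segment (vx i) (vx (Suc i))")
    case True
    then have zj: "z \<in> open_segment (vx j) (vx (Suc j))" using ends[OF z(2)] inner_not_vertex by blast
    have "dir j = dir i \<or> dir j = - dir i" using inner_germs[OF True dir_dirs[of j]] inner_germs[OF zj dir_dirs[of j]] by simp
    then show ?thesis
    proof
      assume "dir j = dir i"
      then have "vx (Suc i) = vx (Suc j)" using edges_overlap[OF edge edge _ True zj] by (simp add: dir_def)
      moreover have "vx i = vx j"
        using edges_overlap[of "vx (Suc i)" "vx i" "vx (Suc j)" "vx j" z] edge is_edge_commute True zj \<open>dir j = dir i\<close>
        unfolding dir_def by (metis heading_commute open_segment_commute)
      ultimately show ?thesis using ij vx_eq_iff by blast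
    next
      assume d: "dir j = - dir i"
      have "vx (Suc i) = vx j"
        using edges_overlap[of "vx i" "vx (Suc i)" "vx (Suc j)" "vx j" z] edge is_edge_commute True zj d
        unfolding dir_def by (metis heading_commute open_segment_commute minus_minus)
      moreover have "vx i = vx (Suc j)"
        using edges_overlap[of "vx (Suc i)" "vx i" "vx j" "vx (Suc j)" z] edge is_edge_commute True zj d
        unfolding dir_def by (metis heading_commute open_segment_commute minus_minus)
      ultimately show ?thesis using cw[of i] cw[of j] cw_edge_asym by metis
    qed
  next
    case False
    then have zi: "z = vx i \<or> z = vx (Suc i)" using ends[OF z(1)] by blast
    then have zj: "z = vx j \<or> z = vx (Suc j)" using ends[OF z(2)] inner_not_vertex by blast
    have "Suc i mod n \<noteq> Suc j mod n"
    proof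
      assume "Suc i mod n = Suc j mod n"
      then have "(Suc i + (n - 1)) mod n = (Suc j + (n - 1)) mod n" by (metis mod_add_left_eq)
      then show False using ij n_pos by simp
    qed
    then show ?thesis using zi zj ij vx_eq_iff by metis
  qed
qed

lemma nv_eq: "nv J = n"
proof -
  have "inj_on pt (set vs)" by (auto simp: inj_on_def pt_def prod_eq_iff)
  then have "card (pt ` set vs) = n" using vs_list unfolding cw_vertex_list_def by (metis card_image distinct_card)
  moreover have "pt ` set vs = vertices J" using vs_list unfolding cw_vertex_list_def by blast
  ultimately show ?thesis unfolding nv_def by simp
qed

end

section \<open>Unit cells\<close>

context vertex_list
begin

definition X :: "nat \<Rightarrow> int" where "X i = fst (cyc vs i)"
definition Y :: "nat \<Rightarrow> int" where "Y i = snd (cyc vs i)"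

definition goes_right :: "nat \<Rightarrow> bool" where "goes_right i \<longleftrightarrow> Y (Suc i) = Y i \<and> X i < X (Suc i)"
definition goes_left :: "nat \<Rightarrow> bool" where "goes_left i \<longleftrightarrow> Y (Suc i) = Y i \<and> X (Suc i) < X i"
definition goes_up :: "nat \<Rightarrow> bool" where "goes_up i \<longleftrightarrow> X (Suc i) = X i \<and> Y i < Y (Suc i)"
definition goes_down :: "nat \<Rightarrow> bool" where "goes_down i \<longleftrightarrow> X (Suc i) = X i \<and> Y (Suc i) < Y i"

lemmas goes_defs = goes_right_def goes_left_def goes_up_def goes_down_def

lemma vx_XY: "vx i = (real_of_int (X i), real_of_int (Y i))"
  by (simp add: vx_def pt_def X_def Y_def)

lemma goes_dir:
  "goes_right i \<longleftrightarrow> dir i = (1, 0)" "goes_left i \<longleftrightarrow> dir i = (-1, 0)"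
  "goes_up i \<longleftrightarrow> dir i = (0, 1)" "goes_down i \<longleftrightarrow> dir i = (0, -1)"
  by (auto simp: goes_defs dir_def heading_def vx_XY sgn_if)

lemma goes_cases: "goes_right i \<or> goes_left i \<or> goes_up i \<or> goes_down i"
  using dir_dirs[of i] unfolding goes_dir by blast

lemma goes_turn: "(goes_right i \<or> goes_left i) \<longleftrightarrow> (goes_up (Suc i) \<or> goes_down (Suc i))"
  using dir_dirs[of i] dir_dirs[of "Suc i"] dir_turn[of i] unfolding goes_dir by (elim insertE emptyE) simp_all

lemma goes_cong:
  assumes "i mod n = j mod n"
  shows "goes_right i = goes_right j" "goes_left i = goes_left j" "goes_up i = goes_up j" "goes_down i = goes_down j" "X i = X j" "Y i = Y j"
  using dir_cong[OF assms] vx_cong[OF assms] unfolding goes_dir by (auto simp: vx_XY)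

lemma side_iff:
  "p \<in> side i \<longleftrightarrow> real_of_int (min (X i) (X (Suc i))) \<le> fst p \<and> fst p \<le> real_of_int (max (X i) (X (Suc i))) \<and>
     real_of_int (min (Y i) (Y (Suc i))) \<le> snd p \<and> snd p \<le> real_of_int (max (Y i) (Y (Suc i)))"
proof -
  have "X (Suc i) = X i \<or> Y (Suc i) = Y i" using goes_cases[of i] by (auto simp: goes_defs)
  then show ?thesis unfolding side_def vx_XY by (auto simp: hseg vseg of_int_min of_int_max)
qed

lemma sides_meet_int:
  assumes "pt p \<in> side i" "pt p \<in> side j" "i mod n \<noteq> j mod n"
  shows "p = (X j, Y j) \<and> j mod n = Suc i mod n \<or> p = (X i, Y i) \<and> i mod n = Suc j mod n"
  using sides_meet[OF assms] by (auto simp: vx_XY pt_def prod_eq_iff)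

text \<open>The centre may stand for the cell, because the open cell contains no boundary point
  (\<open>cell_off_J\<close>).\<close>

definition inn :: "int \<Rightarrow> int \<Rightarrow> bool" where "inn i j \<longleftrightarrow> (real_of_int i + 1/2, real_of_int j + 1/2) \<in> inside J"

lemma int_between: "real_of_int i < real_of_int k \<Longrightarrow> real_of_int k < real_of_int i + 1 \<Longrightarrow> False"
  by (metis of_int_1 of_int_add of_int_less_iff zless_add1_eq less_irrefl less_asym)

lemma J_grid:
  assumes "p \<in> J" "real_of_int i < fst p" "fst p < real_of_int i + 1"
  obtains k where "k < n" "goes_right k \<or> goes_left k" "snd p = real_of_int (Y k)" "min (X k) (X (Suc k)) \<le> i" "i < max (X k) (X (Suc k))"
proof -
  obtain k where k: "k < n" "p \<in> side k" using J_sides[OF assms(1)] .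
  have s: "real_of_int (min (X k) (X (Suc k))) \<le> fst p \<and> fst p \<le> real_of_int (max (X k) (X (Suc k))) \<and>
     real_of_int (min (Y k) (Y (Suc k))) \<le> snd p \<and> snd p \<le> real_of_int (max (Y k) (Y (Suc k)))" using k(2) by (simp only: side_iff)
  have "min (X k) (X (Suc k)) \<le> i" "i < max (X k) (X (Suc k))" using s assms(2,3) by linarith+
  moreover from this have "goes_right k \<or> goes_left k" using goes_cases[of k] by (auto simp: goes_defs)
  moreover from this have "snd p = real_of_int (Y k)" using s by (auto simp: goes_defs)
  ultimately show ?thesis using that k(1) by blast
qed

lemma J_grid':
  assumes "p \<in> J" "real_of_int j < snd p" "snd p < real_of_int j + 1"
  obtains k where "k < n" "goes_up k \<or> goes_down k" "fst p = real_of_int (X k)" "min (Y k) (Y (Suc k)) \<le> j" "j < max (Y k) (Y (Suc k))"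
proof -
  obtain k where k: "k < n" "p \<in> side k" using J_sides[OF assms(1)] .
  have s: "real_of_int (min (X k) (X (Suc k))) \<le> fst p \<and> fst p \<le> real_of_int (max (X k) (X (Suc k))) \<and>
     real_of_int (min (Y k) (Y (Suc k))) \<le> snd p \<and> snd p \<le> real_of_int (max (Y k) (Y (Suc k)))" using k(2) by (simp only: side_iff)
  have "min (Y k) (Y (Suc k)) \<le> j" "j < max (Y k) (Y (Suc k))" using s assms(2,3) by linarith+
  moreover from this have "goes_up k \<or> goes_down k" using goes_cases[of k] by (auto simp: goes_defs)
  moreover from this have "fst p = real_of_int (X k)" using s by (auto simp: goes_defs)
  ultimately show ?thesis using that k(1) by blast
qed

definition unit_square :: "int \<Rightarrow> int \<Rightarrow> point set" where
  "unit_square i j = {real_of_int i <..< real_of_int i + 1} \<times> {real_of_int j <..< real_of_int j + 1}"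

lemma cell_off_J: "unit_square i j \<inter> J = {}"
proof -
  have False if p: "p \<in> unit_square i j" "p \<in> J" for p
  proof -
    have b: "real_of_int i < fst p" "fst p < real_of_int i + 1" "real_of_int j < snd p" "snd p < real_of_int j + 1" using p(1) by (auto simp: unit_square_def)
    obtain k where "snd p = real_of_int (Y k)" using J_grid[OF p(2) b(1,2)] .
    then show False using b(3,4) int_between by metis
  qed
  then show ?thesis by blast
qed

lemma cell_inside: "p \<in> unit_square i j \<Longrightarrow> p \<in> inside J \<longleftrightarrow> inn i j"
proof -
  assume p: "p \<in> unit_square i j"
  have c: "connected (unit_square i j)" unfolding unit_square_def by (intro convex_connected convex_Times) simp_all
  have m: "(real_of_int i + 1/2, real_of_int j + 1/2) \<in> unit_square i j" by (simp add: unit_square_def)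
  show ?thesis using connected_side[OF c cell_off_J p] connected_side[OF c cell_off_J m] p m unfolding inn_def by blast
qed

lemma side_jump:
  assumes z: "z \<in> open_segment (vx k) (vx (Suc k))" and m: "m = (snd (dir k), - fst (dir k))"
  shows "\<exists>\<epsilon>>0. \<forall>t. 0 < t \<and> t < \<epsilon> \<longrightarrow> z + t *\<^sub>R m \<in> inside J \<and> z - t *\<^sub>R m \<notin> inside J"
proof -
  obtain l where l: "0 < l" "vx (Suc k) = vx k + l *\<^sub>R dir k" using edge_param[OF edge[of k]] unfolding dir_def by blast
  have nm: "(snd (vx (Suc k)) - snd (vx k), - (fst (vx (Suc k)) - fst (vx k))) = l *\<^sub>R m"
    unfolding l(2) m by simp
  obtain e where e: "e > 0" "\<And>t. 0 < t \<Longrightarrow> t < e \<Longrightarrow> z + t *\<^sub>R (l *\<^sub>R m) \<in> inside J"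
    using cw[of k] z unfolding cw_edge_def interior_on_def nm by blast
  obtain f where f: "f > 0" "\<forall>t. 0 < t \<and> t < f \<longrightarrow> z - t *\<^sub>R (l *\<^sub>R m) \<in> outside J"
    using two_sided[OF edge z nm[symmetric] e] by blast
  have "z + t *\<^sub>R m \<in> inside J \<and> z - t *\<^sub>R m \<notin> inside J" if "0 < t" "t < min e f * l" for t
  proof -
    have "0 < t / l" "t / l < min e f" using that l(1) by (simp_all only: divide_pos_pos pos_divide_less_eq)
    then have t: "0 < t / l" "t / l < e" "t / l < f" by simp_all
    have "(t / l) *\<^sub>R (l *\<^sub>R m) = t *\<^sub>R m" using l(1) by simp
    then show ?thesis using e(2)[OF t(1,2)] f(2) t in_out(2) by metis
  qed
  then show ?thesis using e(1) f(1) l(1) by (intro exI[of _ "min e f * l"]) auto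
qed

lemma side_mid:
  shows "goes_right k \<Longrightarrow> X k \<le> i \<Longrightarrow> i < X (Suc k) \<Longrightarrow> (real_of_int i + 1/2, real_of_int (Y k)) \<in> open_segment (vx k) (vx (Suc k))"
    "goes_left k \<Longrightarrow> X (Suc k) \<le> i \<Longrightarrow> i < X k \<Longrightarrow> (real_of_int i + 1/2, real_of_int (Y k)) \<in> open_segment (vx k) (vx (Suc k))"
    "goes_up k \<Longrightarrow> Y k \<le> i \<Longrightarrow> i < Y (Suc k) \<Longrightarrow> (real_of_int (X k), real_of_int i + 1/2) \<in> open_segment (vx k) (vx (Suc k))"
    "goes_down k \<Longrightarrow> Y (Suc k) \<le> i \<Longrightarrow> i < Y k \<Longrightarrow> (real_of_int (X k), real_of_int i + 1/2) \<in> open_segment (vx k) (vx (Suc k))"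
  unfolding open_segment_def vx_XY goes_defs by (auto simp: hseg vseg min_def max_def)

lemma jump_cells:
  assumes z: "z \<in> open_segment (vx k) (vx (Suc k))" and m: "m = (snd (dir k), - fst (dir k))"
    and c: "\<And>t. 0 < t \<Longrightarrow> t < 1 \<Longrightarrow> z + t *\<^sub>R m \<in> unit_square i j" "\<And>t. 0 < t \<Longrightarrow> t < 1 \<Longrightarrow> z - t *\<^sub>R m \<in> unit_square i' j'"
  shows "inn i j \<and> \<not> inn i' j'"
proof -
  obtain e where e: "e > 0" "\<forall>t. 0 < t \<and> t < e \<longrightarrow> z + t *\<^sub>R m \<in> inside J \<and> z - t *\<^sub>R m \<notin> inside J" using side_jump[OF z m] by blast
  obtain t :: real where t: "0 < t" "t < e" "t < 1" using e(1) field_lbound_gt_zero[of e 1] by auto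
  then show ?thesis using e(2) c cell_inside by metis
qed

lemma jump_right:
  assumes "goes_right k" "X k \<le> i" "i < X (Suc k)"
  shows "inn i (Y k - 1) \<and> \<not> inn i (Y k)"
  by (rule jump_cells[OF side_mid(1)[OF assms] refl]) (use assms(1) in \<open>auto simp: goes_dir unit_square_def\<close>)

lemma jump_left:
  assumes "goes_left k" "X (Suc k) \<le> i" "i < X k"
  shows "inn i (Y k) \<and> \<not> inn i (Y k - 1)"
  by (rule jump_cells[OF side_mid(2)[OF assms] refl]) (use assms(1) in \<open>auto simp: goes_dir unit_square_def\<close>)

lemma jump_up:
  assumes "goes_up k" "Y k \<le> j" "j < Y (Suc k)"
  shows "inn (X k) j \<and> \<not> inn (X k - 1) j"
  by (rule jump_cells[OF side_mid(3)[OF assms] refl]) (use assms(1) in \<open>auto simp: goes_dir unit_square_def\<close>)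

lemma jump_down:
  assumes "goes_down k" "Y (Suc k) \<le> j" "j < Y k"
  shows "inn (X k - 1) j \<and> \<not> inn (X k) j"
  by (rule jump_cells[OF side_mid(4)[OF assms] refl]) (use assms(1) in \<open>auto simp: goes_dir unit_square_def\<close>)

lemma connected_same:
  assumes "connected C" "p \<in> C" "q \<in> C" "(p \<in> inside J) \<noteq> (q \<in> inside J)"
  obtains z where "z \<in> C" "z \<in> J"
  using connected_side[OF assms(1) _ assms(2)] connected_side[OF assms(1) _ assms(3)] assms(2-4) that by blast

text \<open>The segment joining the two centres meets the boundary, by \<open>J_grid\<close> at an
  integral height, that is on the common border of the cells.\<close>

lemma inn_change_vertical:
  assumes "inn i j \<noteq> inn i (j - 1)"
  obtains k where "k < n" "Y k = j" "goes_right k \<and> X k \<le> i \<and> i < X (Suc k) \<or> goes_left k \<and> X (Suc k) \<le> i \<and> i < X k"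
proof -
  let ?x = "real_of_int i + 1/2"
  obtain z where z: "z \<in> {?x} \<times> {real_of_int j - 1/2 .. real_of_int j + 1/2}" "z \<in> J"
    using connected_same[of "{?x} \<times> {real_of_int j - 1/2 .. real_of_int j + 1/2}" "(?x, real_of_int j + 1/2)" "(?x, real_of_int (j - 1) + 1/2)"] assms
    by (auto simp: inn_def intro!: connected_Times)
  have zx: "real_of_int i < fst z" "fst z < real_of_int i + 1" using z(1) by auto
  obtain k where k: "k < n" "goes_right k \<or> goes_left k" "snd z = real_of_int (Y k)" "min (X k) (X (Suc k)) \<le> i" "i < max (X k) (X (Suc k))"
    using J_grid[OF z(2) zx] .
  have "Y k = j" using k(3) z(1) by auto
  then show ?thesis using that k by (auto simp: goes_defs)
qed

lemma inn_change_horizontal: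
  assumes "inn i j \<noteq> inn (i - 1) j"
  obtains k where "k < n" "X k = i" "goes_up k \<and> Y k \<le> j \<and> j < Y (Suc k) \<or> goes_down k \<and> Y (Suc k) \<le> j \<and> j < Y k"
proof -
  let ?y = "real_of_int j + 1/2"
  obtain z where z: "z \<in> {real_of_int i - 1/2 .. real_of_int i + 1/2} \<times> {?y}" "z \<in> J"
    using connected_same[of "{real_of_int i - 1/2 .. real_of_int i + 1/2} \<times> {?y}" "(real_of_int i + 1/2, ?y)" "(real_of_int (i - 1) + 1/2, ?y)"] assms
    by (auto simp: inn_def intro!: connected_Times)
  have zx: "real_of_int j < snd z" "snd z < real_of_int j + 1" using z(1) by auto
  obtain k where k: "k < n" "goes_up k \<or> goes_down k" "fst z = real_of_int (X k)" "min (Y k) (Y (Suc k)) \<le> j" "j < max (Y k) (Y (Suc k))"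
    using J_grid'[OF z(2) zx] .
  have "X k = i" using k(3) z(1) by auto
  then show ?thesis using that k by (auto simp: goes_defs)
qed

lemma inn_bounded: "\<exists>B. \<forall>i j. inn i j \<longrightarrow> j < B"
proof -
  obtain B where B: "\<And>p. p \<in> inside J \<Longrightarrow> norm p \<le> B" using J_facts(5) by (auto simp: bounded_iff)
  have "j < \<lceil>B\<rceil>" if "inn i j" for i j
  proof -
    have "\<bar>real_of_int j + 1/2\<bar> \<le> B" using B[of "(real_of_int i + 1/2, real_of_int j + 1/2)"] that norm_snd_le[where x = "real_of_int i + 1/2" and y = "real_of_int j + 1/2"] unfolding inn_def by force
    then show ?thesis by linarith
  qed
  then show ?thesis by blast
qed

section \<open>Feasible and stable locations on the grid\<close>

lemma hole_closure: "hole J = closure (inside J)"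
  using J_facts(3,6) by (metis closure_Un_frontier hole_def sup_commute)

lemma cell_closure: "closure (unit_square i j) = {real_of_int i .. real_of_int i + 1} \<times> {real_of_int j .. real_of_int j + 1}"
  by (simp add: unit_square_def closure_Times)

text \<open>The index ranges are the cells whose interior the rectangle meets: \<open>w\<close>
  columns at an integral abscissa, \<open>w + 1\<close> otherwise. Conversely the rectangle is
  covered by the closures of these cells, and the hole is the closure of the inside.\<close>

lemma feasible_iff:
  assumes w: "0 < w" and h: "0 < h"
  shows "feasible (hole J) (real_of_int w) (real_of_int h) p \<longleftrightarrow>
    (\<forall>i\<in>{\<lfloor>fst p\<rfloor>..<\<lceil>fst p\<rceil> + w}. \<forall>j\<in>{\<lfloor>snd p\<rfloor>..<\<lceil>snd p\<rceil> + h}. inn i j)"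
proof
  assume f: "feasible (hole J) (real_of_int w) (real_of_int h) p"
  have mid: "\<exists>t. real_of_int i < t \<and> t < real_of_int i + 1 \<and> a \<le> t \<and> t \<le> a + real_of_int w" if "i \<in> {\<lfloor>a\<rfloor>..<\<lceil>a\<rceil> + w}" "0 < w" for a i w
  proof -
    have "max (real_of_int i) a < min (real_of_int i + 1) (a + real_of_int w)"
      using that by (auto simp: min_def max_def) linarith+
    then obtain t where "max (real_of_int i) a < t" "t < min (real_of_int i + 1) (a + real_of_int w)" using dense by blast
    then show ?thesis by (intro exI[of _ t]) auto
  qed
  show "\<forall>i\<in>{\<lfloor>fst p\<rfloor>..<\<lceil>fst p\<rceil> + w}. \<forall>j\<in>{\<lfloor>snd p\<rfloor>..<\<lceil>snd p\<rceil> + h}. inn i j"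
  proof (intro ballI)
    fix i j assume i: "i \<in> {\<lfloor>fst p\<rfloor>..<\<lceil>fst p\<rceil> + w}" and j: "j \<in> {\<lfloor>snd p\<rfloor>..<\<lceil>snd p\<rceil> + h}"
    obtain s t where s: "real_of_int i < s" "s < real_of_int i + 1" "fst p \<le> s" "s \<le> fst p + real_of_int w"
      and t: "real_of_int j < t" "t < real_of_int j + 1" "snd p \<le> t" "t \<le> snd p + real_of_int h"
      using mid[OF i w] mid[OF j h] by blast
    have "(s, t) \<in> hole J" using f s t by (auto simp: feasible_def)
    moreover have c: "(s, t) \<in> unit_square i j" using s t by (simp add: unit_square_def)
    ultimately have "(s, t) \<in> inside J" using cell_off_J unfolding hole_def by blast
    then show "inn i j" using cell_inside[OF c] by simp
  qed
next
  assume a: "\<forall>i\<in>{\<lfloor>fst p\<rfloor>..<\<lceil>fst p\<rceil> + w}. \<forall>j\<in>{\<lfloor>snd p\<rfloor>..<\<lceil>snd p\<rceil> + h}. inn i j"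
  have near: "\<exists>i\<in>{\<lfloor>a\<rfloor>..<\<lceil>a\<rceil> + w}. real_of_int i \<le> t \<and> t \<le> real_of_int i + 1" if "a \<le> t" "t \<le> a + real_of_int w" "0 < w" for a t w
  proof (cases "\<lfloor>t\<rfloor> < \<lceil>a\<rceil> + w")
    case True
    then show ?thesis using that by (intro bexI[of _ "\<lfloor>t\<rfloor>"]) (auto simp: floor_mono)
  next
    case False
    \<comment> \<open>Here \<open>t\<close> is the right border of an integral placement, so the
      cell on its left must serve.\<close>
    then have "\<lfloor>t\<rfloor> = \<lceil>a\<rceil> + w" "t = real_of_int (\<lceil>a\<rceil> + w)" using that by linarith+
    then show ?thesis using that by (intro bexI[of _ "\<lceil>a\<rceil> + w - 1"]) (auto, linarith+)
  qed
  show "feasible (hole J) (real_of_int w) (real_of_int h) p"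
    unfolding feasible_def
  proof
    fix q assume q: "q \<in> {fst p..fst p + real_of_int w} \<times> {snd p..snd p + real_of_int h}"
    have q': "fst p \<le> fst q" "fst q \<le> fst p + real_of_int w" "snd p \<le> snd q" "snd q \<le> snd p + real_of_int h" using q by auto
    obtain i where i: "i \<in> {\<lfloor>fst p\<rfloor>..<\<lceil>fst p\<rceil> + w}" "real_of_int i \<le> fst q" "fst q \<le> real_of_int i + 1"
      using near[OF q'(1,2) w] by blast
    obtain j where j: "j \<in> {\<lfloor>snd p\<rfloor>..<\<lceil>snd p\<rceil> + h}" "real_of_int j \<le> snd q" "snd q \<le> real_of_int j + 1"
      using near[OF q'(3,4) h] by blast
    have "unit_square i j \<subseteq> inside J" using a i(1) j(1) cell_inside by blast
    then have "closure (unit_square i j) \<subseteq> hole J" unfolding hole_closure by (rule closure_mono)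
    moreover have "q \<in> closure (unit_square i j)" unfolding cell_closure using i j by (cases q) auto
    ultimately show "q \<in> hole J" by blast
  qed
qed

definition grid_stable :: "int \<Rightarrow> int \<Rightarrow> int \<Rightarrow> int \<Rightarrow> bool" where
  "grid_stable w h a b \<longleftrightarrow> (\<forall>i\<in>{a..<a+w}. \<forall>j\<in>{b..<b+h}. inn i j) \<and>
     (\<exists>j\<in>{b..<b+h}. \<not> inn (a - 1) j) \<and> (\<exists>i\<in>{a..<a+w}. \<not> inn i (b - 1))"

text \<open>Feasibility depends on floors and ceilings only. Sliding a nonintegral coordinate a
  little changes neither, so stable locations are integral; sliding an integral one adds exactly one
  column or row of cells.\<close>

lemma bl_stable_iff:
  assumes w: "0 < w" and h: "0 < h"
  shows "{p. bl_stable (hole J) (real_of_int w) (real_of_int h) p} = pt ` {(a, b). grid_stable w h a b}"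
proof -
  let ?F = "feasible (hole J) (real_of_int w) (real_of_int h)"
  note fi = feasible_iff[OF w h]
  have shift: "\<lfloor>real_of_int a - t\<rfloor> = a - 1" "\<lceil>real_of_int a - t\<rceil> = a" if "0 < t" "t < 1" for a t
    using that by linarith+
  have frac: "\<exists>\<delta>>0. \<forall>t. 0 < t \<and> t < \<delta> \<longrightarrow> \<lfloor>c - t\<rfloor> = \<lfloor>c\<rfloor> \<and> \<lceil>c - t\<rceil> = \<lceil>c\<rceil>" if "c \<noteq> real_of_int \<lfloor>c\<rfloor>" for c :: real
  proof (intro exI[of _ "c - real_of_int \<lfloor>c\<rfloor>"] conjI allI impI)
    show "0 < c - real_of_int \<lfloor>c\<rfloor>" using that by linarith
    fix t assume "0 < t \<and> t < c - real_of_int \<lfloor>c\<rfloor>"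
    moreover from this have "\<lceil>c - t\<rceil> = \<lfloor>c\<rfloor> + 1" "\<lceil>c\<rceil> = \<lfloor>c\<rfloor> + 1" by linarith+
    ultimately show "\<lfloor>c - t\<rfloor> = \<lfloor>c\<rfloor>" "\<lceil>c - t\<rceil> = \<lceil>c\<rceil>" by linarith+
  qed
  have st: "bl_stable (hole J) (real_of_int w) (real_of_int h) (pt (a, b)) \<longleftrightarrow> grid_stable w h a b" for a b
  proof -
    have F: "?F (pt (a, b)) \<longleftrightarrow> (\<forall>i\<in>{a..<a+w}. \<forall>j\<in>{b..<b+h}. inn i j)" unfolding fi by (simp add: pt_def)
    have F1: "?F (real_of_int a - t, real_of_int b) \<longleftrightarrow> (\<forall>i\<in>{a-1..<a+w}. \<forall>j\<in>{b..<b+h}. inn i j)" if "0 < t" "t < 1" for t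
      unfolding fi using shift[OF that] by simp
    have F2: "?F (real_of_int a, real_of_int b - t) \<longleftrightarrow> (\<forall>i\<in>{a..<a+w}. \<forall>j\<in>{b-1..<b+h}. inn i j)" if "0 < t" "t < 1" for t
      unfolding fi using shift[OF that] by simp
    have e1: "{a-1..<a+w} = insert (a-1) {a..<a+w}" "{b-1..<b+h} = insert (b-1) {b..<b+h}" using w h by auto
    show ?thesis
    proof
      assume s: "bl_stable (hole J) (real_of_int w) (real_of_int h) (pt (a, b))"
      then obtain e where e: "e > 0" "\<And>t. 0 < t \<Longrightarrow> t < e \<Longrightarrow> \<not> ?F (real_of_int a - t, real_of_int b) \<and> \<not> ?F (real_of_int a, real_of_int b - t)"
        unfolding bl_stable_def by (auto simp: pt_def)
      obtain t :: real where t: "0 < t" "t < e" "t < 1" using e(1) field_lbound_gt_zero[of e 1] by auto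
      have f: "\<forall>i\<in>{a..<a+w}. \<forall>j\<in>{b..<b+h}. inn i j" using s F unfolding bl_stable_def by blast
      show "grid_stable w h a b" using e(2)[OF t(1,2)] f unfolding F1[OF t(1,3)] F2[OF t(1,3)] e1 grid_stable_def by blast
    next
      assume g: "grid_stable w h a b"
      have "\<not> ?F (real_of_int a - t, real_of_int b) \<and> \<not> ?F (real_of_int a, real_of_int b - t)" if "0 < t" "t < 1" for t
        using g unfolding F1[OF that] F2[OF that] e1 grid_stable_def by blast
      moreover have "?F (pt (a, b))" using g unfolding F grid_stable_def by blast
      ultimately show "bl_stable (hole J) (real_of_int w) (real_of_int h) (pt (a, b))"
        unfolding bl_stable_def by (intro conjI exI[of _ 1]) (auto simp: pt_def)
    qed
  qed
  have int: "p = pt (\<lfloor>fst p\<rfloor>, \<lfloor>snd p\<rfloor>)" if s: "bl_stable (hole J) (real_of_int w) (real_of_int h) p" for p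
  proof -
    obtain e where e: "e > 0" "\<And>t. 0 < t \<Longrightarrow> t < e \<Longrightarrow> \<not> ?F (fst p - t, snd p) \<and> \<not> ?F (fst p, snd p - t)" and F: "?F p"
      using s unfolding bl_stable_def by blast
    have "fst p = real_of_int \<lfloor>fst p\<rfloor>"
    proof (rule ccontr)
      assume "fst p \<noteq> real_of_int \<lfloor>fst p\<rfloor>"
      then obtain d where d: "d > 0" "\<forall>t. 0 < t \<and> t < d \<longrightarrow> \<lfloor>fst p - t\<rfloor> = \<lfloor>fst p\<rfloor> \<and> \<lceil>fst p - t\<rceil> = \<lceil>fst p\<rceil>" using frac by blast
      obtain t where t: "0 < t" "t < d" "t < e" using d(1) e(1) field_lbound_gt_zero by metis
      have "?F (fst p - t, snd p)" using F d(2) t unfolding fi by simp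
      then show False using e(2) t by blast
    qed
    moreover have "snd p = real_of_int \<lfloor>snd p\<rfloor>"
    proof (rule ccontr)
      assume "snd p \<noteq> real_of_int \<lfloor>snd p\<rfloor>"
      then obtain d where d: "d > 0" "\<forall>t. 0 < t \<and> t < d \<longrightarrow> \<lfloor>snd p - t\<rfloor> = \<lfloor>snd p\<rfloor> \<and> \<lceil>snd p - t\<rceil> = \<lceil>snd p\<rceil>" using frac by blast
      obtain t where t: "0 < t" "t < d" "t < e" using d(1) e(1) field_lbound_gt_zero by metis
      have "?F (fst p, snd p - t)" using F d(2) t unfolding fi by simp
      then show False using e(2) t by blast
    qed
    ultimately show ?thesis by (simp add: pt_def prod_eq_iff)
  qed
  show ?thesis
  proof (intro set_eqI iffI)
    fix p assume p: "p \<in> {p. bl_stable (hole J) (real_of_int w) (real_of_int h) p}"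
    have "grid_stable w h \<lfloor>fst p\<rfloor> \<lfloor>snd p\<rfloor>" using p int[of p] st[of "\<lfloor>fst p\<rfloor>" "\<lfloor>snd p\<rfloor>"] by simp
    then show "p \<in> pt ` {(a, b). grid_stable w h a b}" using int[of p] p by blast
  next
    fix p assume "p \<in> pt ` {(a, b). grid_stable w h a b}"
    then show "p \<in> {p. bl_stable (hole J) (real_of_int w) (real_of_int h) p}" using st by auto
  qed
qed

end

section \<open>Notches and the rightmost edge\<close>

context vertex_list
begin

text \<open>Transfers connectedness from the inside to the adjacency graph of its cells: whether the
  cell of a point belongs to \<open>S\<close> is locally constant on the inside.\<close>

lemma cells_connected:
  assumes ab: "(a, b) \<in> S" "inn a b"
    and cl: "\<And>i j i' j'. (i, j) \<in> S \<Longrightarrow> inn i j \<Longrightarrow> inn i' j' \<Longrightarrow> \<bar>i' - i\<bar> + \<bar>j' - j\<bar> = 1 \<Longrightarrow> (i', j') \<in> S"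
    and ij: "inn i j"
  shows "(i, j) \<in> S"
proof -
  let ?f = "\<lambda>p :: point. (\<lfloor>fst p\<rfloor>, \<lfloor>snd p\<rfloor>) \<in> S"
  have loc: "\<forall>\<^sub>F q in at p within inside J. ?f p = ?f q" if p: "p \<in> inside J" for p
  proof -
    obtain e where e: "e > 0" "ball p e \<subseteq> inside J" using p J_facts(3) open_contains_ball by blast
    have tiny: "\<exists>\<delta>>0. \<forall>t. 0 < t \<and> t < \<delta> \<longrightarrow> real_of_int \<lceil>c\<rceil> - 1 < c - t \<and> c + t < real_of_int \<lfloor>c\<rfloor> + 1" for c :: real
      by (rule exI[of _ "min (c - (real_of_int \<lceil>c\<rceil> - 1)) (real_of_int \<lfloor>c\<rfloor> + 1 - c)"]) (auto, linarith+)
    obtain d1 d2 where d1: "d1 > 0" "\<forall>t. 0 < t \<and> t < d1 \<longrightarrow> real_of_int \<lceil>fst p\<rceil> - 1 < fst p - t \<and> fst p + t < real_of_int \<lfloor>fst p\<rfloor> + 1"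
      and d2: "d2 > 0" "\<forall>t. 0 < t \<and> t < d2 \<longrightarrow> real_of_int \<lceil>snd p\<rceil> - 1 < snd p - t \<and> snd p + t < real_of_int \<lfloor>snd p\<rfloor> + 1"
      using tiny[of "fst p"] tiny[of "snd p"] by (elim exE conjE) (rule that)
    define t where "t = min (e / 2) (min d1 d2) / 2"
    have t: "0 < t" "t < d1" "t < d2" "2 * t < e" using e(1) d1(1) d2(1) by (auto simp: t_def min_def)
    \<comment> \<open>\<open>\<lceil>c\<rceil> - 1\<close> and \<open>\<lfloor>c\<rfloor>\<close>
      index the cells touching a coordinate \<open>c\<close>, two if it is integral and one
      otherwise. All cells touching an inside point belong to the hole.\<close>
    have inn: "inn i j" if i: "i \<in> {\<lceil>fst p\<rceil> - 1, \<lfloor>fst p\<rfloor>}" and j: "j \<in> {\<lceil>snd p\<rceil> - 1, \<lfloor>snd p\<rfloor>}" for i j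
    proof -
      have near: "\<exists>\<sigma>\<in>{1, -1}. real_of_int k < c + \<sigma> * t \<and> c + \<sigma> * t < real_of_int k + 1"
        if "k \<in> {\<lceil>c\<rceil> - 1, \<lfloor>c\<rfloor>}" "real_of_int \<lceil>c\<rceil> - 1 < c - t \<and> c + t < real_of_int \<lfloor>c\<rfloor> + 1" for k c
      proof (cases "k = \<lfloor>c\<rfloor>")
        case True
        then show ?thesis using that t(1) by (intro bexI[of _ 1]) (auto, linarith+)
      next
        case False
        then show ?thesis using that t(1) by (intro bexI[of _ "-1"]) (auto, linarith+)
      qed
      obtain \<sigma> \<tau> where s: "\<sigma> \<in> {1, -1}" "real_of_int i < fst p + \<sigma> * t" "fst p + \<sigma> * t < real_of_int i + 1"
        and u: "\<tau> \<in> {1, -1}" "real_of_int j < snd p + \<tau> * t" "snd p + \<tau> * t < real_of_int j + 1"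
        using near[OF i] near[OF j] d1(2) d2(2) t by blast
      let ?q = "(fst p + \<sigma> * t, snd p + \<tau> * t)"
      have "dist p ?q = norm (\<sigma> * t, \<tau> * t)" by (cases p) (simp add: dist_norm norm_minus_commute norm_Pair)
      also have "\<dots> \<le> norm (\<sigma> * t) + norm (\<tau> * t)" by (rule norm_Pair_le)
      also have "\<dots> < e" using s(1) u(1) t by (auto simp: abs_mult)
      finally have "?q \<in> inside J" using e(2) by auto
      moreover have "?q \<in> unit_square i j" using s u by (simp add: unit_square_def)
      ultimately show ?thesis using cell_inside by blast
    qed
    have same: "(i, j) \<in> S \<longleftrightarrow> (i', j') \<in> S"
      if "i \<in> {\<lceil>fst p\<rceil> - 1, \<lfloor>fst p\<rfloor>}" "i' \<in> {\<lceil>fst p\<rceil> - 1, \<lfloor>fst p\<rfloor>}" "j \<in> {\<lceil>snd p\<rceil> - 1, \<lfloor>snd p\<rfloor>}" "j' \<in> {\<lceil>snd p\<rceil> - 1, \<lfloor>snd p\<rfloor>}" for i j i' j'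
    proof -
      have ii: "i' = i \<or> \<bar>i' - i\<bar> = 1" using that(1,2) by auto linarith+
      have jj: "j' = j \<or> \<bar>j' - j\<bar> = 1" using that(3,4) by auto linarith+
      have "(i, j) \<in> S \<longleftrightarrow> (i', j) \<in> S"
        using ii cl[of i j i' j] cl[of i' j i j] inn[OF that(1,3)] inn[OF that(2,3)] by (auto simp: abs_minus_commute)
      also have "\<dots> \<longleftrightarrow> (i', j') \<in> S"
        using jj cl[of i' j i' j'] cl[of i' j' i' j] inn[OF that(2,3)] inn[OF that(2,4)] by (auto simp: abs_minus_commute)
      finally show ?thesis .
    qed
    let ?N = "{real_of_int \<lceil>fst p\<rceil> - 1 <..< real_of_int \<lfloor>fst p\<rfloor> + 1} \<times> {real_of_int \<lceil>snd p\<rceil> - 1 <..< real_of_int \<lfloor>snd p\<rfloor> + 1}"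
    have "open ?N" by (intro open_Times) auto
    moreover have "p \<in> ?N" by (cases p) (auto, linarith+)
    moreover have "?f p = ?f q" if "q \<in> ?N" for q
    proof -
      have "real_of_int \<lceil>fst p\<rceil> - 1 < fst q" "fst q < real_of_int \<lfloor>fst p\<rfloor> + 1" "real_of_int \<lceil>snd p\<rceil> - 1 < snd q" "snd q < real_of_int \<lfloor>snd p\<rfloor> + 1"
        using that by auto
      then have "\<lfloor>fst q\<rfloor> \<in> {\<lceil>fst p\<rceil> - 1, \<lfloor>fst p\<rfloor>}" "\<lfloor>snd q\<rfloor> \<in> {\<lceil>snd p\<rceil> - 1, \<lfloor>snd p\<rfloor>}" by (simp; linarith)+
      then show ?thesis using same[of "\<lfloor>fst p\<rfloor>" "\<lfloor>fst q\<rfloor>" "\<lfloor>snd p\<rfloor>" "\<lfloor>snd q\<rfloor>"] by blast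
    qed
    ultimately show ?thesis unfolding eventually_at_topological by blast
  qed
  let ?c = "\<lambda>i j. (real_of_int i + 1/2, real_of_int j + 1/2)"
  have fl: "\<lfloor>real_of_int k + 1/2\<rfloor> = k" for k by linarith
  have "?f (?c a b) = ?f (?c i j)"
    using connected_local_const[of "inside J" "?c a b" "?c i j" ?f] J_facts(4) loc ab(2) ij unfolding inn_def by blast
  then show ?thesis using ab(1) unfolding fst_conv snd_conv fl by simp
qed

section \<open>Turns of the boundary at notches, corners and the rightmost edge\<close>

lemma interior_side: "interior_on J (vx k) (vx (Suc k)) (snd (dir k), - fst (dir k))"
  unfolding interior_on_def
proof
  fix z assume "z \<in> open_segment (vx k) (vx (Suc k))"
  from side_jump[OF this refl] show "\<exists>\<epsilon>>0. \<forall>t. 0 < t \<and> t < \<epsilon> \<longrightarrow> z + t *\<^sub>R (snd (dir k), - fst (dir k)) \<in> inside J" by blast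
qed

lemma right_notchI:
  assumes "goes_left k" "goes_down (Suc k)" "goes_right (Suc (Suc k))"
  shows "right_notch J (vx (Suc k)) (vx (Suc (Suc k)))"
proof -
  have "interior_on J (vx (Suc k)) (vx (Suc (Suc k))) (-1, 0)"
    using interior_side[of "Suc k"] assms(2) unfolding goes_dir by simp
  moreover have "snd (vx k) = snd (vx (Suc k))" "fst (vx k) > fst (vx (Suc k))"
    "snd (vx (Suc (Suc (Suc k)))) = snd (vx (Suc (Suc k)))" "fst (vx (Suc (Suc (Suc k)))) > fst (vx (Suc (Suc k)))"
    "fst (vx (Suc k)) = fst (vx (Suc (Suc k)))"
    using assms by (auto simp: goes_defs vx_XY)
  ultimately show ?thesis unfolding right_notch_def adjacent_right_def using edge by blast
qed

lemma top_notchI: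
  assumes "goes_down k" "goes_right (Suc k)" "goes_up (Suc (Suc k))"
  shows "top_notch J (vx (Suc k)) (vx (Suc (Suc k)))"
proof -
  have "interior_on J (vx (Suc k)) (vx (Suc (Suc k))) (0, -1)"
    using interior_side[of "Suc k"] assms(2) unfolding goes_dir by simp
  moreover have "fst (vx k) = fst (vx (Suc k))" "snd (vx k) > snd (vx (Suc k))"
    "fst (vx (Suc (Suc (Suc k)))) = fst (vx (Suc (Suc k)))" "snd (vx (Suc (Suc (Suc k)))) > snd (vx (Suc (Suc k)))"
    "snd (vx (Suc k)) = snd (vx (Suc (Suc k)))"
    using assms by (auto simp: goes_defs vx_XY)
  ultimately show ?thesis unfolding top_notch_def adjacent_above_def using edge by blast
qed

lemma falling_corner_iff: "falling_corner J v \<longleftrightarrow> (\<exists>k. v = vx (Suc k) \<and> goes_down k \<and> goes_right (Suc k))"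
proof
  assume f: "falling_corner J v"
  then obtain u w where u: "cw_edge J u v" "fst u = fst v" "snd v < snd u" and w: "cw_edge J v w" "snd w = snd v" "fst v < fst w"
    unfolding falling_corner_def by blast
  obtain i where i: "u = vx i" "v = vx (Suc i)" using cw_edge_listed[OF u(1)] .
  obtain j where j: "v = vx j" "w = vx (Suc j)" using cw_edge_listed[OF w(1)] .
  have "goes_down i" "goes_right j" using u w i unfolding j by (auto simp: goes_defs vx_XY)
  moreover have "Suc i mod n = j mod n" using i(2) j(1) vx_eq_iff by metis
  ultimately show "\<exists>k. v = vx (Suc k) \<and> goes_down k \<and> goes_right (Suc k)" using i(2) goes_cong(1) by blast
next
  assume "\<exists>k. v = vx (Suc k) \<and> goes_down k \<and> goes_right (Suc k)"
  then obtain k where k: "v = vx (Suc k)" "goes_down k" "goes_right (Suc k)" by blast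
  have "fst (vx k) = fst v" "snd v < snd (vx k)" "snd (vx (Suc (Suc k))) = snd v" "fst v < fst (vx (Suc (Suc k)))"
    using k by (auto simp: goes_defs vx_XY)
  then show "falling_corner J v" unfolding falling_corner_def using cw[of k] cw[of "Suc k"] k(1) by blast
qed

lemma rightmost_edgeD:
  assumes "rightmost_edge J (vx (Suc k)) (vx (Suc (Suc k)))"
  shows "goes_right k" "goes_down (Suc k)" "goes_left (Suc (Suc k))"
proof -
  have v: "fst (vx (Suc k)) = fst (vx (Suc (Suc k)))" and io: "interior_on J (vx (Suc k)) (vx (Suc (Suc k))) (-1, 0)"
    using assms by (auto simp: rightmost_edge_def adjacent_left_def)
  obtain p where p: "is_edge J p (vx (Suc k))" "snd p = snd (vx (Suc k))" "fst p < fst (vx (Suc k))"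
    using assms by (auto simp: rightmost_edge_def adjacent_left_def)
  obtain q where q: "is_edge J (vx (Suc (Suc k))) q" "snd q = snd (vx (Suc (Suc k)))" "fst q < fst (vx (Suc (Suc k)))"
    using assms by (auto simp: rightmost_edge_def adjacent_left_def)
  have "p = vx k" using edge_from_vx[of k p] p v is_edge_commute by (metis less_irrefl)
  then show "goes_right k" using p by (auto simp: goes_defs vx_XY)
  have "q = vx (Suc (Suc (Suc k)))" using edge_from_vx[OF q(1)] q v by (metis less_irrefl)
  then show "goes_left (Suc (Suc k))" using q by (auto simp: goes_defs vx_XY)
  have "\<not> goes_up (Suc k)"
  proof
    assume u: "goes_up (Suc k)"
    let ?z = "midpoint (vx (Suc k)) (vx (Suc (Suc k)))"
    have z: "?z \<in> open_segment (vx (Suc k)) (vx (Suc (Suc k)))" using edge[of "Suc k"] by (simp add: midpoint_in_open_segment is_edge_def)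
    have m: "(1, 0) = (snd (dir (Suc k)), - fst (dir (Suc k)))" using u by (simp add: goes_dir)
    obtain e where e: "e > 0" "\<forall>t. 0 < t \<and> t < e \<longrightarrow> ?z + t *\<^sub>R (1, 0) \<in> inside J \<and> ?z - t *\<^sub>R (1, 0) \<notin> inside J"
      using side_jump[OF z m] by blast
    obtain f where f: "f > 0" "\<forall>t. 0 < t \<and> t < f \<longrightarrow> ?z + t *\<^sub>R (-1, 0) \<in> inside J"
      using io z unfolding interior_on_def by blast
    obtain t where t: "0 < t" "t < e" "t < f" using e(1) f(1) field_lbound_gt_zero by metis
    have "?z + t *\<^sub>R (-1, 0) = ?z - t *\<^sub>R (1, 0)" by (simp add: prod_eq_iff)
    then show False using e(2) f(2) t by metis
  qed
  then show "goes_down (Suc k)" using goes_turn[of k] \<open>goes_right k\<close> by blast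
qed

lemma predE:
  obtains k' where "Suc k' mod n = k mod n"
  by (rule that[of "k + n - 1"]) (use n_pos in simp)

text \<open>A gap between two eastern neighbours is bounded on its left by a downward edge. As the
  whole run in column \<open>c\<close> is inside, neither horizontal neighbour of that edge can
  extend to the left, so it is a right notch.\<close>

lemma east_interval:
  assumes no: "\<nexists>a b. right_notch J a b"
    and col: "\<And>q. r \<le> q \<Longrightarrow> q \<le> r' \<Longrightarrow> inn c q" and ends: "inn (c + 1) r" "inn (c + 1) r'" and q: "r \<le> q" "q \<le> r'"
  shows "inn (c + 1) q"
proof (rule ccontr)
  assume nq: "\<not> inn (c + 1) q"
  then have "inn (c + 1) q \<noteq> inn (c + 1 - 1) q" using col q by simp
  then obtain k0 where k0: "X k0 = c + 1" "goes_up k0 \<and> Y k0 \<le> q \<and> q < Y (Suc k0) \<or> goes_down k0 \<and> Y (Suc k0) \<le> q \<and> q < Y k0"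
    using inn_change_horizontal by metis
  then have k0': "goes_down k0" "Y (Suc k0) \<le> q" "q < Y k0" using jump_up[of k0 q] nq by auto
  obtain k where k: "Suc k mod n = k0 mod n" using predE .
  have D: "goes_down (Suc k)" and x: "X (Suc k) = c + 1" and y: "Y (Suc k) = Y k0" and y': "Y (Suc (Suc k)) = Y (Suc k0)"
    using goes_cong[OF k] k0(1) k0' vx_Suc_cong[OF k] by (auto simp: vx_XY)
  have x': "X (Suc (Suc k)) = c + 1" using D x by (simp add: goes_defs)
  have yr: "r < Y (Suc (Suc k))" using jump_down[OF D, of r] ends(1) k0' q x y y' by fastforce
  have yr': "Y (Suc k) \<le> r'" using jump_down[OF D, of r'] ends(2) k0' q x y y' by fastforce
  have "\<not> goes_right k" using jump_right[of k c] col[of "Y k"] x yr' k0' q y by (auto simp: goes_defs)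
  then have L: "goes_left k" using goes_turn[of k] D by blast
  have "\<not> goes_left (Suc (Suc k))" using jump_left[of "Suc (Suc k)" c] col[of "Y (Suc (Suc k)) - 1"] x' yr k0' q y' by (auto simp: goes_defs)
  moreover have "goes_right (Suc (Suc k)) \<or> goes_left (Suc (Suc k))"
    using goes_turn[of "Suc k"] goes_cases[of "Suc (Suc k)"] D by (auto simp: goes_dir)
  ultimately have "goes_right (Suc (Suc k))" by blast
  then show False using right_notchI[OF L D] no by blast
qed

text \<open>Without right notch, a vertical run of cells has at most one neighbouring run to the east.
  Since the cells are connected, all of them can therefore reach any given run that has no
  eastern neighbour, by vertical and eastward steps.\<close>

definition east_step :: "((int \<times> int) \<times> (int \<times> int)) set" where
  "east_step = {((c, r), (c', r')). inn c r \<and> inn c' r' \<and> (c' = c \<and> \<bar>r' - r\<bar> = 1 \<or> c' = c + 1 \<and> r' = r)}"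

lemma column_path:
  assumes "\<And>q. min r r' \<le> q \<Longrightarrow> q \<le> max r r' \<Longrightarrow> inn c q"
  shows "((c, r), (c, r')) \<in> east_step\<^sup>*"
proof -
  have "((c, r), (c, r + \<sigma> * int m)) \<in> east_step\<^sup>*" if "\<sigma> \<in> {1, -1}" "r' = r + \<sigma> * int l" "m \<le> l" for \<sigma> l m
    using that(3)
  proof (induction m)
    case (Suc m)
    have "inn c (r + \<sigma> * int m)" "inn c (r + \<sigma> * int (Suc m))" using that Suc.prems by (intro assms; auto)+
    then have "((c, r + \<sigma> * int m), (c, r + \<sigma> * int (Suc m))) \<in> east_step" using that(1) by (auto simp: east_step_def algebra_simps)
    then show ?case using Suc by (meson Suc_leD rtrancl.rtrancl_into_rtrancl)
  qed simp
  from this[of 1 "nat (r' - r)" "nat (r' - r)"] this[of "-1" "nat (r - r')" "nat (r - r')"] show ?thesis by (cases "r \<le> r'") auto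
qed

lemma dead_end_reached:
  assumes no: "\<nexists>a b. right_notch J a b" and K: "K \<noteq> {}" "\<And>p. p \<in> K \<Longrightarrow> inn (fst p) (snd p)" "\<And>p p'. p \<in> K \<Longrightarrow> (p, p') \<in> east_step \<Longrightarrow> p' \<in> K"
    and ij: "inn i j"
  shows "\<exists>p\<in>K. ((i, j), p) \<in> east_step\<^sup>*"
proof -
  define S where "S = {p. \<exists>p'\<in>K. (p, p') \<in> east_step\<^sup>*}"
  have Kcl: "p' \<in> K" if "(p, p') \<in> east_step\<^sup>*" "p \<in> K" for p p' using that by (induction rule: rtrancl_induct) (use K(3) in blast)+
  have Sstep: "p \<in> S" if "(p, p') \<in> east_step" "p' \<in> S" for p p' using that by (auto simp: S_def intro: converse_rtrancl_into_rtrancl)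
  have Spath: "p \<in> S" if "(p, p') \<in> east_step\<^sup>*" "p' \<in> S" for p p' using that by (auto simp: S_def intro: rtrancl_trans)
  have KS: "K \<subseteq> S" by (auto simp: S_def)
  \<comment> \<open>\<open>r'\<close> is the row in which the path leaves the column eastwards, or
    one in which it has reached \<open>K\<close> within the column.\<close>
  have run: "\<exists>r'. (\<forall>q. min (snd p) r' \<le> q \<and> q \<le> max (snd p) r' \<longrightarrow> inn (fst p) q) \<and> ((fst p, r') \<in> K \<or> inn (fst p + 1) r' \<and> (fst p + 1, r') \<in> S)"
    if "(p, p') \<in> east_step\<^sup>*" "p' \<in> K" for p p'
    using that
  proof (induction rule: converse_rtrancl_induct)
    case base
    then show ?case using K(2)[of p'] by (intro exI[of _ "snd p'"]) auto
  next
    case (step p p1)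
    obtain c r c1 r1 where p: "p = (c, r)" "p1 = (c1, r1)" by fastforce
    have st: "inn c r" "inn c1 r1" "c1 = c \<and> \<bar>r1 - r\<bar> = 1 \<or> c1 = c + 1 \<and> r1 = r" using step(1) by (auto simp: east_step_def p)
    have p1S: "p1 \<in> S" using step(2,4) by (auto simp: S_def)
    from st(3) show ?case
    proof
      assume v: "c1 = c \<and> \<bar>r1 - r\<bar> = 1"
      obtain r' where r': "\<forall>q. min r1 r' \<le> q \<and> q \<le> max r1 r' \<longrightarrow> inn c q" "(c, r') \<in> K \<or> inn (c + 1) r' \<and> (c + 1, r') \<in> S"
        using step.IH[OF step(4)] v by (auto simp: p)
      have "inn c q" if "min r r' \<le> q" "q \<le> max r r'" for q
      proof (cases "q = r")
        case False
        then have "min r1 r' \<le> q \<and> q \<le> max r1 r'" using v that by linarith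
        then show ?thesis using r'(1) by blast
      qed (use st(1) in simp)
      then show ?thesis using r'(2) by (auto simp: p)
    next
      assume e: "c1 = c + 1 \<and> r1 = r"
      then show ?thesis using st(1,2) p1S by (intro exI[of _ r]) (auto simp: p)
    qed
  qed
  \<comment> \<open>The only critical direction: a vertical or western neighbour of a cell of
    \<open>S\<close> reaches that cell by a single step.\<close>
  have east: "(c + 1, r) \<in> S" if cr: "(c, r) \<in> S" "inn c r" "inn (c + 1) r" for c r
  proof -
    obtain p' where "((c, r), p') \<in> east_step\<^sup>*" "p' \<in> K" using cr(1) unfolding S_def by blast
    from run[OF this] obtain r' where r': "\<forall>q. min r r' \<le> q \<and> q \<le> max r r' \<longrightarrow> inn c q" "(c, r') \<in> K \<or> inn (c + 1) r' \<and> (c + 1, r') \<in> S"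
      unfolding fst_conv snd_conv by blast
    from r'(2) show ?thesis
    proof
      assume "(c, r') \<in> K"
      then have "(c, r) \<in> K" using Kcl column_path[of r' r c] r'(1) by (metis min.commute max.commute)
      moreover have "((c, r), (c + 1, r)) \<in> east_step" using cr by (auto simp: east_step_def)
      ultimately show ?thesis using K(3) KS by blast
    next
      assume e: "inn (c + 1) r' \<and> (c + 1, r') \<in> S"
      \<comment> \<open>The eastern neighbour of row \<open>r\<close> can now move vertically to the
        eastern cell through which the path continues.\<close>
      have "inn (c + 1) q" if "min r r' \<le> q" "q \<le> max r r'" for q
        by (rule east_interval[OF no, of "min r r'" "max r r'"]) (use r'(1) e cr that in \<open>auto simp: min_def max_def\<close>)
      then show ?thesis using Spath[OF column_path] e by blast
    qed
  qed
  obtain p0 where p0: "p0 \<in> K" using K(1) by blast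
  have "(i, j) \<in> S"
  proof (rule cells_connected[of "fst p0" "snd p0", OF _ _ _ ij])
    show "(fst p0, snd p0) \<in> S" using p0 KS by auto
    show "inn (fst p0) (snd p0)" using K(2) p0 by blast
    fix i j i' j' assume a: "(i, j) \<in> S" "inn i j" "inn i' j'" "\<bar>i' - i\<bar> + \<bar>j' - j\<bar> = 1"
    then consider "i' = i" "\<bar>j - j'\<bar> = 1" | "i = i' + 1" "j' = j" | "i' = i + 1" "j' = j" by linarith
    then show "(i', j') \<in> S"
    proof cases
      case 1 then show ?thesis using a by (auto simp: east_step_def intro!: Sstep[OF _ a(1)])
    next
      case 2 then show ?thesis using a by (auto simp: east_step_def intro!: Sstep[OF _ a(1)])
    next
      case 3 then show ?thesis using a east by simp
    qed
  qed
  then show ?thesis by (simp add: S_def)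
qed

text \<open>The cells just left of such an edge form a dead end, walled by the edge and its two
  horizontal neighbours. A path from one dead end must lead into the other but cannot leave its own,
  so they share a cell, and the edges a point that is not a common vertex of consecutive
  sides.\<close>

lemma rightmost_unique:
  assumes no: "\<nexists>a b. right_notch J a b"
    and i: "goes_right i" "goes_down (Suc i)" "goes_left (Suc (Suc i))"
    and j: "goes_right j" "goes_down (Suc j)" "goes_left (Suc (Suc j))"
  shows "Suc i mod n = Suc j mod n"
proof (rule ccontr)
  assume ne: "Suc i mod n \<noteq> Suc j mod n"
  define K where "K = (\<lambda>i. {(X (Suc i) - 1, r) | r. Y (Suc (Suc i)) \<le> r \<and> r < Y (Suc i)})"
  have K: "K i \<noteq> {}" "\<And>p. p \<in> K i \<Longrightarrow> inn (fst p) (snd p)" "\<And>p p'. p \<in> K i \<Longrightarrow> (p, p') \<in> east_step \<Longrightarrow> p' \<in> K i"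
    if i: "goes_right i" "goes_down (Suc i)" "goes_left (Suc (Suc i))" for i
  proof -
    show "K i \<noteq> {}" using i(2) by (auto simp: K_def goes_defs)
    show "inn (fst p) (snd p)" if "p \<in> K i" for p using that jump_down[OF i(2), of "snd p"] by (auto simp: K_def)
    fix p p' assume p: "p \<in> K i" "(p, p') \<in> east_step"
    obtain c r c' r' where e: "p = (c, r)" "p' = (c', r')" by fastforce
    have cr: "c = X (Suc i) - 1" "Y (Suc (Suc i)) \<le> r" "r < Y (Suc i)" using p(1) by (auto simp: K_def e)
    have st: "inn c' r'" "c' = c \<and> \<bar>r' - r\<bar> = 1 \<or> c' = c + 1 \<and> r' = r" using p(2) by (auto simp: east_step_def e)
    have v: "c' = c" "\<bar>r' - r\<bar> = 1" using jump_down[OF i(2), of r] cr st by auto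
    have "r' \<noteq> Y (Suc i)" using jump_right[OF i(1), of c] i(1) st cr v by (auto simp: goes_defs)
    moreover have "r' \<noteq> Y (Suc (Suc i)) - 1" using jump_left[OF i(3), of c] i(2,3) st cr v by (auto simp: goes_defs)
    ultimately have "Y (Suc (Suc i)) \<le> r'" "r' < Y (Suc i)" using v cr by linarith+
    then show "p' \<in> K i" using v cr by (auto simp: K_def e)
  qed
  obtain p where p: "p \<in> K i" using K(1)[OF i] by blast
  have "\<exists>p'\<in>K j. ((fst p, snd p), p') \<in> east_step\<^sup>*"
    by (rule dead_end_reached[OF no]) (use K(1,2)[OF j] K(3)[OF j] K(2)[OF i p] in blast)+
  then obtain p' where p': "p' \<in> K j" "(p, p') \<in> east_step\<^sup>*" by auto
  have "p' \<in> K i" using p'(2) p by (induction rule: rtrancl_induct) (use K(3)[OF i] in blast)+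
  then obtain r where r: "X (Suc i) = X (Suc j)" "Y (Suc (Suc i)) \<le> r" "r < Y (Suc i)" "Y (Suc (Suc j)) \<le> r" "r < Y (Suc j)"
    using p'(1) by (auto simp: K_def)
  have "pt (X (Suc i), r) \<in> side (Suc i)" "pt (X (Suc i), r) \<in> side (Suc j)"
    unfolding side_iff pt_def using r i(2) j(2) by (auto simp: goes_defs min_def max_def)
  then show False using sides_meet_int[OF _ _ ne] r by fastforce
qed

end

section \<open>The boundary of a BLS-hole as a chain\<close>

locale bls_list = vertex_list +
  fixes r0 :: nat
  assumes bls: "bls_hole J" and rightmost: "rightmost_edge J (vx r0) (vx (Suc r0))"
begin

abbreviation "gR k \<equiv> goes_right (Suc r0 + k)"
abbreviation "gL k \<equiv> goes_left (Suc r0 + k)"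
abbreviation "gU k \<equiv> goes_up (Suc r0 + k)"
abbreviation "gD k \<equiv> goes_down (Suc r0 + k)"

lemma Suc_add_mod: "Suc (i + n) mod n = Suc i mod n"
  using mod_add_self2[of "Suc i" n] by simp

text \<open>Adding \<open>a * (n - 1)\<close> undoes the offset \<open>a\<close> modulo
  \<open>n\<close> without subtraction.\<close>

lemma offset_cancel:
  assumes "(a + k) mod n = (a + k') mod n"
  shows "k mod n = k' mod n"
proof -
  have "(a + k + a * (n - 1)) mod n = (a + k' + a * (n - 1)) mod n" using assms by (metis mod_add_left_eq)
  moreover have "a + k + a * (n - 1) = k + a * n" for k using n_pos by (cases n) auto
  ultimately have "(k + a * n) mod n = (k' + a * n) mod n" by metis
  then show ?thesis by (simp only: mod_mult_self1)
qed

lemma offsetE: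
  obtains m where "m < n" "(Suc r0 + m) mod n = k mod n"
proof (rule that[of "(k + Suc r0 * (n - 1)) mod n"])
  show "(k + Suc r0 * (n - 1)) mod n < n" using n_pos by simp
  have "(Suc r0 + (k + Suc r0 * (n - 1)) mod n) mod n = (Suc r0 + (k + Suc r0 * (n - 1))) mod n" by (rule mod_add_right_eq)
  also have "Suc r0 + (k + Suc r0 * (n - 1)) = k + Suc r0 * n" using n_pos by (cases n) auto
  also have "\<dots> mod n = k mod n" by (rule mod_mult_self1)
  finally show "(Suc r0 + (k + Suc r0 * (n - 1)) mod n) mod n = k mod n" .
qed

text \<open>Offset 0 is the edge after the rightmost one, so the rightmost edge has offset
  \<open>n - 1\<close>; horizontal and vertical edges alternate from there.\<close>

lemma rightmost_turns: "gR (n - 2)" "gD (n - 1)" "gL 0" "even n" "4 \<le> n"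
  and horizontal_iff: "gR k \<or> gL k \<longleftrightarrow> even k"
proof -
  let ?k = "r0 + n - 1"
  have k: "Suc ?k = r0 + n" using n_pos by simp
  have "vx (Suc ?k) = vx r0" "vx (Suc (Suc ?k)) = vx (Suc r0)" unfolding k by (rule vx_cong, simp add: Suc_add_mod)+
  then have "rightmost_edge J (vx (Suc ?k)) (vx (Suc (Suc ?k)))" using rightmost by simp
  note g = rightmost_edgeD[OF this]
  have "(Suc (Suc ?k)) mod n = (Suc r0 + 0) mod n" unfolding k by (simp add: Suc_add_mod)
  then show L: "gL 0" using g(3) goes_cong(2) by blast
  have "Suc r0 + (n - 1) = r0 + n" using n_pos by simp
  then show D: "gD (n - 1)" using g(2) k by simp
  have ex: "\<not> (goes_right k \<or> goes_left k) \<longleftrightarrow> goes_up k \<or> goes_down k" for k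
    using goes_cases[of k] by (auto simp: goes_dir)
  have hi: "gR k \<or> gL k \<longleftrightarrow> even k" for k
  proof (induction k)
    case (Suc k)
    have "gR (Suc k) \<or> gL (Suc k) \<longleftrightarrow> \<not> (gR k \<or> gL k)" using goes_turn[of "Suc r0 + k"] ex[of "Suc (Suc r0 + k)"] by auto
    also have "\<dots> \<longleftrightarrow> \<not> even k" by (simp only: Suc)
    finally show ?case by (simp only: even_Suc)
  qed (use L in simp)
  then show "gR k \<or> gL k \<longleftrightarrow> even k" by blast
  have "odd (n - 1)" using hi[of "n - 1"] D ex[of "Suc r0 + (n - 1)"] by blast
  then show ev: "even n" by auto
  have "2 \<le> n" using ev n_pos by presburger
  then have "Suc r0 + (n - 2) = ?k" by simp
  then show R: "gR (n - 2)" using g(1) by metis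
  have "n - 2 \<noteq> 0"
  proof
    assume 0: "n - 2 = 0"
    show False using R L unfolding 0 goes_dir by simp
  qed
  then show "4 \<le> n" using ev by presburger
qed

lemma vertical_iff: "gU k \<or> gD k \<longleftrightarrow> odd k"
  using horizontal_iff[of k] goes_cases[of "Suc r0 + k"] by (auto simp: goes_dir)

lemma no_LDR: "gL k \<Longrightarrow> gD (Suc k) \<Longrightarrow> \<not> gR (Suc (Suc k))"
  using right_notchI[of "Suc r0 + k"] bls unfolding bls_hole_def add_Suc_right by blast

lemma no_DRU: "gD k \<Longrightarrow> gR (Suc k) \<Longrightarrow> \<not> gU (Suc (Suc k))"
  using top_notchI[of "Suc r0 + k"] bls unfolding bls_hole_def add_Suc_right by blast

lemma DR_unique:
  assumes "gD k" "gR (Suc k)" "gD k'" "gR (Suc k')"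
  shows "Suc k mod n = Suc k' mod n"
proof -
  have "falling_corner J (vx (Suc r0 + Suc k))" "falling_corner J (vx (Suc r0 + Suc k'))"
    unfolding falling_corner_iff using assms by auto
  then have "vx (Suc r0 + Suc k) = vx (Suc r0 + Suc k')" using bls unfolding bls_hole_def by blast
  then show ?thesis unfolding vx_eq_iff by (rule offset_cancel)
qed

lemma RDL_unique:
  assumes "gR k" "gD (Suc k)" "gL (Suc (Suc k))" "Suc k < n"
  shows "Suc k = n - 1"
proof -
  let ?k = "n - 2"
  have k: "Suc ?k = n - 1" using rightmost_turns(5) by simp
  have "(Suc r0 + Suc (Suc ?k)) mod n = (Suc r0 + 0) mod n" unfolding k using n_pos by (simp add: Suc_add_mod)
  then have L: "gL (Suc (Suc ?k))" using rightmost_turns(3) goes_cong(2) by blast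
  have no: "\<nexists>a b. right_notch J a b" using bls unfolding bls_hole_def by blast
  have "gD (Suc ?k)" using rightmost_turns(2) unfolding k .
  then have "Suc (Suc r0 + k) mod n = Suc (Suc r0 + ?k) mod n"
    using rightmost_unique[OF no, of "Suc r0 + k" "Suc r0 + ?k"] assms(1-3) L rightmost_turns(1) unfolding add_Suc_right by blast
  then have "(Suc r0 + Suc k) mod n = (Suc r0 + Suc ?k) mod n" by simp
  then have "Suc k mod n = Suc ?k mod n" by (rule offset_cancel)
  then show ?thesis using assms(4) k n_pos by simp
qed

definition fc :: bool where "fc \<longleftrightarrow> (\<exists>v. falling_corner J v)"

text \<open>Each index stands for two edges. The top edge and the rightmost edge remain outside the
  chain, with a falling corner also the descent to it and the edge behind it.\<close>

definition N :: nat where "N = (if fc then n div 2 - 2 else n div 2 - 1)"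

text \<open>Before the downward edge the boundary goes right, or there were a right notch. After the
  rightward edge it goes down, or there were a top notch, and then left, or there were a second
  falling corner. Right, down, left identifies the rightmost edge and thereby the offsets.\<close>

lemma falling_pattern:
  assumes fc
  shows "6 \<le> n" "gR (n - 4)" "gD (n - 3)"
proof -
  obtain k0 where k0: "goes_down k0" "goes_right (Suc k0)" using assms unfolding fc_def falling_corner_iff by blast
  obtain m where m: "m < n" "(Suc r0 + m) mod n = k0 mod n" using offsetE .
  have "Suc (Suc r0 + m) mod n = Suc k0 mod n" using vx_Suc_cong[OF m(2)] unfolding vx_eq_iff .
  then have D: "gD m" and R: "gR (Suc m)" using k0 goes_cong(4)[OF m(2)] goes_cong(1)[of "Suc (Suc r0 + m)" "Suc k0"] by auto
  have "odd m" using D vertical_iff by blast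
  then obtain m1 where m1: "m = Suc m1" by (cases m) auto
  have "even m1" using \<open>odd m\<close> m1 by simp
  then have R1: "gR m1" using horizontal_iff[of m1] no_LDR[of m1] D R unfolding m1 by blast
  have D2: "gD (Suc (Suc m))" using no_DRU[OF D R] vertical_iff[of "Suc (Suc m)"] \<open>odd m\<close> by auto
  have n4: "4 \<le> n" "even n" by (rule rightmost_turns)+
  have "\<not> gR (Suc (Suc (Suc m)))"
  proof
    assume "gR (Suc (Suc (Suc m)))"
    then have "Suc m mod n = Suc (Suc (Suc m)) mod n" using DR_unique[OF D R D2] by blast
    then have "(Suc m + 0) mod n = (Suc m + 2) mod n" by simp
    from offset_cancel[OF this] show False using n4 by simp
  qed
  then have L3: "gL (Suc (Suc (Suc m)))" using horizontal_iff[of "Suc (Suc (Suc m))"] \<open>odd m\<close> by auto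
  have "m \<noteq> n - 1"
  proof
    assume "m = n - 1"
    then have "(Suc r0 + Suc m) mod n = (Suc r0 + 0) mod n" using n_pos by (simp add: Suc_add_mod)
    then have "gR 0" using R goes_cong(1) by blast
    then show False using rightmost_turns(3) by (simp add: goes_dir)
  qed
  then have "Suc (Suc m) < n" using m(1) \<open>odd m\<close> n4 by presburger
  then have "Suc (Suc m) = n - 1" using RDL_unique[OF R D2 L3] by blast
  then have mn: "m = n - 3" "m1 = n - 4" using m1 by auto
  show "gD (n - 3)" "gR (n - 4)" using D R1 mn by auto
  have "n - 4 \<noteq> 0"
  proof
    assume 0: "n - 4 = 0"
    show False using R1 rightmost_turns(3) unfolding mn 0 by (simp add: goes_dir)
  qed
  then show "6 \<le> n" using n4 by presburger
qed

lemma N_double: "2 * N = (if fc then n - 4 else n - 2)" "0 < N" "N < n div 2"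
proof -
  obtain m where m: "n = 2 * m" using rightmost_turns(4) by blast
  then have "n div 2 = m" by simp
  then show "2 * N = (if fc then n - 4 else n - 2)" "0 < N" "N < n div 2"
    using rightmost_turns(5) falling_pattern(1) by (cases fc; simp add: N_def m)+
qed

text \<open>A downward edge followed by a rightward one makes a falling corner, and the only one
  belongs to edge \<open>n - 3\<close>, which the chain leaves out.\<close>

lemma chain_down_left:
  assumes "gD k" "k < 2 * N"
  shows "gL (Suc k)"
proof (rule ccontr)
  assume n: "\<not> gL (Suc k)"
  have "odd k" using assms(1) vertical_iff by blast
  then have R: "gR (Suc k)" using n horizontal_iff[of "Suc k"] by auto
  have fc: fc unfolding fc_def falling_corner_iff using assms(1) R unfolding add_Suc_right by blast
  have "Suc (n - 3) = n - 2" using rightmost_turns(5) by simp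
  then have "Suc k mod n = (n - 2) mod n" using DR_unique[OF assms(1) R falling_pattern(3)[OF fc]] rightmost_turns(1) by simp
  then have "Suc k = n - 2" using assms(2) N_double(1) fc falling_pattern(1) by (simp split: if_splits)
  then show False using assms(2) N_double(1) fc by simp
qed

lemma chain_right_up:
  assumes "gR k" "Suc k < 2 * N"
  shows "gU (Suc k)"
proof (rule ccontr)
  assume "\<not> gU (Suc k)"
  moreover have "odd (Suc k)" using assms(1) horizontal_iff by auto
  ultimately have D: "gD (Suc k)" using vertical_iff by blast
  then have "gL (Suc (Suc k))" using chain_down_left assms(2) by blast
  then have "Suc k = n - 1" using RDL_unique[OF assms(1) D] assms(2) N_double(1) by (simp split: if_splits)
  then show False using assms(2) N_double(1) by (simp split: if_splits)
qed

section \<open>Coordinates of the chain\<close>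

definition cx :: "nat \<Rightarrow> int" where "cx k = X (Suc r0 + 2 * k)"
definition cy :: "nat \<Rightarrow> int" where "cy k = Y (Suc r0 + 2 * k)"

lemma odd_vertex: "X (Suc r0 + Suc (2 * k)) = cx (Suc k)" "Y (Suc r0 + Suc (2 * k)) = cy k"
proof -
  have "gU (Suc (2 * k)) \<or> gD (Suc (2 * k))" using vertical_iff[of "Suc (2 * k)"] by simp
  then show "X (Suc r0 + Suc (2 * k)) = cx (Suc k)" by (auto simp: goes_defs cx_def)
  have "gR (2 * k) \<or> gL (2 * k)" using horizontal_iff[of "2 * k"] by simp
  then show "Y (Suc r0 + Suc (2 * k)) = cy k" by (auto simp: goes_defs cy_def)
qed

lemma even_vertex: "X (Suc r0 + 2 * k) = cx k" "Y (Suc r0 + 2 * k) = cy k"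
  by (simp_all add: cx_def cy_def)

lemma even_vertex': "X (Suc (Suc r0 + Suc (2 * k))) = cx (Suc k)" "Y (Suc (Suc r0 + Suc (2 * k))) = cy (Suc k)"
  using even_vertex[of "Suc k"] by simp_all

lemma odd_vertex': "X (Suc (Suc r0 + 2 * k)) = cx (Suc k)" "Y (Suc (Suc r0 + 2 * k)) = cy k"
  using odd_vertex[of k] by simp_all

lemma chain_goes:
  "gR (2 * k) \<longleftrightarrow> cx k < cx (Suc k)" "gL (2 * k) \<longleftrightarrow> cx (Suc k) < cx k"
  "gU (Suc (2 * k)) \<longleftrightarrow> cy k < cy (Suc k)" "gD (Suc (2 * k)) \<longleftrightarrow> cy (Suc k) < cy k"
  unfolding goes_defs even_vertex odd_vertex even_vertex' odd_vertex' by auto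

lemma chain_steps: "cx k \<noteq> cx (Suc k)" "cy k \<noteq> cy (Suc k)"
  using horizontal_iff[of "2 * k"] vertical_iff[of "Suc (2 * k)"] unfolding chain_goes by auto

lemma chain_close: "cx (n div 2) = cx 0" "cy (n div 2) = cy 0"
proof -
  have "2 * (n div 2) = n" using rightmost_turns(4) by simp
  then show "cx (n div 2) = cx 0" "cy (n div 2) = cy 0"
    unfolding cx_def cy_def using goes_cong(5,6)[of "Suc r0 + n" "Suc r0"] by (simp_all add: Suc_add_mod)
qed

lemma on_piece_side:
  assumes "on_piece cx cy e a b"
  shows "pt (a, b) \<in> side (Suc r0 + e)"
proof (cases "even e")
  case True
  then obtain k where "e = 2 * k" by blast
  then show ?thesis using assms unfolding side_iff by (auto simp: on_piece_def even_vertex odd_vertex' pt_def simp del: add_Suc add_Suc_right)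
next
  case False
  then obtain k where "e = Suc (2 * k)" by (metis oddE Suc_eq_plus1)
  then show ?thesis using assms unfolding side_iff by (auto simp: on_piece_def odd_vertex even_vertex' pt_def simp del: add_Suc add_Suc_right)
qed

lemma chain_vertex_eq: "chain_vertex cx cy e = (X (Suc r0 + e), Y (Suc r0 + e))"
proof (cases "even e")
  case True
  then obtain k where "e = 2 * k" by blast
  then show ?thesis by (simp add: chain_vertex_def even_vertex del: add_Suc add_Suc_right)
next
  case False
  then obtain k where "e = Suc (2 * k)" by (metis oddE Suc_eq_plus1)
  then show ?thesis by (simp add: chain_vertex_def odd_vertex del: add_Suc add_Suc_right)
qed

lemma chain_above_left: "cx (Suc k) \<le> i \<Longrightarrow> i < cx k \<Longrightarrow> inn i (cy k) \<and> \<not> inn i (cy k - 1)"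
  using jump_left[of "Suc r0 + 2 * k" i] chain_goes(2)[of k] unfolding even_vertex odd_vertex' by linarith

lemma chain_below_right: "cx k \<le> i \<Longrightarrow> i < cx (Suc k) \<Longrightarrow> \<not> inn i (cy k) \<and> inn i (cy k - 1)"
  using jump_right[of "Suc r0 + 2 * k" i] chain_goes(1)[of k] unfolding even_vertex odd_vertex' by linarith

lemma chain_right_of_up: "cy k \<le> j \<Longrightarrow> j < cy (Suc k) \<Longrightarrow> inn (cx (Suc k)) j \<and> \<not> inn (cx (Suc k) - 1) j"
  using jump_up[of "Suc r0 + Suc (2 * k)" j] chain_goes(3)[of k] unfolding odd_vertex even_vertex' by linarith

lemma chain_right_of_down: "cy (Suc k) \<le> j \<Longrightarrow> j < cy k \<Longrightarrow> \<not> inn (cx (Suc k)) j"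
  using jump_down[of "Suc r0 + Suc (2 * k)" j] chain_goes(4)[of k] unfolding odd_vertex even_vertex' by linarith

lemma chain_change_vertical:
  assumes "inn i j \<noteq> inn i (j - 1)"
  shows "\<exists>k<n div 2. hcov cx k i \<and> cy k = j"
proof -
  obtain k0 where k0: "k0 < n" "Y k0 = j" "goes_right k0 \<and> X k0 \<le> i \<and> i < X (Suc k0) \<or> goes_left k0 \<and> X (Suc k0) \<le> i \<and> i < X k0"
    using inn_change_vertical[OF assms] .
  obtain m where m: "m < n" "(Suc r0 + m) mod n = k0 mod n" using offsetE .
  note c = goes_cong[OF m(2)]
  have c': "X (Suc (Suc r0 + m)) = X (Suc k0)" using vx_Suc_cong[OF m(2)] by (simp add: vx_XY)
  have "even m" using k0(3) c(1,2) horizontal_iff[of m] by blast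
  then obtain k where k: "m = 2 * k" by blast
  have "min (cx k) (cx (Suc k)) \<le> i \<and> i < max (cx k) (cx (Suc k))" "cy k = j"
    using k0(2,3) c' c(5,6) unfolding k even_vertex odd_vertex' by auto
  moreover have "k < n div 2" using m(1) k rightmost_turns(4) by auto
  ultimately show ?thesis unfolding hcov_def by blast
qed

lemma chain_change_horizontal:
  assumes "inn i j" "\<not> inn (i - 1) j"
  shows "\<exists>k<n div 2. cy k \<le> j \<and> j < cy (Suc k) \<and> cx (Suc k) = i"
proof -
  obtain k0 where k0: "k0 < n" "X k0 = i" "goes_up k0 \<and> Y k0 \<le> j \<and> j < Y (Suc k0) \<or> goes_down k0 \<and> Y (Suc k0) \<le> j \<and> j < Y k0"
    using inn_change_horizontal[of i j] assms by blast
  then have u: "goes_up k0" "Y k0 \<le> j" "j < Y (Suc k0)" using jump_down[of k0 j] assms by auto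
  obtain m where m: "m < n" "(Suc r0 + m) mod n = k0 mod n" using offsetE .
  note c = goes_cong[OF m(2)]
  have c': "Y (Suc (Suc r0 + m)) = Y (Suc k0)" using vx_Suc_cong[OF m(2)] by (simp add: vx_XY)
  have "odd m" using u(1) c(3) vertical_iff[of m] by blast
  then obtain k where k: "m = Suc (2 * k)" by (metis oddE Suc_eq_plus1)
  have "cy k \<le> j" "j < cy (Suc k)" "cx (Suc k) = i"
    using k0(2) u c' c(5,6) unfolding k odd_vertex even_vertex' by auto
  moreover have "k < n div 2" using m(1) k rightmost_turns(4) by auto
  ultimately show ?thesis by blast
qed

lemma chain_end:
  "cx N < cx (Suc N)" "\<not> fc \<Longrightarrow> Suc N = n div 2" "fc \<Longrightarrow> Suc (Suc N) = n div 2"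
  "fc \<Longrightarrow> cy (Suc N) < cy N" "fc \<Longrightarrow> cx (Suc N) < cx 0" "\<not> fc \<Longrightarrow> cx (Suc N) = cx 0"
  "\<not> fc \<Longrightarrow> cy (Suc N) < cy N" "fc \<Longrightarrow> cy (Suc (Suc N)) < cy (Suc N)"
proof -
  have n: "even n" "4 \<le> n" by (rule rightmost_turns)+
  show s1: "Suc N = n div 2" if "\<not> fc" using that n by (auto simp: N_def)
  show s2: "Suc (Suc N) = n div 2" if fc using that n falling_pattern(1) by (auto simp: N_def)
  have "gR (2 * N)" using N_double(1) rightmost_turns(1) falling_pattern(2) by auto
  then show "cx N < cx (Suc N)" unfolding chain_goes .
  show "cx (Suc N) = cx 0" if "\<not> fc" using s1[OF that] chain_close(1) by simp
  show "cy (Suc N) < cy N" if "\<not> fc"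
  proof -
    have "Suc (2 * N) = n - 1" using N_double(1) that n by simp
    then show ?thesis using rightmost_turns(2) chain_goes(4)[of N] by simp
  qed
  show "cy (Suc N) < cy N" if fc
  proof -
    have "Suc (2 * N) = n - 3" using N_double(1) that falling_pattern(1) by simp
    then show ?thesis using falling_pattern(3)[OF that] chain_goes(4)[of N] by simp
  qed
  show "cx (Suc N) < cx 0" if fc
  proof -
    have "2 * Suc N = n - 2" using N_double(1) that falling_pattern(1) by simp
    then have "cx (Suc N) < cx (Suc (Suc N))" using rightmost_turns(1) chain_goes(1)[of "Suc N"] by simp
    then show ?thesis using s2[OF that] chain_close(1) by simp
  qed
  show "cy (Suc (Suc N)) < cy (Suc N)" if fc
  proof -
    have "Suc (2 * Suc N) = n - 1" using N_double(1) that falling_pattern(1) by simp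
    then show ?thesis using rightmost_turns(2) chain_goes(4)[of "Suc N"] by simp
  qed
qed

definition c2 :: int where "c2 = (if fc then cy (Suc N) else cy N)"

lemma bls_chain_boundary:
  assumes w: "0 < w" "0 < h"
  shows "bls_chain N cx cy inn (cx (Suc N)) c2 w h"
proof unfold_locales
  fix k assume k: "k < N"
  show "cx k \<noteq> cx (Suc k)" "cy k \<noteq> cy (Suc k)" by (rule chain_steps)+
  show "cy k < cy (Suc k)" if "cx k < cx (Suc k)"
    using chain_right_up[of "2 * k"] that k unfolding chain_goes by simp
next
  fix k assume k: "Suc k < N" "cy (Suc k) < cy k"
  have "gL (Suc (Suc (2 * k)))" using chain_down_left[of "Suc (2 * k)"] k unfolding chain_goes by simp
  then show "cx (Suc (Suc k)) < cx (Suc k)" using chain_goes(2)[of "Suc k"] by simp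
next
  fix e e' a b assume e: "e < e'" "e' < 2 * N" "on_piece cx cy e a b" "on_piece cx cy e' a b"
  \<comment> \<open>At least the last two edges are missing from the chain, so no two of its pieces
    are neighbours by wrapping around.\<close>
  have lt: "Suc e' < n" using e(2) N_double(1) by (simp split: if_splits)
  have inj: "l = l'" if "(Suc r0 + l) mod n = (Suc r0 + l') mod n" "l < n" "l' < n" for l l'
    using offset_cancel[OF that(1)] that(2,3) by simp
  have ne: "(Suc r0 + e) mod n \<noteq> (Suc r0 + e') mod n" using inj[of e e'] e(1) lt by linarith
  from sides_meet_int[OF on_piece_side[OF e(3)] on_piece_side[OF e(4)] ne]
  show "e' = Suc e \<and> (a, b) = chain_vertex cx cy e'"
  proof
    assume a: "(a, b) = (X (Suc r0 + e'), Y (Suc r0 + e')) \<and> (Suc r0 + e') mod n = Suc (Suc r0 + e) mod n"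
    then have "(Suc r0 + e') mod n = (Suc r0 + Suc e) mod n" by simp
    from inj[OF this] have "e' = Suc e" using lt e(1) by linarith
    then show ?thesis using a chain_vertex_eq by simp
  next
    assume "(a, b) = (X (Suc r0 + e), Y (Suc r0 + e)) \<and> (Suc r0 + e) mod n = Suc (Suc r0 + e') mod n"
    then have "(Suc r0 + e) mod n = (Suc r0 + Suc e') mod n" by simp
    from inj[OF this] have "e = Suc e'" using lt e(1) by linarith
    then show ?thesis using e(1) by simp
  qed
next
  show "0 < N" by (rule N_double)
  show "cx 1 < cx 0" using rightmost_turns(3) chain_goes(2)[of 0] by simp
  show "cx N < cx (Suc N)" by (rule chain_end)
  show "cx (Suc N) \<le> cx 0" using chain_end(5,6) by (cases fc) auto
  show "c2 \<le> cy N" using chain_end(4) by (auto simp: c2_def)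
  show "\<exists>B. \<forall>i j. inn i j \<longrightarrow> j < B" by (rule inn_bounded)
  show "0 < w" "0 < h" by fact+
next
  fix i j assume "inn i j \<noteq> inn i (j - 1)"
  then obtain k where k: "k < n div 2" "hcov cx k i" "cy k = j" using chain_change_vertical by blast
  \<comment> \<open>Index \<open>N\<close> is the top edge, \<open>Suc N\<close> the edge from the
    falling corner to the rightmost edge.\<close>
  have "k < N \<or> k = N \<or> fc \<and> k = Suc N" using k(1) chain_end(2,3) by (cases fc) linarith+
  then show "(\<exists>k<N. hcov cx k i \<and> cy k = j) \<or> cx N \<le> i \<and> i < cx (Suc N) \<and> j = cy N \<or> cx (Suc N) \<le> i \<and> i < cx 0 \<and> j = c2"
  proof (elim disjE)
    assume "k = N" then show ?thesis using k chain_end(1) by (auto simp: hcov_def)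
  next
    assume "fc \<and> k = Suc N"
    then show ?thesis using k chain_end(3,5) chain_close(1) by (auto simp: hcov_def c2_def)
  qed (use k in blast)
next
  fix i j assume "inn i j" "\<not> inn (i - 1) j"
  then obtain k where k: "k < n div 2" "cy k \<le> j" "j < cy (Suc k)" "cx (Suc k) = i" using chain_change_horizontal by blast
  have "k < N \<or> k = N \<or> fc \<and> k = Suc N" using k(1) chain_end(2,3) by (cases fc) linarith+
  \<comment> \<open>The vertical edges that close the boundary all go down.\<close>
  moreover have "k \<noteq> N" using k chain_end(4,7) by (cases fc) auto
  moreover have "\<not> (fc \<and> k = Suc N)" using k chain_end(8) by auto
  ultimately show "\<exists>k<N. cy k \<le> j \<and> j < cy (Suc k) \<and> cx (Suc k) = i" using k by blast
qed (use chain_above_left chain_below_right chain_right_of_up chain_right_of_down in blast)+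

lemma stored_chain_boundary:
  assumes w: "0 < w" "0 < h" and st: "stores_vertices m ns vs" and cells: "distinct (node_cells ns)" "set (node_cells ns) \<subseteq> {0<..<B}"
  shows "stored_chain N cx cy inn (cx (Suc N)) c2 w h m B (\<lambda>k. cyc ns (Suc r0 + 2 * k)) (\<lambda>k. cyc ns (Suc r0 + Suc (2 * k)))"
    and "m (cyc ns i) = X i" "m (cyc ns i + 1) = Y i" "m (cyc ns i + 2) = cyc ns (Suc i)" "m (cyc ns (Suc i) + 3) = cyc ns i" "0 < cyc ns i"
proof -
  have len: "length ns = n" and nodes: "\<And>i. i < n \<Longrightarrow> m (ns ! i) = fst (vs ! i) \<and> m (ns ! i + 1) = snd (vs ! i) \<and>
      m (ns ! i + 2) = cyc ns (i + 1) \<and> m (ns ! i + 3) = cyc ns (i + n - 1)"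
    using st by (auto simp: stores_vertices_def)
  have cong: "cyc ns k = cyc ns l" if "k mod n = l mod n" for k l using that by (simp add: cyc_def len)
  have nth: "cyc ns k = ns ! (k mod n)" for k by (simp add: cyc_def len)
  have node: "m (cyc ns k) = X k" "m (cyc ns k + 1) = Y k" "m (cyc ns k + 2) = cyc ns (Suc k)" "m (cyc ns (Suc k) + 3) = cyc ns k" for k
  proof -
    have lt: "k mod n < n" "Suc k mod n < n" using n_pos by simp_all
    show "m (cyc ns k) = X k" "m (cyc ns k + 1) = Y k" using nodes[OF lt(1)] by (auto simp: X_def Y_def cyc_def len)
    have "cyc ns (k mod n + 1) = cyc ns (Suc k)" by (rule cong) (simp add: mod_Suc_eq)
    then show "m (cyc ns k + 2) = cyc ns (Suc k)" using nodes[OF lt(1)] by (simp add: nth[of k])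
    have "Suc k mod n + n - 1 = Suc k mod n + (n - 1)" "Suc k + (n - 1) = k + n" using n_pos by linarith+
    then have "(Suc k mod n + n - 1) mod n = (Suc k mod n + (n - 1)) mod n" by simp
    also have "\<dots> = (Suc k + (n - 1)) mod n" by (rule mod_add_left_eq)
    also have "\<dots> = k mod n" by (simp only: \<open>Suc k + (n - 1) = k + n\<close> mod_add_self2)
    finally have "cyc ns (Suc k mod n + n - 1) = cyc ns k" by (rule cong)
    then show "m (cyc ns (Suc k) + 3) = cyc ns k" using nodes[OF lt(2)] by (simp add: nth[of "Suc k"])
  qed
  have inB: "0 < cyc ns k" "cyc ns k + 3 < B" for k
  proof -
    have "cyc ns k \<in> set ns" using n_pos by (simp add: nth len)
    then have "cyc ns k \<in> set (node_cells ns)" "cyc ns k + 3 \<in> set (node_cells ns)" by (auto simp: node_cells_def)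
    then show "0 < cyc ns k" "cyc ns k + 3 < B" using cells(2) by auto
  qed
  show "m (cyc ns i) = X i" "m (cyc ns i + 1) = Y i" "m (cyc ns i + 2) = cyc ns (Suc i)" "m (cyc ns (Suc i) + 3) = cyc ns i" "0 < cyc ns i"
    by (rule node inB)+
  have dist: "distinct ns"
  proof -
    have "distinct (node_cells l) \<Longrightarrow> distinct l" for l by (induction l) (auto simp: node_cells_def)
    then show ?thesis using cells(1) .
  qed
  interpret bls_chain N cx cy inn "cx (Suc N)" c2 w h by (rule bls_chain_boundary[OF w])
  show "stored_chain N cx cy inn (cx (Suc N)) c2 w h m B (\<lambda>k. cyc ns (Suc r0 + 2 * k)) (\<lambda>k. cyc ns (Suc r0 + Suc (2 * k)))"
  proof unfold_locales
    fix k
    let ?a = "cyc ns (Suc r0 + 2 * k)" and ?b = "cyc ns (Suc r0 + Suc (2 * k))"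
    show "0 < ?a \<and> ?a + 3 < B \<and> m ?a = cx k \<and> m (?a + 1) = cy k" using inB[of "Suc r0 + 2 * k"] node(1,2)[of "Suc r0 + 2 * k"] even_vertex by metis
    show "m (?a + 2) = ?b" using node(3)[of "Suc r0 + 2 * k"] by simp
    have "m ?b = cx (Suc k)" using node(1)[of "Suc r0 + Suc (2 * k)"] odd_vertex(1) by metis
    moreover have "m (?b + 2) = cyc ns (Suc r0 + 2 * Suc k)" using node(3)[of "Suc r0 + Suc (2 * k)"] by simp
    ultimately show "0 < ?b \<and> ?b + 3 < B \<and> m ?b = cx (Suc k) \<and> m (?b + 2) = cyc ns (Suc r0 + 2 * Suc k)"
      using inB[of "Suc r0 + Suc (2 * k)"] by blast
    assume k: "k < N"
    \<comment> \<open>The loop stops by comparing addresses, so the end node must not occur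
      earlier.\<close>
    show "?a \<noteq> cyc ns (Suc r0 + 2 * N)"
    proof
      assume "?a = cyc ns (Suc r0 + 2 * N)"
      then have "(Suc r0 + 2 * k) mod n = (Suc r0 + 2 * N) mod n"
        using dist n_pos by (simp only: nth len nth_eq_iff_index_eq mod_less_divisor)
      then have "2 * k mod n = 2 * N mod n" by (rule offset_cancel)
      then show False using k N_double(3) by simp
    qed
  qed
qed

end

theorem mainTheorem13:
  "\<exists>(prog :: com) (C :: nat). \<forall>(J :: point set) (w :: int) (h :: int) (s :: state).
     bls_hole J \<and> integral_vertices J \<and> 0 < w \<and> 0 < h \<and> encodes s J w h \<longrightarrow>
     (\<exists>t s'. exec prog s t s' \<and> t \<le> C * nv J \<and>
        reported s' = {p. bl_stable (hole J) (real_of_int w) (real_of_int h) p})"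
proof (rule exI[of _ main_com], rule exI[of _ 2000], intro allI impI)
  fix J w h s
  assume asm: "bls_hole J \<and> integral_vertices J \<and> 0 < w \<and> 0 < h \<and> encodes s J w h"
  then have w: "0 < w" "0 < h" and bls: "bls_hole J" by auto
  from asm obtain vs ns k l where vs: "cw_vertex_list J vs" and st: "stores_vertices (mem s) ns vs"
    and r01: "reg s 0 = w" "reg s 1 = h"
    and r7: "\<exists>i<length vs. rightmost_edge J (pt (cyc vs i)) (pt (cyc vs (i + 1))) \<and> reg s 7 = ns ! i"
    and r8: "if \<exists>v. falling_corner J v
      then \<exists>i<length vs. falling_corner J (pt (vs ! i)) \<and> reg s 8 = ns ! i
      else reg s 8 = 0"
    and dis: "distinct (node_cells ns @ array_cells (reg s 3) k @ array_cells (reg s 5) l)"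
    and sub: "set (node_cells ns @ array_cells (reg s 3) k @ array_cells (reg s 5) l) \<subseteq> {0<..<reg s 9}"
    unfolding encodes_def by blast
  obtain r0 where r0: "r0 < length vs" "rightmost_edge J (pt (cyc vs r0)) (pt (cyc vs (r0 + 1)))" "reg s 7 = ns ! r0" using r7 by blast
  have "rectilinear J" using bls by (simp add: rectilinear_def bls_hole_def)
  then interpret vertex_list J vs
    using vs r0(1) by (intro vertex_list.intro vertex_list_axioms.intro) auto
  interpret bls_list J vs r0
    by unfold_locales (use bls r0(2) in \<open>auto simp: vx_def\<close>)
  have dn: "distinct (node_cells ns)" "set (node_cells ns) \<subseteq> {0<..<reg s 9}" using dis sub by auto
  note sc = stored_chain_boundary[OF w st dn]
  note node = sc(2-6)
  interpret stored_chain N cx cy inn "cx (Suc N)" c2 w h "mem s" "reg s 9" "\<lambda>k. cyc ns (Suc r0 + 2 * k)" "\<lambda>k. cyc ns (Suc r0 + Suc (2 * k))"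
    by (rule sc(1))
  have len: "length ns = length vs" using st by (simp add: stores_vertices_def)
  have reg7: "reg s 7 = cyc ns r0" using r0 by (simp add: cyc_def len)
  have per: "cyc ns (i + n) = cyc ns i" for i by (simp add: cyc_def len)
  have prev: "mem s (cyc ns i + 3) = cyc ns (i + n - 1)" for i
    using node(4)[of "i + n - 1"] n_pos per[of i] by simp
  have n4: "4 \<le> n" by (rule rightmost_turns)
  have c: "if 0 < reg s 8
    then mem s (mem s (mem s (reg s 7 + 3) + 3) + 3) = cyc ns (Suc r0 + 2 * N) \<and> mem s (reg s 8) = cx (Suc N) \<and> mem s (reg s 8 + 1) = c2
    else mem s (reg s 7 + 3) = cyc ns (Suc r0 + 2 * N) \<and> cx (Suc N) = cx 0 \<and> c2 = cy N"
  proof (cases fc)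
    case True
    then obtain i where i: "i < n" "falling_corner J (pt (vs ! i))" "reg s 8 = ns ! i" using r8 unfolding fc_def by auto
    have r: "reg s 8 = cyc ns i" using i by (simp add: cyc_def len)
    have n6: "6 \<le> n" and D: "gD (n - 3)" using falling_pattern[OF True] by auto
    have e: "Suc (2 * N) = n - 3" "Suc (n - 3) = n - 2" "2 * Suc N = n - 2" using N_double(1) True n6 by auto
    \<comment> \<open>The falling corner of the input is the only one, hence the vertex located by
      \<open>falling_pattern\<close>.\<close>
    have "falling_corner J (vx (Suc r0 + (n - 2)))"
      unfolding falling_corner_iff using D rightmost_turns(1) e(2) by (intro exI[of _ "Suc r0 + (n - 3)"]) (metis add_Suc_right)
    then have "pt (vs ! i) = vx (Suc r0 + (n - 2))" using bls i(2) unfolding bls_hole_def by blast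
    then have "vx i = vx (Suc r0 + 2 * Suc N)" using i(1) by (simp only: e(3)) (simp add: vx_def cyc_def)
    then have "X i = cx (Suc N)" "Y i = c2" using True unfolding vx_XY even_vertex by (simp_all add: c2_def)
    moreover have "mem s (mem s (mem s (reg s 7 + 3) + 3) + 3) = cyc ns (Suc r0 + 2 * N)"
    proof -
      \<comment> \<open>Going back from the upper end of the rightmost edge, three predecessors pass
        the falling corner and the right end of the top edge and reach its left end.\<close>
      have i: "Suc r0 + 2 * N = r0 + n - 3" "r0 + n - 1 + n - 1 = r0 + n - 2 + n" "r0 + n - 2 + n - 1 = r0 + n - 3 + n"
        using e(1) n6 by linarith+
      show ?thesis unfolding reg7 prev i per ..
    qed
    ultimately show ?thesis using node(1,2,5)[of i] unfolding r by simp
  next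
    case False
    then have "reg s 8 = 0" using r8 unfolding fc_def by simp
    moreover have "Suc r0 + 2 * N = r0 + n - 1" using N_double(1) False n4 by simp
    ultimately show ?thesis using chain_end(6)[OF False] False unfolding reg7 prev by (simp add: c2_def)
  qed
  have m7: "mem s (reg s 7 + 2) = cyc ns (Suc r0 + 2 * 0)" "mem s (reg s 7) = cx 0"
  proof -
    show "mem s (reg s 7 + 2) = cyc ns (Suc r0 + 2 * 0)" unfolding reg7 node by simp
    \<comment> \<open>Register 7 holds the upper end of the rightmost edge, which has the abscissa
      of the start of the chain.\<close>
    have "goes_down (Suc r0 + (n - 1))" by (rule rightmost_turns)
    then have "X (Suc (Suc r0 + (n - 1))) = X (Suc r0 + (n - 1))" by (simp add: goes_defs)
    moreover have "Suc r0 + (n - 1) = r0 + n" using n_pos by linarith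
    moreover from this have "(Suc r0 + (n - 1)) mod n = r0 mod n" "Suc (Suc r0 + (n - 1)) mod n = Suc r0 mod n" by (simp_all only: Suc_add_mod mod_add_self2)
    ultimately have "X r0 = X (Suc r0)" using goes_cong(5) by metis
    then show "mem s (reg s 7) = cx 0" unfolding reg7 node by (simp add: cx_def)
  qed
  obtain t s' where t: "exec main_com s t s'" "t \<le> 2000 * N + 1000" "reported s' = pt ` {(p, q). stable p q}"
    using main_ter[OF refl r01 refl m7 c] by blast
  \<comment> \<open>By \<open>N < n div 2\<close> the bound \<open>2000 * N + 1000\<close> is even
    below \<open>1000 * n\<close>.\<close>
  have "t \<le> 2000 * nv J" using t(2) N_double(3) n4 unfolding nv_eq by linarith
  moreover have "stable p q = grid_stable w h p q" for p q by (simp add: stable_def grid_stable_def)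
  ultimately show "\<exists>t s'. exec main_com s t s' \<and> t \<le> 2000 * nv J \<and> reported s' = {p. bl_stable (hole J) (real_of_int w) (real_of_int h) p}"
    using t(1,3) bl_stable_iff[OF w] by auto
qed

end
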